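(* Let $R, C_1, C_2, C$ be closed surfaces and let $p:R\to C_1$, $q:R\to C_2$, $f:C_1\to C$, $g:C_2\to C$ be branched covering maps such that $\deg f\ge 2$, $f\circ p=g\circ q$, the maps $p$ and $q$ have no non-trivial common compositional right factor, and $\deg p=\deg g$. Then for every $z\in C_1$ the equality of partitions $$\mu_{p,z}=\mu_{g,f(z)}^{\deg_z f}$$ holds. Moreover, $f:\mathcal O_2^p\to\mathcal O_2^g$ and $q:\mathcal O_1^p\to\mathcal O_1^g$ are minimal holomorphic maps between orbifolds.
   Context: A surface is an oriented connected two-dimensional topological manifold without boundary; closed means compact. A continuous map $f:R\to C$ between surfaces is a branched covering map if every $y\in C$ has an open neighborhood $V$ such that $f^{-1}(V)$ is a disjoint union of open sets $U_i$, $i\in I$ ($I\neq\emptyset$), each $U_i$ contains exactly one point $x_i$ of $f^{-1}\{y\}$, and there are orientation-preserving homeomorphisms $\varphi_i:U_i\to\mathbb D$, $\psi_i:V\to\mathbb D$ onto the open unit disk with $\varphi_i(x_i)=\psi_i(y)=0$ and $(\psi_i\circ f\circ\varphi_i^{-1})(z)=z^{d_i}$ for some integer $d_i\ge1$. The integer $d_i$ is the local degree $\deg_{x_i}f$. For closed surfaces, $\deg f$ is the (global) degree, i.e. $\sum_{x\in f^{-1}\{y\}}\deg_x f$ for any $y$. Branched covering maps $p:R\to C_1$ and $q:R\to C_2$ between closed surfaces have no non-trivial common compositional right factor if whenever $p=\tilde p\circ w$, $q=\tilde q\circ w$ with branched covering maps $w:R\to\tilde R$, $\tilde p:\tilde R\to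 C_1$, $\tilde q:\tilde R\to C_2$ between closed surfaces, one has $\deg w=1$. A (surface) orbifold is a pair $\mathcal O=(R,\nu)$ of a surface $R$ and a function $\nu:R\to\mathbb N$ (positive integers) with $\nu(z)=1$ except at isolated points. For a branched covering map $f:R_1\to R_2$ and orbifolds $\mathcal O_1=(R_1,\nu_1)$, $\mathcal O_2=(R_2,\nu_2)$, the map $f:\mathcal O_1\to\mathcal O_2$ is a minimal holomorphic map between orbifolds if $\nu_2(f(z))=\nu_1(z)\gcd(\deg_z f,\nu_2(f(z)))$ for all $z\in R_1$. For a branched covering map $f:R_1\to R_2$ between closed surfaces, the orbifolds $\mathcal O_1^f=(R_1,\nu_1^f)$ and $\mathcal O_2^f=(R_2,\nu_2^f)$ are defined by: $\nu_2^f(z)$ is the least common multiple of the local degrees of $f$ at the points of $f^{-1}\{z\}$, and $\nu_1^f(z)=\nu_2^f(f(z))/\deg_z f$. For $z\in R_2$, $\mu_{f,z}$ denotes the partition of $\deg f$ given by the collection of local degrees of $f$ at the points of $f^{-1}\{z\}$. For a partition $\mu=(a_1,\dots,a_k)$ of $n\ge1$ and an integer $d\ge1$, $\mu^d$ is the partition of $n$ obtained by replacing each $a_i$ by the number $\mathrm{lcm}(a_i,d)/d$ taken $\gcd(a_i,d)$ times. *)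

theory Defs
  imports "HOL-Complex_Analysis.Complex_Analysis" "HOL-Library.Multiset"
    "HOL-Library.Disjoint_Sets"
begin

section \<open>Oriented surfaces\<close>

text \<open>
  A homeomorphism between open subsets of the complex plane preserves the orientation iff the image
  of every small positively oriented circle winds once, in the positive direction, around the image
  of its centre. Note that \<^const>\<open>winding_number\<close> is defined for arbitrary continuous paths.
\<close>

definition orientation_preserving_on :: "complex set \<Rightarrow> (complex \<Rightarrow> complex) \<Rightarrow> bool" where
  "orientation_preserving_on S h \<longleftrightarrow>
     (\<forall>z\<in>S. \<forall>r>0. cball z r \<subseteq> S \<longrightarrow> winding_number (h \<circ> circlepath z r) (h z) = 1)"

text \<open>
  The orientation is given by an atlas of pairs \<open>(U, \<phi>)\<close> whose transition maps preserve the
  orientation. The atlas need not be maximal; the values of \<open>\<phi>\<close> outside \<open>U\<close> are irrelevant.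
\<close>

record 'a surface =
  surf_top :: "'a topology"
  surf_atlas :: "('a set \<times> ('a \<Rightarrow> complex)) set"

definition oriented_atlas :: "'a topology \<Rightarrow> ('a set \<times> ('a \<Rightarrow> complex)) set \<Rightarrow> bool" where
  "oriented_atlas X A \<longleftrightarrow>
     (\<Union>(U, \<phi>)\<in>A. U) = topspace X \<and>
     (\<forall>(U, \<phi>)\<in>A. openin X U \<and> open (\<phi> ` U) \<and>
        homeomorphic_map (subtopology X U) (top_of_set (\<phi> ` U)) \<phi>) \<and>
     (\<forall>(U, \<phi>)\<in>A. \<forall>(W, \<theta>)\<in>A.
        orientation_preserving_on (\<theta> ` (U \<inter> W)) (\<phi> \<circ> inv_into W \<theta>))"

definition is_surface :: "'a surface \<Rightarrow> bool" where
  "is_surface S \<longleftrightarrow>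
     topspace (surf_top S) \<noteq> {} \<and> connected_space (surf_top S) \<and>
     Hausdorff_space (surf_top S) \<and> second_countable (surf_top S) \<and>
     oriented_atlas (surf_top S) (surf_atlas S)"

definition closed_surface :: "'a surface \<Rightarrow> bool" where
  "closed_surface S \<longleftrightarrow> is_surface S \<and> compact_space (surf_top S)"

abbreviation points :: "'a surface \<Rightarrow> 'a set" where
  "points S \<equiv> topspace (surf_top S)"

definition disk_chart :: "'a surface \<Rightarrow> 'a set \<Rightarrow> ('a \<Rightarrow> complex) \<Rightarrow> bool" where
  "disk_chart S U \<phi> \<longleftrightarrow>
     openin (surf_top S) U \<and>
     homeomorphic_map (subtopology (surf_top S) U) (top_of_set (ball 0 1)) \<phi> \<and>
     (\<forall>(W, \<theta>)\<in>surf_atlas S.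
        orientation_preserving_on (\<theta> ` (U \<inter> W)) (\<phi> \<circ> inv_into W \<theta>))"


section \<open>Branched covering maps\<close>

definition fiber :: "'a surface \<Rightarrow> ('a \<Rightarrow> 'b) \<Rightarrow> 'b \<Rightarrow> 'a set" where
  "fiber R f y = {x \<in> points R. f x = y}"

definition branched_sheet ::
  "'a surface \<Rightarrow> 'b surface \<Rightarrow> ('a \<Rightarrow> 'b) \<Rightarrow> 'a set \<Rightarrow> 'a \<Rightarrow> 'b set \<Rightarrow> 'b \<Rightarrow> nat \<Rightarrow> bool" where
  "branched_sheet R C f U x V y d \<longleftrightarrow>
     openin (surf_top R) U \<and> openin (surf_top C) V \<and> f ` U \<subseteq> V \<and>
     U \<inter> fiber R f y = {x} \<and> 1 \<le> d \<and>
     (\<exists>\<phi> \<psi>. disk_chart R U \<phi> \<and> disk_chart C V \<psi> \<and> \<phi> x = 0 \<and> \<psi> y = 0 \<and>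
        (\<forall>z\<in>ball 0 1. (\<psi> \<circ> f \<circ> inv_into U \<phi>) z = z ^ d))"

definition branched_covering :: "'a surface \<Rightarrow> 'b surface \<Rightarrow> ('a \<Rightarrow> 'b) \<Rightarrow> bool" where
  "branched_covering R C f \<longleftrightarrow>
     is_surface R \<and> is_surface C \<and> continuous_map (surf_top R) (surf_top C) f \<and>
     (\<forall>y\<in>points C. \<exists>V \<U>.
        openin (surf_top C) V \<and> y \<in> V \<and>
        \<U> \<noteq> {} \<and> disjoint \<U> \<and> \<Union>\<U> = {x \<in> points R. f x \<in> V} \<and>
        (\<forall>U\<in>\<U>. \<exists>x d. branched_sheet R C f U x V y d))"

definition local_degree :: "'a surface \<Rightarrow> 'b surface \<Rightarrow> ('a \<Rightarrow> 'b) \<Rightarrow> 'a \<Rightarrow> nat" where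
  "local_degree R C f x = (THE d. \<exists>U V. branched_sheet R C f U x V (f x) d)"

definition global_degree :: "'a surface \<Rightarrow> 'b surface \<Rightarrow> ('a \<Rightarrow> 'b) \<Rightarrow> nat" where
  "global_degree R C f =
     (THE n. \<forall>y\<in>points C. (\<Sum>x\<in>fiber R f y. local_degree R C f x) = n)"

text \<open>
  The intermediate surface \<open>T\<close> is quantified over the carrier type of \<open>R\<close>. This loses no
  generality: branched covering maps are surjective, so every \<open>T\<close> admitting a branched covering
  map \<open>w\<close> from \<open>R\<close> is in bijection with a subset of \<open>points R\<close>, and its structure can
  be transported there (lemma \<open>no_common_right_factorD\<close> below).
\<close>

definition no_common_right_factor ::
  "'a surface \<Rightarrow> 'b surface \<Rightarrow> 'c surface \<Rightarrow> ('a \<Rightarrow> 'b) \<Rightarrow> ('a \<Rightarrow> 'c) \<Rightarrow> bool" where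
  "no_common_right_factor R C1 C2 p q \<longleftrightarrow>
     (\<forall>(T :: 'a surface) w p' q'.
        closed_surface T \<and> branched_covering R T w \<and>
        branched_covering T C1 p' \<and> branched_covering T C2 q' \<and>
        (\<forall>x\<in>points R. p x = p' (w x)) \<and> (\<forall>x\<in>points R. q x = q' (w x)) \<longrightarrow>
        global_degree R T w = 1)"


subsection \<open>Independence of the carrier type of the intermediate surface\<close>

definition surface_iso ::
  "'a surface \<Rightarrow> 'b surface \<Rightarrow> ('a \<Rightarrow> 'b) \<Rightarrow> ('b \<Rightarrow> 'a) \<Rightarrow> bool" where
  "surface_iso T T' j k \<longleftrightarrow>
     homeomorphic_maps (surf_top T) (surf_top T') j k \<and>
     oriented_atlas (surf_top T) (surf_atlas T) \<and> oriented_atlas (surf_top T') (surf_atlas T') \<and>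
     (\<forall>(W, \<theta>)\<in>surf_atlas T. \<exists>\<theta>'. (j ` W, \<theta>') \<in> surf_atlas T' \<and> (\<forall>x\<in>W. \<theta>' (j x) = \<theta> x)) \<and>
     (\<forall>(W, \<theta>)\<in>surf_atlas T'. \<exists>\<theta>'. (k ` W, \<theta>') \<in> surf_atlas T \<and> (\<forall>x\<in>W. \<theta>' (k x) = \<theta> x))"

lemma surface_iso_sym: "surface_iso T T' j k \<Longrightarrow> surface_iso T' T k j"
  unfolding surface_iso_def
  by (elim conjE, intro conjI) (assumption | rule homeomorphic_maps_sym[THEN iffD1])+

lemma surface_iso_chart:
  assumes "surface_iso T T' j k" "(W, \<theta>) \<in> surf_atlas T'"
  obtains \<theta>' where "(k ` W, \<theta>') \<in> surf_atlas T" "\<And>x. x \<in> W \<Longrightarrow> \<theta>' (k x) = \<theta> x"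
proof -
  have "\<forall>(W, \<theta>)\<in>surf_atlas T'. \<exists>\<theta>'. (k ` W, \<theta>') \<in> surf_atlas T \<and> (\<forall>x\<in>W. \<theta>' (k x) = \<theta> x)"
    using assms(1) unfolding surface_iso_def by (elim conjE)
  from bspec[OF this assms(2)] show thesis using that by blast
qed

lemma branched_coveringE:
  assumes "branched_covering R C f" "y \<in> points C"
  obtains V \<U> where "openin (surf_top C) V" "y \<in> V" "\<U> \<noteq> {}" "disjoint \<U>"
    "\<Union>\<U> = {x \<in> points R. f x \<in> V}" "\<forall>U\<in>\<U>. \<exists>x d. branched_sheet R C f U x V y d"
proof -
  have "\<forall>y\<in>points C. \<exists>V \<U>.
        openin (surf_top C) V \<and> y \<in> V \<and>
        \<U> \<noteq> {} \<and> disjoint \<U> \<and> \<Union>\<U> = {x \<in> points R. f x \<in> V} \<and>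
        (\<forall>U\<in>\<U>. \<exists>x d. branched_sheet R C f U x V y d)"
    using assms(1) unfolding branched_covering_def by (elim conjE)
  from bspec[OF this assms(2)] show thesis
    by (elim exE conjE) (rule that)
qed

lemma orientation_preserving_on_cong:
  assumes "orientation_preserving_on S h" "\<And>z. z \<in> S \<Longrightarrow> h z = h' z"
  shows "orientation_preserving_on S h'"
  unfolding orientation_preserving_on_def
proof (intro ballI allI impI)
  fix z r assume z: "z \<in> S" and r: "r > (0::real)" and sub: "cball z r \<subseteq> S"
  have "circlepath z r t \<in> cball z r" for t
    using r by (simp add: circlepath dist_norm norm_mult)
  then have "circlepath z r t \<in> S" for t using sub by blast
  then have "h' \<circ> circlepath z r = h \<circ> circlepath z r"
    using assms(2) by (simp add: fun_eq_iff)
  then show "winding_number (h' \<circ> circlepath z r) (h' z) = 1"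
    using assms z r sub unfolding orientation_preserving_on_def by metis
qed

lemma homeomorphic_maps_facts:
  assumes "homeomorphic_maps X Y j k"
  shows "\<And>x. x \<in> topspace X \<Longrightarrow> k (j x) = x" "\<And>y. y \<in> topspace Y \<Longrightarrow> j (k y) = y"
    "\<And>x. x \<in> topspace X \<Longrightarrow> j x \<in> topspace Y" "\<And>y. y \<in> topspace Y \<Longrightarrow> k y \<in> topspace X"
    "\<And>U. openin X U \<Longrightarrow> openin Y (j ` U)"
    "homeomorphic_map X Y j" "homeomorphic_map Y X k"
proof -
  show hm: "homeomorphic_map X Y j" "homeomorphic_map Y X k"
    using assms homeomorphic_maps_map by blast+
  show "\<And>x. x \<in> topspace X \<Longrightarrow> k (j x) = x" "\<And>y. y \<in> topspace Y \<Longrightarrow> j (k y) = y"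
    using assms by (auto simp: homeomorphic_maps_def)
  show "\<And>x. x \<in> topspace X \<Longrightarrow> j x \<in> topspace Y" "\<And>y. y \<in> topspace Y \<Longrightarrow> k y \<in> topspace X"
    using assms by (auto simp: homeomorphic_maps_def continuous_map_def)
  show "\<And>U. openin X U \<Longrightarrow> openin Y (j ` U)"
    using hm(1) homeomorphic_imp_open_map open_map_def by blast
qed

lemma oriented_atlasD:
  assumes "oriented_atlas X A" "(W, \<theta>) \<in> A"
  shows "W \<subseteq> topspace X" "openin X W" "inj_on \<theta> W"
proof -
  show W: "openin X W" using assms unfolding oriented_atlas_def by auto
  then show "W \<subseteq> topspace X" by (rule openin_subset)
  have "homeomorphic_map (subtopology X W) (top_of_set (\<theta> ` W)) \<theta>"
    using assms unfolding oriented_atlas_def by auto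
  then show "inj_on \<theta> W"
    using \<open>W \<subseteq> topspace X\<close> by (auto simp: homeomorphic_map_def quotient_map_def inf.absorb2 dest: homeomorphic_imp_injective_map)
qed

lemma disk_chart_iso:
  assumes iso: "surface_iso T T' j k" and ch: "disk_chart T U \<phi>"
  shows "disk_chart T' (j ` U) (\<phi> \<circ> k)"
  unfolding disk_chart_def
proof (intro conjI)
  let ?X = "surf_top T" and ?Y = "surf_top T'"
  have hm: "homeomorphic_maps ?X ?Y j k" using iso unfolding surface_iso_def by blast
  note F = homeomorphic_maps_facts[OF hm]
  have U: "openin ?X U" and hU: "homeomorphic_map (subtopology ?X U) (top_of_set (ball 0 1)) \<phi>"
    and orU: "\<And>W \<theta>. (W, \<theta>) \<in> surf_atlas T \<Longrightarrow>
      orientation_preserving_on (\<theta> ` (U \<inter> W)) (\<phi> \<circ> inv_into W \<theta>)"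
    using ch unfolding disk_chart_def by auto
  have Us: "U \<subseteq> topspace ?X" using U openin_subset by blast
  show "openin ?Y (j ` U)" using F U by blast
  have kj: "k ` j ` U = U" using Us F(1) by force
  have "homeomorphic_map (subtopology ?Y (j ` U)) (subtopology ?X U) k"
  proof (rule homeomorphic_map_subtopologies[OF F(7)])
    have "j ` U \<subseteq> points T'" using F(3) Us by blast
    then show "k ` (points T' \<inter> j ` U) = points T \<inter> U" using Us kj by (simp add: inf.absorb2)
  qed
  then show "homeomorphic_map (subtopology ?Y (j ` U)) (top_of_set (ball 0 1)) (\<phi> \<circ> k)"
    using hU homeomorphic_map_compose by blast
  show "\<forall>(W, \<theta>)\<in>surf_atlas T'. orientation_preserving_on (\<theta> ` (j ` U \<inter> W)) (\<phi> \<circ> k \<circ> inv_into W \<theta>)"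
  proof clarify
    fix W \<theta> assume W: "(W, \<theta>) \<in> surf_atlas T'"
    obtain \<theta>' where \<theta>': "(k ` W, \<theta>') \<in> surf_atlas T" "\<And>x. x \<in> W \<Longrightarrow> \<theta>' (k x) = \<theta> x"
      using surface_iso_chart[OF iso W] by blast
    have at: "oriented_atlas ?X (surf_atlas T)" "oriented_atlas ?Y (surf_atlas T')"
      using iso unfolding surface_iso_def by auto
    have Ws: "W \<subseteq> topspace ?Y" and inj: "inj_on \<theta> W"
      using oriented_atlasD[OF at(2) W] by auto
    have inj': "inj_on \<theta>' (k ` W)" using oriented_atlasD[OF at(1) \<theta>'(1)] by auto
    have "\<theta>' ` (U \<inter> k ` W) = \<theta> ` (j ` U \<inter> W)"
    proof (intro equalityI subsetI)
      fix z assume "z \<in> \<theta>' ` (U \<inter> k ` W)"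
      then obtain x where x: "x \<in> W" "k x \<in> U" "z = \<theta>' (k x)" by blast
      then have "x \<in> j ` U" using F(2)[of x] Ws by (metis image_eqI subsetD)
      then show "z \<in> \<theta> ` (j ` U \<inter> W)" using x \<theta>'(2) by auto
    next
      fix z assume "z \<in> \<theta> ` (j ` U \<inter> W)"
      then obtain u where u: "u \<in> U" "j u \<in> W" "z = \<theta> (j u)" by blast
      then have "k (j u) = u" using F(1) Us by blast
      then show "z \<in> \<theta>' ` (U \<inter> k ` W)" using u \<theta>'(2)[of "j u"] by (metis IntI image_eqI)
    qed
    then have "orientation_preserving_on (\<theta> ` (j ` U \<inter> W)) (\<phi> \<circ> inv_into (k ` W) \<theta>')"
      using orU[OF \<theta>'(1)] by simp
    then show "orientation_preserving_on (\<theta> ` (j ` U \<inter> W)) (\<phi> \<circ> k \<circ> inv_into W \<theta>)"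
    proof (rule orientation_preserving_on_cong)
      fix z assume "z \<in> \<theta> ` (j ` U \<inter> W)"
      then obtain x where x: "x \<in> W" "z = \<theta> x" by blast
      then have "inv_into W \<theta> z = x" "inv_into (k ` W) \<theta>' z = k x"
        using inj inv_into_f_f[OF inj', of "k x"] \<theta>'(2) by auto
      then show "(\<phi> \<circ> inv_into (k ` W) \<theta>') z = (\<phi> \<circ> k \<circ> inv_into W \<theta>) z" by simp
    qed
  qed
qed

lemma disk_chartD:
  assumes "disk_chart S U \<phi>"
  shows "U \<subseteq> points S" "inj_on \<phi> U" "\<phi> ` U = ball 0 1"
proof -
  have U: "openin (surf_top S) U"
    and h: "homeomorphic_map (subtopology (surf_top S) U) (top_of_set (ball 0 1)) \<phi>"
    using assms unfolding disk_chart_def by auto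
  show s: "U \<subseteq> points S" using U openin_subset by blast
  show "inj_on \<phi> U" using homeomorphic_imp_injective_map[OF h] s by (simp add: inf.absorb2)
  show "\<phi> ` U = ball 0 1" using homeomorphic_imp_surjective_map[OF h] s by (simp add: inf.absorb2)
qed

lemma branched_sheet_post:
  assumes iso: "surface_iso T T' j k" and fR: "f ` points R \<subseteq> points T" and y: "y \<in> points T"
    and sh: "branched_sheet R T f U x V y d"
  shows "branched_sheet R T' (j \<circ> f) U x (j ` V) (j y) d"
proof -
  have hm: "homeomorphic_maps (surf_top T) (surf_top T') j k"
    using iso unfolding surface_iso_def by blast
  note F = homeomorphic_maps_facts[OF hm]
  obtain \<phi> \<psi> where *: "openin (surf_top R) U" "openin (surf_top T) V" "f ` U \<subseteq> V"
    "U \<inter> fiber R f y = {x}" "1 \<le> d" "disk_chart R U \<phi>" "disk_chart T V \<psi>" "\<phi> x = 0" "\<psi> y = 0"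
    "\<And>z. z \<in> ball 0 1 \<Longrightarrow> (\<psi> \<circ> f \<circ> inv_into U \<phi>) z = z ^ d"
    using sh unfolding branched_sheet_def by blast
  have fib: "fiber R (j \<circ> f) (j y) = fiber R f y"
  proof -
    have "f x = y" if "x \<in> points R" "j (f x) = j y" for x
      using that fR F(1) y by (metis image_subset_iff)
    then show ?thesis unfolding fiber_def by auto
  qed
  have kj: "k (j (f (inv_into U \<phi> z))) = f (inv_into U \<phi> z)" if "z \<in> ball 0 1" for z
  proof -
    have "inv_into U \<phi> z \<in> U" using disk_chartD(3)[OF *(6)] that by (metis inv_into_into)
    then show ?thesis using F(1) *(1) fR openin_subset by blast
  qed
  have "(j \<circ> f) ` U \<subseteq> j ` V" using *(3) by auto
  moreover have "U \<inter> fiber R (j \<circ> f) (j y) = {x}" using fib *(4) by simp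
  moreover have "(\<psi> \<circ> k) (j y) = 0" using F(1) y *(9) by simp
  moreover have "\<forall>z\<in>ball 0 1. (\<psi> \<circ> k \<circ> (j \<circ> f) \<circ> inv_into U \<phi>) z = z ^ d"
    using kj *(10) by simp
  ultimately show ?thesis
    unfolding branched_sheet_def
    using F(5)[OF *(2)] *(1,5,6,8) disk_chart_iso[OF iso *(7)] by blast
qed

lemma branched_sheet_cong:
  assumes "branched_sheet R C f U x V y d" "\<And>u. u \<in> points R \<Longrightarrow> f u = f' u"
  shows "branched_sheet R C f' U x V y d"
proof -
  obtain \<phi> \<psi> where *: "openin (surf_top R) U" "openin (surf_top C) V" "f ` U \<subseteq> V"
    "U \<inter> fiber R f y = {x}" "1 \<le> d" "disk_chart R U \<phi>" "disk_chart C V \<psi>" "\<phi> x = 0" "\<psi> y = 0"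
    "\<And>z. z \<in> ball 0 1 \<Longrightarrow> (\<psi> \<circ> f \<circ> inv_into U \<phi>) z = z ^ d"
    using assms(1) unfolding branched_sheet_def by blast
  have Us: "U \<subseteq> points R" using *(1) openin_subset by blast
  have "inv_into U \<phi> z \<in> points R" if "z \<in> ball 0 1" for z
    using disk_chartD(3)[OF *(6)] that Us by (metis inv_into_into subsetD)
  then have "\<forall>z\<in>ball 0 1. (\<psi> \<circ> f' \<circ> inv_into U \<phi>) z = z ^ d"
    using *(10) assms(2) by simp
  moreover have "fiber R f' y = fiber R f y" unfolding fiber_def using assms(2) by auto
  moreover have "f' ` U \<subseteq> V" using *(3) Us assms(2) by (metis image_cong subsetD)
  ultimately show ?thesis unfolding branched_sheet_def using * by auto
qed

lemma branched_sheet_pre: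
  assumes iso: "surface_iso T T' j k" and sh: "branched_sheet T C f U x V y d"
  shows "branched_sheet T' C (f \<circ> k) (j ` U) (j x) V y d"
proof -
  have hm: "homeomorphic_maps (surf_top T) (surf_top T') j k"
    using iso unfolding surface_iso_def by blast
  note F = homeomorphic_maps_facts[OF hm]
  obtain \<phi> \<psi> where *: "openin (surf_top T) U" "openin (surf_top C) V" "f ` U \<subseteq> V"
    "U \<inter> fiber T f y = {x}" "1 \<le> d" "disk_chart T U \<phi>" "disk_chart C V \<psi>" "\<phi> x = 0" "\<psi> y = 0"
    "\<And>z. z \<in> ball 0 1 \<Longrightarrow> (\<psi> \<circ> f \<circ> inv_into U \<phi>) z = z ^ d"
    using sh unfolding branched_sheet_def by blast
  have Us: "U \<subseteq> points T" using *(1) openin_subset by blast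
  have kj: "\<And>u. u \<in> U \<Longrightarrow> k (j u) = u" using Us F(1) by blast
  have xU: "x \<in> U" using *(4) by blast
  have ch: "disk_chart T' (j ` U) (\<phi> \<circ> k)" using disk_chart_iso[OF iso *(6)] .
  have fib: "j ` U \<inter> fiber T' (f \<circ> k) y = j ` (U \<inter> fiber T f y)"
    unfolding fiber_def using Us F(3) kj by auto
  have "k (inv_into (j ` U) (\<phi> \<circ> k) z) = inv_into U \<phi> z" if "z \<in> ball 0 1" for z
  proof -
    obtain u where u: "u \<in> U" "z = \<phi> u" using disk_chartD(3)[OF *(6)] \<open>z \<in> ball 0 1\<close> by blast
    have "inv_into (j ` U) (\<phi> \<circ> k) z = j u"
      using inv_into_f_f[OF disk_chartD(2)[OF ch], of "j u"] u kj by simp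
    moreover have "inv_into U \<phi> z = u" using inv_into_f_f[OF disk_chartD(2)[OF *(6)]] u by simp
    ultimately show ?thesis using kj u by simp
  qed
  then have "\<forall>z\<in>ball 0 1. (\<psi> \<circ> (f \<circ> k) \<circ> inv_into (j ` U) (\<phi> \<circ> k)) z = z ^ d"
    using *(10) by simp
  moreover have "(f \<circ> k) ` j ` U \<subseteq> V" using *(3) kj by auto
  moreover have "(\<phi> \<circ> k) (j x) = 0" using kj xU *(8) by simp
  moreover have "j ` U \<inter> fiber T' (f \<circ> k) y = {j x}" using fib *(4) by simp
  ultimately show ?thesis
    unfolding branched_sheet_def using ch F(5)[OF *(1)] *(2,5,7,9) by blast
qed

lemma is_surface_iso:
  assumes iso: "surface_iso T T' j k" and "is_surface T"
  shows "is_surface T'"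
proof -
  have hm: "homeomorphic_maps (surf_top T) (surf_top T') j k"
    using iso unfolding surface_iso_def by blast
  then have hs: "surf_top T homeomorphic_space surf_top T'"
    unfolding homeomorphic_space_def by blast
  note F = homeomorphic_maps_facts[OF hm]
  have "points T' \<noteq> {}" using assms(2) F(3) unfolding is_surface_def by blast
  moreover have "oriented_atlas (surf_top T') (surf_atlas T')"
    using iso unfolding surface_iso_def by (elim conjE)
  ultimately show ?thesis using assms(2)
    unfolding is_surface_def homeomorphic_connected_space[OF hs]
      homeomorphic_Hausdorff_space[OF hs] homeomorphic_space_second_countability[OF hs]
    by (intro conjI) (elim conjE; assumption)+
qed

lemma branched_covering_post:
  assumes iso: "surface_iso T T' j k" and br: "branched_covering R T f"
  shows "branched_covering R T' (j \<circ> f)"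
proof -
  have hm: "homeomorphic_maps (surf_top T) (surf_top T') j k"
    using iso unfolding surface_iso_def by blast
  note F = homeomorphic_maps_facts[OF hm]
  have cf: "continuous_map (surf_top R) (surf_top T) f"
    and cj: "continuous_map (surf_top T) (surf_top T') j"
    using br hm unfolding branched_covering_def homeomorphic_maps_def by auto
  have fR: "f ` points R \<subseteq> points T" using cf by (rule continuous_map_image_subset_topspace)
  show ?thesis unfolding branched_covering_def
  proof (intro conjI ballI)
    show "is_surface R" "is_surface T'"
      using br is_surface_iso[OF iso] unfolding branched_covering_def by auto
    show "continuous_map (surf_top R) (surf_top T') (j \<circ> f)"
      using cf cj continuous_map_compose by blast
  next
    fix y' assume y': "y' \<in> points T'"
    then have y: "k y' \<in> points T" using F(4) by blast
    obtain V \<U> where V: "openin (surf_top T) V" "k y' \<in> V" "\<U> \<noteq> {}" "disjoint \<U>"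
      "\<Union>\<U> = {x \<in> points R. f x \<in> V}" "\<forall>U\<in>\<U>. \<exists>x d. branched_sheet R T f U x V (k y') d"
      by (rule branched_coveringE[OF br y])
    have jk: "j (k y') = y'" using F(2) y' by blast
    have Vs: "V \<subseteq> points T" using V(1) openin_subset by blast
    have "{x \<in> points R. (j \<circ> f) x \<in> j ` V} = {x \<in> points R. f x \<in> V}"
    proof -
      have "f x \<in> V" if "x \<in> points R" "j (f x) \<in> j ` V" for x
      proof -
        obtain v where v: "v \<in> V" "j (f x) = j v" using \<open>j (f x) \<in> j ` V\<close> by blast
        moreover have "f x \<in> points T" "v \<in> points T" using that fR v Vs by auto
        ultimately show ?thesis using F(1) by metis
      qed
      then show ?thesis by auto
    qed
    moreover have "\<forall>U\<in>\<U>. \<exists>x d. branched_sheet R T' (j \<circ> f) U x (j ` V) y' d"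
      using V(6) branched_sheet_post[OF iso fR y] jk by metis
    moreover have "y' \<in> j ` V" using V(2) jk by (metis image_eqI)
    ultimately show "\<exists>V \<U>. openin (surf_top T') V \<and> y' \<in> V \<and> \<U> \<noteq> {} \<and> disjoint \<U> \<and>
        \<Union>\<U> = {x \<in> points R. (j \<circ> f) x \<in> V} \<and>
        (\<forall>U\<in>\<U>. \<exists>x d. branched_sheet R T' (j \<circ> f) U x V y' d)"
      using V(3,4,5) F(5)[OF V(1)]
      by (intro exI[of _ "j ` V"] exI[of _ \<U>] conjI) (simp_all only: not_False_eq_True)
  qed
qed

lemma branched_covering_pre:
  assumes iso: "surface_iso T T' j k" and br: "branched_covering T C f"
  shows "branched_covering T' C (f \<circ> k)"
proof -
  have hm: "homeomorphic_maps (surf_top T) (surf_top T') j k"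
    using iso unfolding surface_iso_def by blast
  note F = homeomorphic_maps_facts[OF hm]
  show ?thesis unfolding branched_covering_def
  proof (intro conjI ballI)
    show "is_surface C" "is_surface T'"
      using br is_surface_iso[OF iso] unfolding branched_covering_def by auto
    show "continuous_map (surf_top T') (surf_top C) (f \<circ> k)"
      using br hm continuous_map_compose unfolding branched_covering_def homeomorphic_maps_def
      by blast
  next
    fix y assume y: "y \<in> points C"
    obtain V \<U> where V: "openin (surf_top C) V" "y \<in> V" "\<U> \<noteq> {}" "disjoint \<U>"
      "\<Union>\<U> = {x \<in> points T. f x \<in> V}" "\<forall>U\<in>\<U>. \<exists>x d. branched_sheet T C f U x V y d"
      by (rule branched_coveringE[OF br y])
    have sub: "U \<subseteq> points T" if "U \<in> \<U>" for U using V(5) that by blast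
    let ?W = "(`) j ` \<U>"
    have "disjoint ?W"
    proof (rule disjointI)
      fix A B assume "A \<in> ?W" "B \<in> ?W" "A \<noteq> B"
      then obtain U U' where U: "U \<in> \<U>" "U' \<in> \<U>" "A = j ` U" "B = j ` U'" "U \<noteq> U'" by blast
      then have "U \<inter> U' = {}" using V(4) by (metis disjointD)
      moreover have "inj_on j (points T)" by (metis F(1) inj_on_inverseI)
      ultimately show "A \<inter> B = {}" using U sub inj_on_image_Int[of j "points T" U U'] by auto
    qed
    moreover have "\<Union>?W = {x \<in> points T'. (f \<circ> k) x \<in> V}"
    proof -
      have "\<Union>?W = j ` \<Union>\<U>" by blast
      also have "\<dots> = {x \<in> points T'. (f \<circ> k) x \<in> V}"
      proof (intro equalityI subsetI)
        fix a assume "a \<in> j ` \<Union>\<U>"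
        then obtain x where "x \<in> points T" "f x \<in> V" "a = j x" unfolding V(5) by blast
        then show "a \<in> {x \<in> points T'. (f \<circ> k) x \<in> V}" using F(1,3) by simp
      next
        fix a assume "a \<in> {x \<in> points T'. (f \<circ> k) x \<in> V}"
        then have a: "a \<in> points T'" "f (k a) \<in> V" by auto
        then have "k a \<in> \<Union>\<U>" unfolding V(5) using F(4) by blast
        then show "a \<in> j ` \<Union>\<U>" using F(2)[OF a(1)] by (metis image_eqI)
      qed
      finally show ?thesis .
    qed
    moreover have "\<forall>U\<in>?W. \<exists>x d. branched_sheet T' C (f \<circ> k) U x V y d"
    proof
      fix U' assume "U' \<in> ?W"
      then obtain U where U: "U \<in> \<U>" "U' = j ` U" by blast
      then obtain x d where "branched_sheet T C f U x V y d" using V(6) by blast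
      then have "branched_sheet T' C (f \<circ> k) U' (j x) V y d"
        using branched_sheet_pre[OF iso] U(2) by simp
      then show "\<exists>x d. branched_sheet T' C (f \<circ> k) U' x V y d" by blast
    qed
    moreover have "?W \<noteq> {}" using V(3) by simp
    ultimately show "\<exists>V \<U>. openin (surf_top C) V \<and> y \<in> V \<and> \<U> \<noteq> {} \<and> disjoint \<U> \<and>
        \<Union>\<U> = {x \<in> points T'. (f \<circ> k) x \<in> V} \<and>
        (\<forall>U\<in>\<U>. \<exists>x d. branched_sheet T' C (f \<circ> k) U x V y d)"
      using V(1,2) by (intro exI[of _ V] exI[of _ ?W] conjI)
  qed
qed

lemma global_degree_post:
  assumes iso: "surface_iso T T' j k" and br: "branched_covering R T f"
  shows "global_degree R T' (j \<circ> f) = global_degree R T f"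
proof -
  have hm: "homeomorphic_maps (surf_top T) (surf_top T') j k"
    using iso unfolding surface_iso_def by blast
  note F = homeomorphic_maps_facts[OF hm]
  have fR: "f ` points R \<subseteq> points T"
    using br continuous_map_image_subset_topspace unfolding branched_covering_def by blast
  then have fR': "(j \<circ> f) ` points R \<subseteq> points T'" using F(3) by auto
  have kjf: "(k \<circ> (j \<circ> f)) u = f u" if "u \<in> points R" for u using that fR F(1) by auto
  have ld: "local_degree R T' (j \<circ> f) x = local_degree R T f x" if x: "x \<in> points R" for x
  proof -
    have fx: "f x \<in> points T" "(j \<circ> f) x \<in> points T'" using x fR F(3) by auto
    have "(\<exists>U V. branched_sheet R T' (j \<circ> f) U x V ((j \<circ> f) x) d) \<longleftrightarrow>
          (\<exists>U V. branched_sheet R T f U x V (f x) d)" for d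
    proof
      assume "\<exists>U V. branched_sheet R T f U x V (f x) d"
      then show "\<exists>U V. branched_sheet R T' (j \<circ> f) U x V ((j \<circ> f) x) d"
        using branched_sheet_post[OF iso fR fx(1)] by fastforce
    next
      assume "\<exists>U V. branched_sheet R T' (j \<circ> f) U x V ((j \<circ> f) x) d"
      then obtain U V where "branched_sheet R T' (j \<circ> f) U x V ((j \<circ> f) x) d" by blast
      then have "branched_sheet R T (k \<circ> (j \<circ> f)) U x (k ` V) (k ((j \<circ> f) x)) d"
        using branched_sheet_post[OF surface_iso_sym[OF iso] fR' fx(2)] by blast
      then have "branched_sheet R T f U x (k ` V) (k ((j \<circ> f) x)) d"
        using branched_sheet_cong kjf by metis
      then show "\<exists>U V. branched_sheet R T f U x V (f x) d" using kjf[OF x] by auto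
    qed
    then show ?thesis unfolding local_degree_def by simp
  qed
  have fib: "fiber R (j \<circ> f) (j y) = fiber R f y" if y: "y \<in> points T" for y
  proof -
    have "f x = y" if "x \<in> points R" "j (f x) = j y" for x
      using that fR F(1) y by (metis image_subset_iff)
    then show ?thesis unfolding fiber_def by auto
  qed
  have sums: "(\<Sum>x\<in>fiber R (j \<circ> f) (j y). local_degree R T' (j \<circ> f) x)
      = (\<Sum>x\<in>fiber R f y. local_degree R T f x)" if "y \<in> points T" for y
    unfolding fib[OF that] by (rule sum.cong) (auto simp: fiber_def ld)
  have pts: "points T' = j ` points T"
    using homeomorphic_imp_surjective_map[OF F(6)] by simp
  show ?thesis unfolding global_degree_def pts using sums by simp
qed

lemma branched_covering_surj:
  assumes "branched_covering R T w" shows "points T \<subseteq> w ` points R"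
proof
  fix y assume y: "y \<in> points T"
  obtain V \<U> where "\<U> \<noteq> {}" "\<forall>U\<in>\<U>. \<exists>x d. branched_sheet R T w U x V y d"
    by (rule branched_coveringE[OF assms y])
  then obtain U x d where "branched_sheet R T w U x V y d" by blast
  then have "x \<in> fiber R w y" unfolding branched_sheet_def by blast
  then show "y \<in> w ` points R" unfolding fiber_def by auto
qed

lemma ex_surface_iso:
  fixes T :: "'a surface" and j :: "'a \<Rightarrow> 'b"
  assumes at: "oriented_atlas (surf_top T) (surf_atlas T)" and inj: "inj_on j (points T)"
  shows "\<exists>T' k. surface_iso T T' j k"
proof -
  define S where "S = points T"
  define k where "k = inv_into S j"
  define Y where "Y = pullback_topology (j ` S) k (surf_top T)"
  define A where "A = (\<lambda>(U, \<phi>). (j ` U, \<phi> \<circ> k)) ` surf_atlas T"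
  have kj: "k (j x) = x" if "x \<in> S" for x
    using inj that unfolding k_def S_def by simp
  have jk: "j (k y) = y" if "y \<in> j ` S" for y using kj that by auto
  have tY: "topspace Y = j ` S"
    unfolding Y_def topspace_pullback_topology using kj by (auto simp: S_def)
  have hm: "homeomorphic_maps (surf_top T) Y j k"
    unfolding homeomorphic_maps_def
  proof (intro conjI ballI)
    show "continuous_map Y (surf_top T) k"
      unfolding Y_def using continuous_map_pullback[OF continuous_map_id] by simp
    show "continuous_map (surf_top T) Y j"
      unfolding Y_def
    proof (rule continuous_map_pullback')
      show "continuous_map (surf_top T) (surf_top T) (k \<circ> j)"
        by (rule continuous_map_eq[OF continuous_map_id]) (auto simp: kj S_def)
      show "topspace (surf_top T) \<subseteq> j -` (j ` S)" by (auto simp: S_def)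
    qed
  qed (use kj jk tY in \<open>auto simp: S_def\<close>)
  note F = homeomorphic_maps_facts[OF hm]
  have D: "U \<subseteq> S" "openin (surf_top T) U" "inj_on \<phi> U" if "(U, \<phi>) \<in> surf_atlas T" for U \<phi>
    using oriented_atlasD[OF at that] by (auto simp: S_def)
  have im: "(\<phi> \<circ> k) ` j ` U = \<phi> ` U" if "U \<subseteq> S" for U and \<phi> :: "'a \<Rightarrow> complex"
    using kj that by (auto simp: image_image subset_iff)
  have atA: "oriented_atlas Y A"
    unfolding oriented_atlas_def
  proof (intro conjI)
    have "(\<Union>(U, \<phi>)\<in>A. U) = j ` (\<Union>(U, \<phi>)\<in>surf_atlas T. U)" unfolding A_def by auto
    also have "\<dots> = topspace Y" using at tY unfolding oriented_atlas_def S_def by simp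
    finally show "(\<Union>(U, \<phi>)\<in>A. U) = topspace Y" .
    show "\<forall>(U, \<phi>)\<in>A. openin Y U \<and> open (\<phi> ` U) \<and>
        homeomorphic_map (subtopology Y U) (top_of_set (\<phi> ` U)) \<phi>"
    proof -
      have "openin Y (j ` U) \<and> open ((\<phi> \<circ> k) ` j ` U) \<and>
          homeomorphic_map (subtopology Y (j ` U)) (top_of_set ((\<phi> \<circ> k) ` j ` U)) (\<phi> \<circ> k)"
        if U: "(U, \<phi>) \<in> surf_atlas T" for U \<phi>
      proof -
        have "homeomorphic_map (subtopology Y (j ` U)) (subtopology (surf_top T) U) k"
        proof (rule homeomorphic_map_subtopologies[OF F(7)])
          have "topspace Y \<inter> j ` U = j ` U" using D(1)[OF U] tY by blast
          moreover have "k ` j ` U = U" using D(1)[OF U] kj by force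
          ultimately show "k ` (topspace Y \<inter> j ` U) = points T \<inter> U"
            using D(1)[OF U] by (simp add: S_def inf.absorb2)
        qed
        moreover have "homeomorphic_map (subtopology (surf_top T) U) (top_of_set (\<phi> ` U)) \<phi>"
          "open (\<phi> ` U)"
          using at U unfolding oriented_atlas_def by auto
        ultimately show ?thesis using im D[OF U] F(5) homeomorphic_map_compose by metis
      qed
      then show ?thesis unfolding A_def by auto
    qed
    show "\<forall>(U, \<phi>)\<in>A. \<forall>(W, \<theta>)\<in>A.
        orientation_preserving_on (\<theta> ` (U \<inter> W)) (\<phi> \<circ> inv_into W \<theta>)"
    proof -
      have "orientation_preserving_on ((\<theta> \<circ> k) ` (j ` U \<inter> j ` W))
          ((\<phi> \<circ> k) \<circ> inv_into (j ` W) (\<theta> \<circ> k))"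
        if U: "(U, \<phi>) \<in> surf_atlas T" and W: "(W, \<theta>) \<in> surf_atlas T" for U \<phi> W \<theta>
      proof -
        have "j ` U \<inter> j ` W = j ` (U \<inter> W)"
          using inj_on_image_Int[OF inj] D[OF U] D[OF W] by (simp add: S_def)
        then have e: "(\<theta> \<circ> k) ` (j ` U \<inter> j ` W) = \<theta> ` (U \<inter> W)"
          using im[of "U \<inter> W"] D[OF U] by (metis inf.coboundedI1)
        have injW: "inj_on (\<theta> \<circ> k) (j ` W)"
        proof (rule inj_onI)
          fix a b assume ab: "a \<in> j ` W" "b \<in> j ` W" "(\<theta> \<circ> k) a = (\<theta> \<circ> k) b"
          then obtain u v where uv: "u \<in> W" "v \<in> W" "a = j u" "b = j v" by blast
          then have "k a = u" "k b = v" using kj D(1)[OF W] by auto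
          then have "\<theta> u = \<theta> v" using ab(3) by simp
          then show "a = b" using D(3)[OF W] uv by (metis inj_onD)
        qed
        have "orientation_preserving_on (\<theta> ` (U \<inter> W)) (\<phi> \<circ> inv_into W \<theta>)"
          using at U W unfolding oriented_atlas_def by blast
        then have "orientation_preserving_on (\<theta> ` (U \<inter> W)) ((\<phi> \<circ> k) \<circ> inv_into (j ` W) (\<theta> \<circ> k))"
        proof (rule orientation_preserving_on_cong)
          fix z assume "z \<in> \<theta> ` (U \<inter> W)"
          then obtain u where u: "u \<in> W" "z = \<theta> u" by blast
          have ku: "k (j u) = u" using kj D(1)[OF W] u by blast
          have "inv_into (j ` W) (\<theta> \<circ> k) z = j u"
            using inv_into_f_f[OF injW, of "j u"] u ku by simp
          moreover have "inv_into W \<theta> z = u" using inv_into_f_f[OF D(3)[OF W]] u by simp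
          ultimately show "(\<phi> \<circ> inv_into W \<theta>) z = ((\<phi> \<circ> k) \<circ> inv_into (j ` W) (\<theta> \<circ> k)) z"
            using ku by simp
        qed
        then show ?thesis using e by simp
      qed
      then show ?thesis unfolding A_def by auto
    qed
  qed
  have "surface_iso T \<lparr>surf_top = Y, surf_atlas = A\<rparr> j k"
    unfolding surface_iso_def
  proof (intro conjI)
    show "\<forall>(W, \<theta>)\<in>surf_atlas T. \<exists>\<theta>'. (j ` W, \<theta>') \<in> surf_atlas \<lparr>surf_top = Y, surf_atlas = A\<rparr> \<and>
        (\<forall>x\<in>W. \<theta>' (j x) = \<theta> x)"
    proof clarify
      fix W \<theta> assume W: "(W, \<theta>) \<in> surf_atlas T"
      then have "(j ` W, \<theta> \<circ> k) \<in> A" unfolding A_def by force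
      moreover have "\<forall>x\<in>W. (\<theta> \<circ> k) (j x) = \<theta> x" using kj D(1)[OF W] by auto
      ultimately show "\<exists>\<theta>'. (j ` W, \<theta>') \<in> surf_atlas \<lparr>surf_top = Y, surf_atlas = A\<rparr> \<and>
        (\<forall>x\<in>W. \<theta>' (j x) = \<theta> x)" by auto
    qed
    show "\<forall>(W, \<theta>)\<in>surf_atlas \<lparr>surf_top = Y, surf_atlas = A\<rparr>.
        \<exists>\<theta>'. (k ` W, \<theta>') \<in> surf_atlas T \<and> (\<forall>x\<in>W. \<theta>' (k x) = \<theta> x)"
    proof clarify
      fix W \<theta> assume "(W, \<theta>) \<in> surf_atlas \<lparr>surf_top = Y, surf_atlas = A\<rparr>"
      then obtain U \<phi> where U: "(U, \<phi>) \<in> surf_atlas T" "W = j ` U" "\<theta> = \<phi> \<circ> k"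
        unfolding A_def by auto
      moreover have "k ` j ` U = U" using kj D(1)[OF U(1)] by force
      ultimately show "\<exists>\<theta>'. (k ` W, \<theta>') \<in> surf_atlas T \<and> (\<forall>x\<in>W. \<theta>' (k x) = \<theta> x)" by auto
    qed
  qed (use hm at atA in auto)
  then show ?thesis by blast
qed

lemma no_common_right_factorD:
  fixes T :: "'e surface"
  assumes ncf: "no_common_right_factor R C1 C2 p q"
    and T: "closed_surface T" "branched_covering R T w"
      "branched_covering T C1 p'" "branched_covering T C2 q'"
      "\<forall>x\<in>points R. p x = p' (w x)" "\<forall>x\<in>points R. q x = q' (w x)"
  shows "global_degree R T w = 1"
proof -
  define j where "j = inv_into (points R) w"
  have "inj_on j (points T)"
    unfolding j_def by (rule inj_on_inv_into) (rule branched_covering_surj[OF T(2)])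
  moreover have "oriented_atlas (surf_top T) (surf_atlas T)"
    using T(1) unfolding closed_surface_def is_surface_def by blast
  ultimately obtain T' k where iso: "surface_iso T T' j k" using ex_surface_iso by blast
  have hm: "homeomorphic_maps (surf_top T) (surf_top T') j k"
    using iso unfolding surface_iso_def by blast
  note F = homeomorphic_maps_facts[OF hm]
  have "closed_surface T'"
    using T(1) is_surface_iso[OF iso] hm homeomorphic_compact_space
    unfolding closed_surface_def homeomorphic_space_def by blast
  moreover have w: "w x \<in> points T" if "x \<in> points R" for x
    using T(2) that continuous_map_image_subset_topspace unfolding branched_covering_def by blast
  then have "\<forall>x\<in>points R. p x = (p' \<circ> k) ((j \<circ> w) x)" "\<forall>x\<in>points R. q x = (q' \<circ> k) ((j \<circ> w) x)"
    using T(5,6) F(1) by auto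
  ultimately have "global_degree R T' (j \<circ> w) = 1"
    using ncf branched_covering_post[OF iso T(2)] branched_covering_pre[OF iso T(3)]
      branched_covering_pre[OF iso T(4)]
    unfolding no_common_right_factor_def by blast
  then show ?thesis using global_degree_post[OF iso T(2)] by simp
qed



section \<open>Orbifolds\<close>

text \<open>
  ``Equal to 1 except at isolated points'' means that the exceptional points do not accumulate
  anywhere in the surface.
\<close>

type_synonym 'a orbifold = "'a surface \<times> ('a \<Rightarrow> nat)"

definition is_orbifold :: "'a orbifold \<Rightarrow> bool" where
  "is_orbifold \<O> \<longleftrightarrow> (case \<O> of (R, \<nu>) \<Rightarrow>
     is_surface R \<and> (\<forall>z\<in>points R. 1 \<le> \<nu> z) \<and>
     surf_top R derived_set_of {z \<in> points R. \<nu> z \<noteq> 1} = {})"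

definition minimal_holomorphic_map :: "'a orbifold \<Rightarrow> 'b orbifold \<Rightarrow> ('a \<Rightarrow> 'b) \<Rightarrow> bool" where
  "minimal_holomorphic_map \<O>1 \<O>2 f \<longleftrightarrow>
     is_orbifold \<O>1 \<and> is_orbifold \<O>2 \<and>
     (case (\<O>1, \<O>2) of ((R1, \<nu>1), (R2, \<nu>2)) \<Rightarrow>
        branched_covering R1 R2 f \<and>
        (\<forall>z\<in>points R1. \<nu>2 (f z) = \<nu>1 z * gcd (local_degree R1 R2 f z) (\<nu>2 (f z))))"

definition orbi2 :: "'a surface \<Rightarrow> 'b surface \<Rightarrow> ('a \<Rightarrow> 'b) \<Rightarrow> 'b orbifold" where
  "orbi2 R1 R2 f = (R2, \<lambda>z. Lcm (local_degree R1 R2 f ` fiber R1 f z))"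

definition orbi1 :: "'a surface \<Rightarrow> 'b surface \<Rightarrow> ('a \<Rightarrow> 'b) \<Rightarrow> 'a orbifold" where
  "orbi1 R1 R2 f = (R1, \<lambda>z. snd (orbi2 R1 R2 f) (f z) div local_degree R1 R2 f z)"


section \<open>Partitions\<close>

definition local_degrees :: "'a surface \<Rightarrow> 'b surface \<Rightarrow> ('a \<Rightarrow> 'b) \<Rightarrow> 'b \<Rightarrow> nat multiset" where
  "local_degrees R C f z = image_mset (local_degree R C f) (mset_set (fiber R f z))"

definition partition_power :: "nat multiset \<Rightarrow> nat \<Rightarrow> nat multiset" where
  "partition_power \<mu> d = (\<Sum>a\<in>#\<mu>. replicate_mset (gcd a d) (lcm a d div d))"

end

theory Submission
  imports Defs
begin

text \<open>
  Call two points of \<open>R\<close> equivalent if \<open>p\<close> and \<open>q\<close> agree on them and if the local images of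
  \<open>(p, q)\<close> at the two points coincide. Over a small disk in \<open>C\<close> all maps are power maps in
  suitable charts: at \<open>x\<close>, with \<open>d = deg f\<close> at \<open>z = p x\<close> and \<open>a = deg g\<close> at \<open>b = q x\<close>, one has
  \<open>p = \<zeta>\<^sup>k\<^sup>\<alpha>\<close> and \<open>q = \<omega> \<zeta>\<^sup>k\<^sup>\<beta>\<close>, where \<open>\<alpha> = a / gcd a d\<close> and \<open>\<beta> = d / gcd a d\<close> are coprime and
  \<open>\<omega>\<^sup>\<alpha>\<close> is a root of unity of order dividing \<open>gcd a d\<close> that determines the local image. Hence
  \<open>\<zeta>\<^sup>k\<close> is a chart of the quotient, which is a closed surface through which \<open>p\<close> and \<open>q\<close>
  factor. As there is no common right factor, the quotient map has degree one: \<open>k = 1\<close>, and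
  distinct points over the same \<open>(z, b)\<close> have distinct \<open>\<omega>\<^sup>\<alpha>\<close>. So there are at most \<open>gcd a d\<close>
  points over \<open>(z, b)\<close>, each of local degree \<open>a / gcd a d\<close> for \<open>p\<close>; summing over \<open>b\<close>, the
  hypothesis \<open>deg p = deg g\<close> forces equality everywhere. The orbifold statements are then
  arithmetic.
\<close>

section \<open>Winding numbers and local orientation in the plane\<close>

text \<open>Two obstacles shape the development. A branched covering only promises, for each sheet
  separately, some coordinate of the base disk in which it is a power map, so two sheets over one
  disk cannot be compared directly. To impose one base coordinate on all sheets, a chart change
  \<open>\<kappa>\<close> is lifted through \<open>z ^ d\<close>; this needs that
  \<open>\<kappa>\<close> winds once around 0. Secondly, the quotient must carry an oriented atlas,
  and orientation means winding numbers of circles under mere homeomorphisms. Hence the opening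
  calculus of winding numbers, made pointwise so that it composes and cancels; transitions of
  quotient charts are then tested on \<open>R\<close>, at points where the quotient map is locally
  injective. The relation on \<open>R\<close> must not depend on the chosen disks, because charts
  with different centres overlap, and it must be transitive. Its definition by nearby meeting points
  gives the former, the invariant \<open>om\<close> at each centre the latter. To make
  \<open>om\<close> an invariant, \<open>\<omega>\<close> is replaced by a root selected from
  \<open>\<omega> ^ \<alpha>\<close> alone, at the cost of a rotation of the sheet
  coordinate.\<close>

lemma winding_number_exp_lift:
  assumes "path l" and c: "\<And>t. t \<in> {0..1} \<Longrightarrow> c t = z + exp (l t)"
  shows "winding_number c z = (l 1 - l 0) / (2 * of_real pi * \<i>)"
proof -
  have "winding_number c z = winding_number (\<lambda>t. c t - z) 0"
    by (rule winding_number_offset)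
  also have "\<dots> = winding_number (exp \<circ> l) 0"
    by (rule winding_number_cong) (simp add: c)
  finally show ?thesis
    using winding_number_compose_exp[OF assms(1)] by (simp add: pathfinish_def pathstart_def)
qed

text \<open>\<open>c t - z\<close> has no zero on the contractible interval, hence a continuous
  logarithm.\<close>

lemma exp_lift_path:
  assumes "path c" "z \<notin> path_image c"
  obtains l where "path l" "\<And>t. t \<in> {0..1} \<Longrightarrow> c t = z + exp (l t)"
    "winding_number c z = (l 1 - l 0) / (2 * of_real pi * \<i>)"
proof -
  have "continuous_on {0..1} (\<lambda>t. c t - z)"
    using assms(1) by (auto simp: path_def intro!: continuous_intros)
  moreover have "contractible {0..1::real}" by (simp add: convex_imp_contractible)
  moreover have "c t - z \<noteq> 0" if "t \<in> {0..1}" for t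
    using assms(2) that by (auto simp: path_image_def)
  ultimately obtain l where l: "continuous_on {0..1} l" "\<And>t. t \<in> {0..1} \<Longrightarrow> c t - z = exp (l t)"
    using continuous_logarithm_on_contractible[of "{0..1}" "\<lambda>t. c t - z"] by blast
  then have pl: "path l" and c: "\<And>t. t \<in> {0..1} \<Longrightarrow> c t = z + exp (l t)"
    unfolding path_def by (auto simp: algebra_simps simp flip: l(2))
  show thesis by (rule that[OF pl c winding_number_exp_lift[OF pl c]])
qed

text \<open>The map \<open>w \<mapsto> z + exp w\<close> makes the half-plane
  \<open>Re w < ln r\<close> the universal cover of the punctured ball. The half-plane is convex, so
  \<open>h - h z\<close> has a logarithm \<open>L\<close> on it, and \<open>n\<close>, the shift of
  \<open>L\<close> under the deck translation, is the local winding number of \<open>h\<close> at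
  \<open>z\<close>.\<close>

lemma exp_lift_punctured_ball:
  assumes h: "continuous_on (ball z r) h" "\<And>w. w \<in> ball z r - {z} \<Longrightarrow> h w \<noteq> h z" and r: "r > 0"
  obtains L :: "complex \<Rightarrow> complex" and n :: int
  where "continuous_on {w. Re w < ln r} L"
    "\<And>w. Re w < ln r \<Longrightarrow> h (z + exp w) = h z + exp (L w)"
    "\<And>w m. Re w < ln r \<Longrightarrow> L (w + 2 * of_real pi * \<i> * of_int m)
       = L w + 2 * of_real pi * \<i> * of_int (n * m)"
proof -
  let ?H = "{w. Re w < ln r}" and ?p = "2 * of_real pi * \<i>"
  have in_ball: "z + exp w \<in> ball z r - {z}" if "w \<in> ?H" for w
    using that r by (simp add: dist_norm flip: exp_less_cancel_iff[of _ "ln r"])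
  have convH: "convex ?H" by (simp add: convex_halfspace_Re_lt)
  have "continuous_on ?H (\<lambda>w. h (z + exp w) - h z)"
    by (intro continuous_intros continuous_on_compose2[OF h(1)]) (use in_ball in auto)
  moreover have "h (z + exp w) - h z \<noteq> 0" if "w \<in> ?H" for w using h(2) in_ball[OF that] by simp
  ultimately obtain L
    where L: "continuous_on ?H L" "\<And>w. w \<in> ?H \<Longrightarrow> h (z + exp w) - h z = exp (L w)"
    using continuous_logarithm_on_contractible[OF _ convex_imp_contractible[OF convH], of "\<lambda>w. h (z + exp w) - h z"]
    by blast
  \<comment> \<open>Increment of \<open>L\<close> along one deck translation, in units of
    \<open>2 * pi * i\<close>. It is integer-valued and continuous on a connected set, hence
    constant.\<close>
  define D where "D = (\<lambda>w. (L (w + ?p) - L w) / ?p)"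
  have Dint: "D w \<in> \<int>" if "w \<in> ?H" for w
  proof -
    have "exp (L (w + ?p)) = exp (L w)" using L(2)[of w] L(2)[of "w + ?p"] that by (simp add: exp_add)
    then obtain n :: int where "L (w + ?p) = L w + of_int (2 * n) * of_real pi * \<i>"
      by (auto simp: exp_eq)
    then have "D w = of_int n" by (simp add: D_def)
    then show ?thesis by simp
  qed
  have "continuous_on ?H D"
    unfolding D_def by (intro continuous_intros continuous_on_compose2[OF L(1)] L(1)) auto
  then have "D constant_on ?H"
  proof (rule continuous_discrete_range_constant[OF convex_connected[OF convH]])
    fix x assume "x \<in> ?H"
    then have "1 \<le> norm (D y - D x)" if "y \<in> ?H" "D y \<noteq> D x" for y
      using Dint[OF that(1)] Dint[OF \<open>x \<in> ?H\<close>] that(2)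
      by (auto simp: Ints_def simp flip: of_int_diff)
    then show "\<exists>e>0. \<forall>y. y \<in> ?H \<and> D y \<noteq> D x \<longrightarrow> e \<le> norm (D y - D x)"
      by (intro exI[of _ 1]) auto
  qed
  then obtain k where k: "\<And>w. w \<in> ?H \<Longrightarrow> D w = k" unfolding constant_on_def by blast
  have "of_real (ln r - 1) \<in> ?H" by simp
  then obtain n :: int where n: "k = of_int n" using Dint k by (metis Ints_cases)
  have step: "L (w + ?p) = L w + ?p * of_int n" if "w \<in> ?H" for w
    using k[OF that] n by (simp add: D_def field_simps)
  have nat: "L (w + ?p * of_nat m) = L w + ?p * (of_int n * of_nat m)" if "w \<in> ?H" for w m
  proof (induction m)
    case (Suc m)
    then show ?case using step[of "w + ?p * of_nat m"] that by (simp add: algebra_simps)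
  qed simp
  have all: "L (w + ?p * of_int m) = L w + ?p * of_int (n * m)" if "w \<in> ?H" for w m
  proof (cases m rule: int_cases2)
    case (nonneg j) then show ?thesis using nat[OF that, of j] by simp
  next
    case (nonpos j) then show ?thesis using nat[of "w - ?p * of_nat j" j] that
      by (simp add: algebra_simps)
  qed
  show thesis
  proof (rule that[OF L(1)])
    show "h (z + exp w) = h z + exp (L w)" if "Re w < ln r" for w
      using L(2)[of w] that by (simp add: algebra_simps)
    show "L (w + ?p * of_int m) = L w + ?p * of_int (n * m)" if "Re w < ln r" for w m
      using all that by simp
  qed
qed

lemma circlepath_exp:
  "r > 0 \<Longrightarrow> circlepath z r t = z + exp (of_real (ln r) + 2 * of_real pi * \<i> * of_real t)"
  by (simp add: circlepath exp_add exp_of_real)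

lemma circlepath_in_cball: "r \<ge> 0 \<Longrightarrow> circlepath z r t \<in> cball z r"
  by (simp add: circlepath dist_norm norm_mult)

text \<open>A lift of \<open>c\<close> with increment \<open>2 * pi * i * m\<close> is carried by
  \<open>L\<close> to a lift of \<open>h \<circ> c\<close> with increment
  \<open>2 * pi * i * n * m\<close>; the standard circle has \<open>m = 1\<close> and so identifies
  \<open>n\<close>.\<close>

lemma winding_number_compose:
  assumes h: "continuous_on (ball z r) h" "\<And>w. w \<in> ball z r - {z} \<Longrightarrow> h w \<noteq> h z"
    and c: "path c" "pathfinish c = pathstart c" "path_image c \<subseteq> ball z r - {z}"
    and s: "0 < s" "s < r"
  shows "winding_number (h \<circ> c) (h z) = winding_number c z * winding_number (h \<circ> circlepath z s) (h z)"
proof -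
  let ?p = "2 * of_real pi * \<i> :: complex"
  obtain L n where L: "continuous_on {w. Re w < ln r} L"
    "\<And>w. Re w < ln r \<Longrightarrow> h (z + exp w) = h z + exp (L w)"
    "\<And>w m. Re w < ln r \<Longrightarrow> L (w + ?p * of_int m) = L w + ?p * of_int (n * m)"
    by (rule exp_lift_punctured_ball[OF h]) (assumption, use s in linarith, blast)
  have key: "winding_number (h \<circ> c) (h z) = winding_number c z * of_int n"
    if c: "path c" "pathfinish c = pathstart c" "path_image c \<subseteq> ball z r - {z}" for c
  proof -
    obtain l where l: "path l" "\<And>t. t \<in> {0..1} \<Longrightarrow> c t = z + exp (l t)"
      "winding_number c z = (l 1 - l 0) / ?p"
      using exp_lift_path[OF c(1), of z] c(3) by blast
    have Re: "Re (l t) < ln r" if "t \<in> {0..1}" for t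
    proof -
      have "c t \<in> path_image c" using that by (simp add: path_image_def)
      then have "exp (Re (l t)) < exp (ln r)" using c(3) l(2)[OF that] s by (auto simp: dist_norm)
      then show ?thesis by (simp only: exp_less_cancel_iff)
    qed
    have "path (L \<circ> l)" using l(1) Re unfolding path_def
      by (intro continuous_on_compose continuous_on_subset[OF L(1)]) auto
    then have "winding_number (h \<circ> c) (h z) = (L (l 1) - L (l 0)) / ?p"
      using winding_number_exp_lift[of "L \<circ> l" "h \<circ> c" "h z"] l(2) L(2) Re by simp
    moreover have "exp (l 1) = exp (l 0)" using l(2)[of 0] l(2)[of 1] c(2)
      by (simp add: pathfinish_def pathstart_def)
    then obtain m :: int where "l 1 = l 0 + of_int (2 * m) * of_real pi * \<i>" by (auto simp: exp_eq)
    then have m: "l 1 = l 0 + ?p * of_int m" by simp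
    moreover have "L (l 1) = L (l 0) + ?p * of_int (n * m)" using L(3)[of "l 0" m] Re[of 0] m by simp
    ultimately show ?thesis using l(3) by simp
  qed
  have "path_image (circlepath z s) \<subseteq> ball z r - {z}" using s by (auto simp: dist_norm norm_minus_commute)
  then have "winding_number (h \<circ> circlepath z s) (h z) = of_int n"
    using key[of "circlepath z s"] s by (simp add: winding_number_circlepath_centre)
  then show ?thesis using key[OF c] by simp
qed

lemma winding_number_circlepath_radius:
  assumes h: "continuous_on (ball z r) h" "\<And>w. w \<in> ball z r - {z} \<Longrightarrow> h w \<noteq> h z"
    and s: "0 < s" "s < r" "0 < s'" "s' < r"
  shows "winding_number (h \<circ> circlepath z s) (h z) = winding_number (h \<circ> circlepath z s') (h z)"
proof -
  have "path_image (circlepath z s) \<subseteq> ball z r - {z}" using s by auto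
  then show ?thesis
    using winding_number_compose[OF h _ _ _ s(3,4), of "circlepath z s"] s
    by (simp add: winding_number_circlepath_centre)
qed

text \<open>The condition on a set ranges over all closed balls inside it, which compositions do not
  respect. The germ at a point composes and cancels; injectivity near \<open>z\<close> keeps the
  image circle off \<open>h z\<close>, so that the winding number is independent of the small
  radius.\<close>

definition orientation_preserving_at :: "(complex \<Rightarrow> complex) \<Rightarrow> complex \<Rightarrow> bool" where
  "orientation_preserving_at h z \<longleftrightarrow>
     (\<exists>r>0. continuous_on (ball z r) h \<and> inj_on h (ball z r) \<and>
        (\<forall>s. 0 < s \<and> s < r \<longrightarrow> winding_number (h \<circ> circlepath z s) (h z) = 1))"

text \<open>One radius decides, because the winding number is the same for all circles around
  \<open>z\<close> in a ball of injectivity.\<close>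

lemma orientation_preserving_atI:
  assumes "continuous_on (ball z r) h" "inj_on h (ball z r)" "0 < s" "s < r"
    "winding_number (h \<circ> circlepath z s) (h z) = 1"
  shows "orientation_preserving_at h z"
  unfolding orientation_preserving_at_def
proof (intro exI conjI allI impI)
  fix s' assume "0 < s' \<and> s' < r"
  moreover have "h w \<noteq> h z" if "w \<in> ball z r - {z}" for w
    using assms(2,3,4) that by (auto dest: inj_onD)
  ultimately show "winding_number (h \<circ> circlepath z s') (h z) = 1"
    using winding_number_circlepath_radius[OF assms(1) _ assms(3,4), of s'] assms(5) by simp
qed (use assms in auto)

lemma orientation_preserving_atE:
  assumes "orientation_preserving_at h z" "e > 0"
  obtains r where "0 < r" "r \<le> e" "continuous_on (ball z r) h" "inj_on h (ball z r)"
    "\<And>s. 0 < s \<Longrightarrow> s < r \<Longrightarrow> winding_number (h \<circ> circlepath z s) (h z) = 1"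
proof -
  obtain r where r: "r > 0" "continuous_on (ball z r) h" "inj_on h (ball z r)"
    "\<And>s. 0 < s \<Longrightarrow> s < r \<Longrightarrow> winding_number (h \<circ> circlepath z s) (h z) = 1"
    using assms(1) unfolding orientation_preserving_at_def by blast
  have "ball z (min r e) \<subseteq> ball z r" by auto
  then show thesis
    by (intro that[of "min r e"]) (use r assms(2) continuous_on_subset inj_on_subset in auto)
qed

lemma orientation_preserving_at_cong:
  assumes "orientation_preserving_at h z" "open S" "z \<in> S" "\<And>w. w \<in> S \<Longrightarrow> h w = h' w"
  shows "orientation_preserving_at h' z"
proof -
  obtain e where e: "e > 0" "ball z e \<subseteq> S" using assms(2,3) open_contains_ball by blast
  obtain r where r: "0 < r" "r \<le> e" "continuous_on (ball z r) h" "inj_on h (ball z r)"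
    "\<And>s. 0 < s \<Longrightarrow> s < r \<Longrightarrow> winding_number (h \<circ> circlepath z s) (h z) = 1"
    by (rule orientation_preserving_atE[OF assms(1) e(1)]) blast
  have eq: "h w = h' w" if "w \<in> ball z r" for w using assms(4)[of w] e(2) r(2) that by (auto simp: subset_iff)
  have "circlepath z (r / 2) t \<in> ball z r" for t
    using circlepath_in_cball[of "r / 2" z t] r(1) by auto
  then have "h' \<circ> circlepath z (r / 2) = h \<circ> circlepath z (r / 2)" "h' z = h z"
    using eq r(1) by (auto simp: fun_eq_iff)
  then show ?thesis
    using r(1) r(5)[of "r / 2"] continuous_on_cong[THEN iffD1, OF refl eq r(3)]
      inj_on_cong[THEN iffD1, OF eq r(4)]
    by (intro orientation_preserving_atI[of z r h' "r / 2"]) auto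
qed

text \<open>Around a closed ball in \<open>S\<close> a slightly larger open ball still lies in
  \<open>S\<close>, by compactness. Inside it the winding number does not depend on the radius, so
  the small circles supplied by the germ settle the given one. The converse only needs one circle
  per point.\<close>

lemma orientation_preserving_on_iff_at:
  assumes S: "open S" "continuous_on S h" "inj_on h S"
  shows "orientation_preserving_on S h \<longleftrightarrow> (\<forall>z\<in>S. orientation_preserving_at h z)"
proof (intro iffI ballI)
  fix z assume *: "orientation_preserving_on S h" "z \<in> S"
  obtain e where e: "e > 0" "ball z e \<subseteq> S" using S(1) * open_contains_ball by blast
  have "winding_number (h \<circ> circlepath z (e / 2)) (h z) = 1"
    using * e by (auto simp: orientation_preserving_on_def subset_iff)
  then show "orientation_preserving_at h z"
    using e S(2,3) continuous_on_subset inj_on_subset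
    by (intro orientation_preserving_atI[of z e h "e / 2"]) auto
next
  assume *: "\<forall>z\<in>S. orientation_preserving_at h z"
  show "orientation_preserving_on S h"
    unfolding orientation_preserving_on_def
  proof (intro ballI allI impI)
    fix z r assume z: "z \<in> S" "r > (0::real)" "cball z r \<subseteq> S"
    obtain r' where r': "r < r'" "ball z r' \<subseteq> S"
    proof -
      obtain e where "e > 0" "(\<Union>w\<in>cball z r. ball w e) \<subseteq> S"
        using compact_subset_open_imp_ball_epsilon_subset[OF compact_cball S(1) z(3)] by blast
      moreover have "w \<in> (\<Union>w\<in>cball z r. ball w e)" if "w \<in> ball z (r + e)" for w
      proof (cases "w \<in> cball z r")
        case True then show ?thesis using \<open>e > 0\<close> centre_in_ball by blast
      next
        case False
        define t where "t = r / norm (w - z)"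
        have n: "norm (w - z) > r" using False by (simp add: dist_norm norm_minus_commute)
        \<comment> \<open>The point at distance \<open>r\<close> from \<open>z\<close> on the ray
          through \<open>w\<close>, hence at distance less than \<open>e\<close> from
          \<open>w\<close>.\<close>
        define w' where "w' = z + of_real t * (w - z)"
        have "norm (w' - z) = \<bar>t\<bar> * norm (w - z)" by (simp add: w'_def norm_mult)
        then have "w' \<in> cball z r" using n z(2) by (simp add: t_def dist_norm norm_minus_commute)
        moreover have "w - w' = of_real (1 - t) * (w - z)" by (simp add: w'_def algebra_simps)
        then have "norm (w - w') = \<bar>1 - t\<bar> * norm (w - z)" by (simp only: norm_mult norm_of_real)
        moreover have "t < 1" "t * norm (w - z) = r" using n z(2) by (auto simp: t_def divide_less_eq)
        ultimately have "norm (w - w') = norm (w - z) - r" by (simp add: algebra_simps)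
        then have "w \<in> ball w' e" using that by (simp add: dist_norm norm_minus_commute)
        then show ?thesis using \<open>w' \<in> cball z r\<close> by blast
      qed
      ultimately show thesis by (intro that[of "r + e"]) auto
    qed
    have c: "continuous_on (ball z r') h" "inj_on h (ball z r')"
      using S(2,3) r'(2) continuous_on_subset inj_on_subset by blast+
    obtain s where s: "0 < s" "s < r'" "winding_number (h \<circ> circlepath z s) (h z) = 1"
    proof (rule orientation_preserving_atE)
      show "orientation_preserving_at h z" "r' > 0" using * z r' by auto
      fix r0 assume "0 < r0" "r0 \<le> r'" "\<And>s. 0 < s \<Longrightarrow> s < r0 \<Longrightarrow> winding_number (h \<circ> circlepath z s) (h z) = 1"
      then show thesis using that[of "r0 / 2"] by auto
    qed
    have "h w \<noteq> h z" if "w \<in> ball z r' - {z}" for w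
      using c(2) z(2) r'(1) that by (auto dest: inj_onD)
    then show "winding_number (h \<circ> circlepath z r) (h z) = 1"
      using winding_number_circlepath_radius[OF c(1) _ s(1,2) z(2) r'(1)] s(3) by simp
  qed
qed

section \<open>Composition and cancellation of local orientations\<close>

lemma small_circle:
  assumes "continuous_on (ball z r) h" "r > 0" "e > 0"
  obtains s where "0 < s" "s < r" "h ` cball z s \<subseteq> ball (h z) e"
proof -
  have "isCont h z" using assms continuous_on_interior[of "ball z r" h z] by simp
  then obtain d where d: "d > 0" "\<And>w. dist w z < d \<Longrightarrow> dist (h w) (h z) < e"
    using assms(3) by (auto simp: continuous_at_eps_delta)
  show thesis
    by (rule that[of "min d r / 2"]) (use d assms in \<open>auto simp: dist_commute\<close>)
qed

text \<open>The winding number of a small circle under a composition is the product of the two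
  winding numbers, so any two of the three maps being orientation preserving forces the third.\<close>

lemma winding_number_compose_circle:
  assumes h: "continuous_on (ball z r) h" "inj_on h (ball z r)" and k: "continuous_on (ball (h z) e) k"
      "inj_on k (ball (h z) e)"
    and r: "0 < r" "0 < e"
  obtains s s' where "0 < s" "s < r" "0 < s'" "s' < e"
    "winding_number (k \<circ> h \<circ> circlepath z s) (k (h z)) =
       winding_number (h \<circ> circlepath z s) (h z) * winding_number (k \<circ> circlepath (h z) s') (k (h z))"
proof -
  obtain s where s: "0 < s" "s < r" "h ` cball z s \<subseteq> ball (h z) e"
    using small_circle[OF h(1) r] by blast
  have sub: "cball z s \<subseteq> ball z r" using s by auto
  have ci: "circlepath z s t \<in> cball z s" "circlepath z s t \<noteq> z" for t
    using circlepath_in_cball[of s z t] s by (auto simp: circlepath)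
  have "h (circlepath z s t) \<in> ball (h z) e - {h z}" for t
  proof -
    have "h (circlepath z s t) \<noteq> h z" using ci[of t] sub h(2) s r by (auto dest: inj_onD)
    then show ?thesis using s(3) ci(1)[of t] by blast
  qed
  then have "path_image (h \<circ> circlepath z s) \<subseteq> ball (h z) e - {h z}"
    by (auto simp: path_image_def)
  moreover have "path (h \<circ> circlepath z s)"
    using ci(1) sub by (intro path_continuous_image continuous_on_subset[OF h(1)])
      (auto simp: path_image_def)
  moreover have "pathfinish (h \<circ> circlepath z s) = pathstart (h \<circ> circlepath z s)"
    by (simp add: pathfinish_compose pathstart_compose)
  ultimately have "winding_number (k \<circ> (h \<circ> circlepath z s)) (k (h z)) =
       winding_number (h \<circ> circlepath z s) (h z) * winding_number (k \<circ> circlepath (h z) (e / 2)) (k (h z))"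
    using k r(2) by (intro winding_number_compose[OF k(1)]) (auto simp: inj_on_def)
  then show thesis using that[of s "e / 2"] s r(2) by (simp add: comp_assoc)
qed

lemma orientation_preserving_at_compose:
  assumes h: "orientation_preserving_at h z" and k: "orientation_preserving_at k (h z)"
  shows "orientation_preserving_at (k \<circ> h) z"
proof -
  obtain r where r: "0 < r" "continuous_on (ball z r) h" "inj_on h (ball z r)"
    "\<And>s. 0 < s \<Longrightarrow> s < r \<Longrightarrow> winding_number (h \<circ> circlepath z s) (h z) = 1"
    using h unfolding orientation_preserving_at_def by blast
  obtain e where e: "0 < e" "continuous_on (ball (h z) e) k" "inj_on k (ball (h z) e)"
    "\<And>s. 0 < s \<Longrightarrow> s < e \<Longrightarrow> winding_number (k \<circ> circlepath (h z) s) (k (h z)) = 1"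
    using k unfolding orientation_preserving_at_def by blast
  obtain s0 where s0: "0 < s0" "s0 < r" "h ` cball z s0 \<subseteq> ball (h z) e"
    using small_circle[OF r(2,1) e(1)] by blast
  have sub: "ball z s0 \<subseteq> ball z r" "h ` ball z s0 \<subseteq> ball (h z) e" using s0 by auto
  have h': "continuous_on (ball z s0) h" "inj_on h (ball z s0)"
    using r sub continuous_on_subset inj_on_subset by blast+
  obtain s s' where s: "0 < s" "s < s0" "0 < s'" "s' < e"
    "winding_number (k \<circ> h \<circ> circlepath z s) (k (h z)) =
       winding_number (h \<circ> circlepath z s) (h z) * winding_number (k \<circ> circlepath (h z) s') (k (h z))"
    by (rule winding_number_compose_circle[OF h' e(2,3) s0(1) e(1)])
  show ?thesis
  proof (rule orientation_preserving_atI[OF _ _ s(1,2)])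
    show "continuous_on (ball z s0) (k \<circ> h)"
      by (rule continuous_on_compose[OF h'(1) continuous_on_subset[OF e(2) sub(2)]])
    show "inj_on (k \<circ> h) (ball z s0)"
      by (rule comp_inj_on[OF h'(2) inj_on_subset[OF e(3) sub(2)]])
    show "winding_number (k \<circ> h \<circ> circlepath z s) ((k \<circ> h) z) = 1"
      using s r(4)[of s] s0 e(4)[of s'] by simp
  qed
qed

lemma orientation_preserving_at_cancel_left:
  assumes k: "orientation_preserving_at k (h z)" and kh: "orientation_preserving_at (k \<circ> h) z"
    and h: "continuous_on (ball z r) h" "inj_on h (ball z r)" "r > 0"
  shows "orientation_preserving_at h z"
proof -
  obtain e where e: "0 < e" "continuous_on (ball (h z) e) k" "inj_on k (ball (h z) e)"
    "\<And>s. 0 < s \<Longrightarrow> s < e \<Longrightarrow> winding_number (k \<circ> circlepath (h z) s) (k (h z)) = 1"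
    using k unfolding orientation_preserving_at_def by blast
  obtain r0 where r0: "0 < r0" "r0 \<le> r"
    "\<And>s. 0 < s \<Longrightarrow> s < r0 \<Longrightarrow> winding_number (k \<circ> h \<circ> circlepath z s) ((k \<circ> h) z) = 1"
    by (rule orientation_preserving_atE[OF kh h(3)]) blast
  have h': "continuous_on (ball z r0) h" "inj_on h (ball z r0)"
    by (rule continuous_on_subset[OF h(1) subset_ball[OF r0(2)]],
        rule inj_on_subset[OF h(2) subset_ball[OF r0(2)]])
  obtain s s' where s: "0 < s" "s < r0" "0 < s'" "s' < e"
    "winding_number (k \<circ> h \<circ> circlepath z s) (k (h z)) =
       winding_number (h \<circ> circlepath z s) (h z) * winding_number (k \<circ> circlepath (h z) s') (k (h z))"
    by (rule winding_number_compose_circle[OF h' e(2,3) r0(1) e(1)])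
  show ?thesis
    by (rule orientation_preserving_atI[OF h' s(1,2)])
      (use s r0(3)[of s] e(4)[of s'] in simp)
qed

lemma orientation_preserving_at_cancel_right:
  assumes h: "orientation_preserving_at h z" and kh: "orientation_preserving_at (k \<circ> h) z"
    and k: "continuous_on (ball (h z) e) k" "inj_on k (ball (h z) e)" "e > 0"
  shows "orientation_preserving_at k (h z)"
proof -
  obtain r where r: "0 < r" "r \<le> 1"
    "\<And>s. 0 < s \<Longrightarrow> s < r \<Longrightarrow> winding_number (k \<circ> h \<circ> circlepath z s) ((k \<circ> h) z) = 1"
    by (rule orientation_preserving_atE[OF kh zero_less_one]) blast
  obtain r0 where r0: "0 < r0" "r0 \<le> r" "continuous_on (ball z r0) h" "inj_on h (ball z r0)"
    "\<And>s. 0 < s \<Longrightarrow> s < r0 \<Longrightarrow> winding_number (h \<circ> circlepath z s) (h z) = 1"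
    by (rule orientation_preserving_atE[OF h r(1)]) blast
  obtain s s' where s: "0 < s" "s < r0" "0 < s'" "s' < e"
    "winding_number (k \<circ> h \<circ> circlepath z s) (k (h z)) =
       winding_number (h \<circ> circlepath z s) (h z) * winding_number (k \<circ> circlepath (h z) s') (k (h z))"
    by (rule winding_number_compose_circle[OF r0(3,4) k(1,2) r0(1) k(3)])
  show ?thesis
    by (rule orientation_preserving_atI[OF k(1,2) s(3,4)])
      (use s r0(2) r(3)[of s] r0(5)[of s] in simp)
qed

text \<open>\<open>K\<close> has a continuous logarithm \<open>M\<close> on the ball, so along a
  circle \<open>h - h z\<close> has the logarithm of \<open>w - z\<close> plus \<open>M\<close>. The
  second summand returns to its initial value, and the winding number is that of the circle. This
  serves the identity, scalings and, away from 0, power maps.\<close>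

lemma orientation_preserving_at_factor:
  assumes K: "continuous_on (ball z r) K" "\<And>w. w \<in> ball z r \<Longrightarrow> K w \<noteq> 0" and r: "r > 0"
    and h: "\<And>w. w \<in> ball z r \<Longrightarrow> h w - h z = (w - z) * K w" and inj: "inj_on h (ball z r)"
  shows "orientation_preserving_at h z"
proof -
  obtain M where M: "continuous_on (ball z r) M" "\<And>w. w \<in> ball z r \<Longrightarrow> K w = exp (M w)"
    using continuous_logarithm_on_ball[OF K] by blast
  let ?c = "circlepath z (r / 2)"
  let ?e = "\<lambda>t. of_real (ln (r / 2)) + 2 * of_real pi * \<i> * of_real t"
  let ?l = "\<lambda>t. ?e t + M (?c t)"
  have c: "?c t \<in> ball z r" for t
    using circlepath_in_cball[of "r / 2" z t] r by auto
  have "path ?l"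
  proof -
    have "continuous_on {0..1} ?c" using path_circlepath path_def by blast
    then show ?thesis unfolding path_def
      by (intro continuous_intros continuous_on_compose2[OF M(1)]) (use c in auto)
  qed
  moreover have "(h \<circ> ?c) t = h z + exp (?l t)" for t
    using h[OF c, of t] M(2)[OF c, of t] circlepath_exp[of "r / 2" z t] r
    by (simp add: exp_add algebra_simps)
  ultimately have "winding_number (h \<circ> ?c) (h z) = (?l 1 - ?l 0) / (2 * of_real pi * \<i>)"
    by (intro winding_number_exp_lift) auto
  also have "?c 1 = ?c 0" by (simp add: circlepath)
  then have "(?l 1 - ?l 0) / (2 * of_real pi * \<i>) = 1" by simp
  finally have wn: "winding_number (h \<circ> ?c) (h z) = 1" .
  have "continuous_on (ball z r) (\<lambda>w. h z + (w - z) * K w)"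
    by (intro continuous_intros K)
  then have "continuous_on (ball z r) h"
    by (rule continuous_on_eq) (use h in \<open>simp add: algebra_simps\<close>)
  then show ?thesis
    by (rule orientation_preserving_atI[OF _ inj _ _ wn]) (use r in auto)
qed

lemma orientation_preserving_at_id: "orientation_preserving_at (\<lambda>w. w) z"
  by (rule orientation_preserving_at_factor[of z 1 "\<lambda>_. 1"]) auto

lemma orientation_preserving_at_mult:
  assumes "c \<noteq> 0" shows "orientation_preserving_at (\<lambda>w. c * w) z"
  by (rule orientation_preserving_at_factor[of z 1 "\<lambda>_. c"]) (use assms in \<open>auto simp: algebra_simps inj_on_def\<close>)

lemma orientation_preserving_at_power:
  assumes z: "z \<noteq> 0" and d: "1 \<le> d" shows "orientation_preserving_at (\<lambda>w. w ^ d) z"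
proof -
  \<comment> \<open>The divided difference of \<open>w ^ d\<close> at \<open>z\<close>. Its value
    there is the derivative \<open>d * z ^ (d - 1)\<close>, so it has no zero nearby.\<close>
  define K where "K = (\<lambda>w. \<Sum>i<d. z ^ (d - Suc i) * w ^ i)"
  have Kz: "K z = of_nat d * z ^ (d - 1)"
    unfolding K_def by (simp flip: power_add)
  have cK: "continuous_on UNIV K" unfolding K_def by (intro continuous_intros)
  have "open {w. K w \<noteq> 0}" using open_Collect_neq[of K "\<lambda>_. 0"] cK by simp
  moreover have "K z \<noteq> 0" using Kz z d by auto
  ultimately obtain e where e: "e > 0" "ball z e \<subseteq> {w. K w \<noteq> 0}" using open_contains_ball by blast
  have "deriv (\<lambda>w. w ^ d) z = of_nat d * z ^ (d - 1)"
    by (rule DERIV_imp_deriv) (auto intro!: derivative_eq_intros)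
  then have "deriv (\<lambda>w. w ^ d) z \<noteq> 0" using z d by auto
  then obtain r where r: "r > 0" "inj_on (\<lambda>w. w ^ d) (ball z r)"
    using has_complex_derivative_locally_injective[of "\<lambda>w. w ^ d" UNIV z,
        OF holomorphic_on_power[OF holomorphic_on_ident]] by auto
  show ?thesis
  proof (rule orientation_preserving_at_factor)
    show "continuous_on (ball z (min r e)) K" using cK continuous_on_subset by blast
    show "inj_on (\<lambda>w. w ^ d) (ball z (min r e))" using r(2) by (rule inj_on_subset) auto
    show "w ^ d - z ^ d = (w - z) * K w" for w unfolding K_def by (rule power_diff_sumr2)
  qed (use e r in auto)
qed

section \<open>Lifting a chart change through a power map\<close>

lemma winding_number_power:
  assumes "path c" "0 \<notin> path_image c"
  shows "winding_number (\<lambda>t. c t ^ d) 0 = of_nat d * winding_number c 0"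
proof -
  obtain l where l: "path l" "\<And>t. t \<in> {0..1} \<Longrightarrow> c t = 0 + exp (l t)"
    "winding_number c 0 = (l 1 - l 0) / (2 * of_real pi * \<i>)"
    using exp_lift_path[OF assms] by blast
  have "path (\<lambda>t. of_nat d * l t)" using l(1) unfolding path_def by (intro continuous_intros)
  then show ?thesis
    using winding_number_exp_lift[of "\<lambda>t. of_nat d * l t" "\<lambda>t. c t ^ d" 0] l
    by (simp add: exp_of_nat_mult right_diff_distrib)
qed

lemma exp_Ln_shift:
  obtains m :: int where "Ln (exp u) = u + 2 * of_real pi * \<i> * of_int m"
proof -
  have "exp (Ln (exp u)) = exp u" by simp
  then obtain m :: int where "Ln (exp u) = u + of_real (of_int (2 * m) * pi) * \<i>"
    unfolding exp_eq by blast
  then show thesis by (intro that[of m]) simp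
qed

text \<open>Writing \<open>\<kappa> (exp u) = exp (L u)\<close> with \<open>L (u + 2 \<pi> i) = L u + 2 \<pi> i\<close>, the map
  \<open>exp u \<mapsto> exp (L (d u) / d)\<close> is well defined and is the required lift.\<close>

lemma root_lift:
  assumes \<kappa>: "continuous_on (ball 0 1) \<kappa>" "inj_on \<kappa> (ball 0 1)" "\<kappa> 0 = 0"
    and op: "\<And>w. w \<in> ball 0 1 \<Longrightarrow> orientation_preserving_at \<kappa> w" and d: "1 \<le> d"
  obtains S where "continuous_on (ball 0 1) S" "inj_on S (ball 0 1)" "S 0 = 0"
    "\<And>w. w \<in> ball 0 1 \<Longrightarrow> S w ^ d = \<kappa> (w ^ d)"
    "S ` ball 0 1 = {v. v ^ d \<in> \<kappa> ` ball 0 1}"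
    "\<And>w. w \<in> ball 0 1 \<Longrightarrow> orientation_preserving_at S w"
proof -
  let ?p = "2 * of_real pi * \<i> :: complex" and ?B = "ball 0 1 :: complex set"
  have \<kappa>0: "\<kappa> w \<noteq> \<kappa> 0" if "w \<in> ?B - {0}" for w using \<kappa>(2) that by (auto dest: inj_onD)
  obtain L n where L0: "continuous_on {w. Re w < ln 1} L"
    "\<And>w. Re w < ln 1 \<Longrightarrow> \<kappa> (0 + exp w) = \<kappa> 0 + exp (L w)"
    "\<And>w m. Re w < ln 1 \<Longrightarrow> L (w + ?p * of_int m) = L w + ?p * of_int (n * m)"
    by (rule exp_lift_punctured_ball[OF \<kappa>(1) \<kappa>0]) (assumption, simp, blast)
  have L: "continuous_on {w. Re w < 0} L" "\<And>w. Re w < 0 \<Longrightarrow> \<kappa> (exp w) = exp (L w)"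
    "\<And>w m. Re w < 0 \<Longrightarrow> L (w + ?p * of_int m) = L w + ?p * of_int (n * m)"
    using L0 \<kappa>(3) by simp_all
  \<comment> \<open>\<open>n\<close> is the winding number of a small circle under
    \<open>\<kappa>\<close>, so preservation of orientation fixes it. The value 1 makes
    \<open>S\<close> commute with rotations by \<open>d\<close>-th roots of unity.\<close>
  have n: "n = 1"
  proof -
    obtain r where r: "0 < r" "r \<le> 1" "\<And>s. 0 < s \<Longrightarrow> s < r \<Longrightarrow> winding_number (\<kappa> \<circ> circlepath 0 s) (\<kappa> 0) = 1"
      by (rule orientation_preserving_atE[OF op[of 0] zero_less_one]) (simp, blast)
    let ?l = "\<lambda>t. of_real (ln (r / 2)) + ?p * of_real t"
    have neg: "Re (?l t) < 0" for t using r by simp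
    have "path (L \<circ> ?l)" unfolding path_def
      by (intro continuous_on_compose continuous_on_subset[OF L(1)] continuous_intros) (use neg in auto)
    moreover have "(\<kappa> \<circ> circlepath 0 (r / 2)) t = \<kappa> 0 + exp ((L \<circ> ?l) t)" for t
      using L(2)[OF neg, of t] circlepath_exp[of "r / 2" 0 t] r(1) \<kappa>(3) by simp
    ultimately have "winding_number (\<kappa> \<circ> circlepath 0 (r / 2)) (\<kappa> 0) = ((L \<circ> ?l) 1 - (L \<circ> ?l) 0) / ?p"
      by (rule winding_number_exp_lift)
    also have "\<dots> = of_int n"
      using L(3)[OF neg, of 0 1] by simp
    finally have "of_int n = (1 :: complex)" using r(3)[of "r / 2"] r(1) by simp
    then show ?thesis by (metis of_int_eq_1_iff)
  qed
  \<comment> \<open>The principal \<open>Ln\<close> jumps along the negative axis, but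
    \<open>S_exp\<close> shows that every logarithm of \<open>w\<close> yields the same value:
    changing it by \<open>2 * pi * i * m\<close> changes \<open>L (d u) / d\<close> by
    \<open>2 * pi * i * m\<close>, which \<open>exp\<close> ignores.\<close>
  define S where "S = (\<lambda>w. if w = 0 then 0 else exp (L (of_nat d * Ln w) / of_nat d))"
  have S_exp: "S (exp u) = exp (L (of_nat d * u) / of_nat d)" if u: "Re u < 0" for u
  proof -
    obtain m :: int where m: "Ln (exp u) = u + ?p * of_int m" by (rule exp_Ln_shift)
    have "of_nat d * Ln (exp u) = of_nat d * u + ?p * of_int (int d * m)" by (simp add: m algebra_simps)
    moreover have "Re (of_nat d * u) < 0" using u d by (simp add: mult_pos_neg)
    ultimately have "L (of_nat d * Ln (exp u)) = L (of_nat d * u) + ?p * of_int (int d * m)"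
      using L(3)[of "of_nat d * u" "int d * m"] n by simp
    then have "L (of_nat d * Ln (exp u)) / of_nat d = L (of_nat d * u) / of_nat d + ?p * of_int m"
      using d by (simp add: field_simps)
    moreover have "exp (?p * of_int m) = 1"
      using exp_integer_2pi[of "of_int m"] by (simp add: mult_ac)
    ultimately show ?thesis by (simp add: S_def exp_add)
  qed
  have neg: "Re (Ln w) < 0" if "w \<in> ?B" "w \<noteq> 0" for w using that by simp
  have neg': "Re (of_nat d * Ln w) < 0" if "w \<in> ?B" "w \<noteq> 0" for w
    using neg[OF that] d by (simp add: mult_pos_neg)
  have S0: "S 0 = 0" by (simp add: S_def)
  have Sd: "S w ^ d = \<kappa> (w ^ d)" if "w \<in> ?B" for w
  proof (cases "w = 0")
    case False
    have "S w ^ d = exp (L (of_nat d * Ln w))"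
      using False d by (simp add: S_def flip: exp_of_nat_mult)
    also have "\<dots> = \<kappa> (exp (of_nat d * Ln w))" using L(2)[OF neg'[OF that False]] by simp
    also have "exp (of_nat d * Ln w) = w ^ d" using False by (simp add: exp_of_nat_mult)
    finally show ?thesis .
  qed (use S0 \<kappa>(3) d in \<open>simp add: power_0_left\<close>)
  have Snz: "S w \<noteq> 0" if "w \<noteq> 0" for w using that by (simp add: S_def)
  have wd: "w ^ d \<in> ?B" if "w \<in> ?B" for w
    using that d by (simp add: norm_power power_less_one_iff)
  have cont: "continuous_on ?B S"
  proof -
    have "isCont S w" if w: "w \<in> ?B" for w
    proof (cases "w = 0")
      case True
      have "isCont (\<lambda>w. \<kappa> (w ^ d)) 0"
      proof -
        have "continuous_on ?B (\<lambda>w. \<kappa> (w ^ d))"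
          by (rule continuous_on_compose2[OF \<kappa>(1)]) (use wd in \<open>auto intro!: continuous_intros\<close>)
        then show ?thesis by (rule continuous_on_interior) simp
      qed
      \<comment> \<open>At 0 only the modulus matters: \<open>norm (S w)\<close> is the
        \<open>d\<close>-th root of \<open>norm (\<kappa> (w ^ d))\<close>, which tends to
        0.\<close>
      then have "isCont (\<lambda>w. root d (norm (\<kappa> (w ^ d)))) 0" by (intro continuous_intros)
      then have "((\<lambda>w. root d (norm (\<kappa> (w ^ d)))) \<longlongrightarrow> 0) (at 0)"
        using \<kappa>(3) d by (simp add: isCont_def power_0_left)
      moreover have "eventually (\<lambda>w. root d (norm (\<kappa> (w ^ d))) = norm (S w)) (at 0)"
      proof -
        have "eventually (\<lambda>w. w \<in> ?B) (at 0)" by (intro eventually_at_in_open') auto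
        then show ?thesis
        proof eventually_elim
          case (elim w)
          then show ?case using Sd[OF elim] d by (simp add: norm_power real_root_power_cancel flip: Sd)
        qed
      qed
      ultimately have "((\<lambda>w. norm (S w)) \<longlongrightarrow> 0) (at 0)" by (rule Lim_transform_eventually)
      then show ?thesis using True S0 by (simp add: isCont_def tendsto_norm_zero_iff)
    next
      case False
      \<comment> \<open>Any continuous logarithm near \<open>w\<close> proves continuity of
        \<open>S\<close> there. Two branches suffice, one cut along the negative and one along the
        positive half-axis.\<close>
      have branch: "isCont S w" if l: "open A" "w \<in> A" "continuous_on A l"
        "\<And>z. z \<in> A \<Longrightarrow> exp (l z) = z \<and> Re (l z) < 0" for A l
      proof -
        have "continuous_on A (\<lambda>z. exp (L (of_nat d * l z) / of_nat d))"
        proof (intro continuous_intros continuous_on_compose2[OF L(1)] l(3))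
          show "(\<lambda>z. of_nat d * l z) ` A \<subseteq> {w. Re w < 0}"
            using l(4) d by (auto simp: mult_pos_neg)
        qed (use d in auto)
        then have "continuous_on A S"
          by (rule continuous_on_eq) (use S_exp l(4) in metis)
        then show ?thesis using l(1,2) continuous_on_eq_continuous_at by blast
      qed
      show ?thesis
      proof (cases "w \<in> \<real>\<^sub>\<le>\<^sub>0")
        case False
        show ?thesis
        proof (rule branch[of "?B - \<real>\<^sub>\<le>\<^sub>0" Ln])
          show "continuous_on (?B - \<real>\<^sub>\<le>\<^sub>0) Ln" by (intro continuous_on_Ln) auto
          show "exp (Ln z) = z \<and> Re (Ln z) < 0" if "z \<in> ?B - \<real>\<^sub>\<le>\<^sub>0" for z
          proof -
            have "z \<noteq> 0" using that by auto
            then show ?thesis using neg[of z] that by simp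
          qed
        qed (use False w in \<open>auto intro!: open_Diff closed_nonpos_Reals_complex\<close>)
      next
        case True
        show ?thesis
        proof (rule branch[of "?B - \<real>\<^sub>\<ge>\<^sub>0" "\<lambda>z. Ln (- z) + of_real pi * \<i>"])
          show "continuous_on (?B - \<real>\<^sub>\<ge>\<^sub>0) (\<lambda>z. Ln (- z) + of_real pi * \<i>)"
            by (intro continuous_intros) (auto simp: complex_nonpos_Reals_iff complex_nonneg_Reals_iff)
          show "exp (Ln (- z) + of_real pi * \<i>) = z \<and> Re (Ln (- z) + of_real pi * \<i>) < 0"
            if "z \<in> ?B - \<real>\<^sub>\<ge>\<^sub>0" for z
          proof -
            have "z \<noteq> 0" using that by auto
            then show ?thesis using neg[of "- z"] that by (simp add: exp_add exp_pi_i)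
          qed
        qed (use True False w in \<open>auto intro!: open_Diff closed_nonneg_Reals_complex
            simp: complex_nonpos_Reals_iff complex_nonneg_Reals_iff complex_eq_iff\<close>)
      qed
    qed
    then show ?thesis by (simp add: continuous_at_imp_continuous_on)
  qed
  \<comment> \<open>Equivariance under \<open>d\<close>-th roots of unity. Injectivity of
    \<open>S\<close> and the description of its image both reduce to it, since a \<open>d\<close>-th
    power determines its root up to such a factor.\<close>
  have rot: "S (w * exp (?p * of_int j / of_nat d)) = S w * exp (?p * of_int j / of_nat d)"
    if w: "w \<in> ?B" "w \<noteq> 0" for w j
  proof -
    let ?u = "Ln w + ?p * of_int j / of_nat d"
    have Re: "Re ?u = Re (Ln w)" by simp
    have "of_nat d * ?u = of_nat d * Ln w + ?p * of_int j" using d by (simp add: field_simps)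
    then have "L (of_nat d * ?u) / of_nat d = L (of_nat d * Ln w) / of_nat d + ?p * of_int j / of_nat d"
      using L(3)[OF neg'[OF w], of j] n by (simp add: add_divide_distrib)
    moreover have "w * exp (?p * of_int j / of_nat d) = exp ?u" using w by (simp add: exp_add)
    ultimately show ?thesis using S_exp[of ?u] S_exp[of "Ln w"] neg[OF w] w Re by (simp add: exp_add)
  qed
  have unity: "\<exists>j::int. a = b * exp (?p * of_int j / of_nat d)" if "a ^ d = b ^ d" "b \<noteq> 0" for a b :: complex
  proof -
    have "(a / b) ^ d = 1" using that by (simp add: power_divide)
    moreover have "a / b \<noteq> 0" using calculation d by (auto simp: power_0_left)
    ultimately have "exp (of_nat d * Ln (a / b)) = exp 0" by (simp add: exp_of_nat_mult)
    then obtain j :: int where "of_nat d * Ln (a / b) = of_int (2 * j) * of_real pi * \<i>"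
      unfolding exp_eq by auto
    then have "Ln (a / b) = ?p * of_int j / of_nat d" using d by (simp add: field_simps)
    then have "a / b = exp (?p * of_int j / of_nat d)" using \<open>a / b \<noteq> 0\<close> by (metis exp_Ln)
    then show ?thesis using that(2) by (intro exI[of _ j]) (simp add: field_simps)
  qed
  have inj: "inj_on S ?B"
  proof (rule inj_onI)
    fix a b assume ab: "a \<in> ?B" "b \<in> ?B" "S a = S b"
    show "a = b"
    proof (cases "b = 0")
      case True then show ?thesis using ab(3) Snz S0 by metis
    next
      case False
      have "\<kappa> (a ^ d) = \<kappa> (b ^ d)" using Sd ab by metis
      then have "a ^ d = b ^ d" using \<kappa>(2) wd ab by (auto dest: inj_onD)
      then obtain j :: int where j: "a = b * exp (?p * of_int j / of_nat d)" using unity False by blast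
      then have "S b = S b * exp (?p * of_int j / of_nat d)" using rot[OF ab(2) False, of j] ab(3) by simp
      then have "exp (?p * of_int j / of_nat d) = 1" using Snz[OF False] by simp
      then show ?thesis using j by simp
    qed
  qed
  have img: "S ` ?B = {v. v ^ d \<in> \<kappa> ` ?B}"
  proof (intro equalityI subsetI)
    fix v assume "v \<in> S ` ?B"
    then show "v \<in> {v. v ^ d \<in> \<kappa> ` ?B}" using Sd wd by auto
  next
    fix v assume "v \<in> {v. v ^ d \<in> \<kappa> ` ?B}"
    then obtain x where x: "x \<in> ?B" "v ^ d = \<kappa> x" by auto
    show "v \<in> S ` ?B"
    proof (cases "x = 0")
      case True
      then have "v = 0" using x \<kappa>(3) d by simp
      then show ?thesis using S0 by (metis centre_in_ball image_eqI zero_less_one)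
    next
      case False
      define w where "w = exp (Ln x / of_nat d)"
      have "w ^ d = x" using False d by (simp add: w_def flip: exp_of_nat_mult)
      moreover have "w \<noteq> 0" by (simp add: w_def)
      moreover have "Re (Ln x / of_nat d) < 0" using neg[OF x(1) False] d by (simp add: divide_neg_pos)
      then have "w \<in> ?B" by (simp add: w_def)
      ultimately obtain j :: int where j: "v = S w * exp (?p * of_int j / of_nat d)"
        using unity[of v "S w"] Sd[of w] x Snz by metis
      have "w * exp (?p * of_int j / of_nat d) \<in> ?B" using \<open>w \<in> ?B\<close> by (simp add: norm_mult)
      then show ?thesis using rot[OF \<open>w \<in> ?B\<close> \<open>w \<noteq> 0\<close>, of j] j by (metis image_eqI)
    qed
  qed
  have opS: "orientation_preserving_at S w" if w: "w \<in> ?B" for w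
  proof (cases "w = 0")
    case False
    have sub: "ball w (1 - norm w) \<subseteq> ?B" by (auto simp: dist_norm) (metis add.commute less_diff_eq norm_triangle_sub order_le_less_trans norm_minus_commute)
    \<comment> \<open>Off 0 the power map is an oriented local coordinate and cancels from
      \<open>S w ^ d = \<kappa> (w ^ d)\<close>.\<close>
    have 1: "orientation_preserving_at (\<kappa> \<circ> (\<lambda>z. z ^ d)) w"
      by (rule orientation_preserving_at_compose[OF orientation_preserving_at_power[OF False d] op[OF wd[OF w]]])
    have "orientation_preserving_at ((\<lambda>z. z ^ d) \<circ> S) w"
      by (rule orientation_preserving_at_cong[OF 1 open_ball w]) (simp add: Sd)
    then show ?thesis
      using orientation_preserving_at_cancel_left[of "\<lambda>z. z ^ d" S w "1 - norm w"]
        orientation_preserving_at_power[OF Snz[OF False] d] continuous_on_subset[OF cont sub] inj_on_subset[OF inj sub] w by simp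
  next
    case True
    obtain r where r: "0 < r" "r \<le> 1" "\<And>s. 0 < s \<Longrightarrow> s < r \<Longrightarrow> winding_number (\<kappa> \<circ> circlepath 0 s) (\<kappa> 0) = 1"
      by (rule orientation_preserving_atE[OF op[of 0] zero_less_one]) (simp, blast)
    define s where "s = r / 2"
    have s: "0 < s" "s < r" "s < 1" using r by (auto simp: s_def)
    let ?c = "circlepath 0 s"
    have cn: "norm (?c t) = s" for t using s by (simp add: circlepath norm_mult)
    then have cB: "?c t \<in> ?B" "?c t \<noteq> 0" for t
    proof -
      show "?c t \<in> ?B" using cn s(3) by simp
      show "?c t \<noteq> 0" using cn[of t] s(1) by (metis less_irrefl norm_zero)
    qed
    have ps: "path (S \<circ> ?c)"
      by (intro path_continuous_image continuous_on_subset[OF cont]) (use cB in \<open>auto simp: path_image_def\<close>)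
    have "0 \<notin> path_image (S \<circ> ?c)" using cB(2) Snz by (auto simp: path_image_def)
    \<comment> \<open>At 0 the power map cannot be cancelled. Instead the winding numbers of both
      sides of \<open>S w ^ d = \<kappa> (w ^ d)\<close> along a circle are compared:
      \<open>d\<close> times that of \<open>S\<close> against \<open>d\<close> times 1.\<close>
    then have "of_nat d * winding_number (S \<circ> ?c) 0 = winding_number (\<lambda>t. (S \<circ> ?c) t ^ d) 0"
      using winding_number_power[OF ps] by simp
    also have "(\<lambda>t. (S \<circ> ?c) t ^ d) = \<kappa> \<circ> (\<lambda>t. ?c t ^ d)" using Sd cB(1) by (simp add: fun_eq_iff)
    also have "winding_number (\<kappa> \<circ> (\<lambda>t. ?c t ^ d)) 0
        = winding_number (\<lambda>t. ?c t ^ d) 0 * winding_number (\<kappa> \<circ> ?c) (\<kappa> 0)"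
    proof -
      have "continuous_on {0..1} ?c" using path_circlepath path_def by blast
      then have "path (\<lambda>t. ?c t ^ d)" unfolding path_def by (intro continuous_intros)
      moreover have "?c t ^ d \<in> ?B - {0}" for t using wd[OF cB(1)] cB(2) by simp
      then have "path_image (\<lambda>t. ?c t ^ d) \<subseteq> ?B - {0}" by (auto simp: path_image_def)
      moreover have "pathfinish (\<lambda>t. ?c t ^ d) = pathstart (\<lambda>t. ?c t ^ d)"
        by (simp add: pathfinish_def pathstart_def circlepath)
      ultimately show ?thesis using winding_number_compose[OF \<kappa>(1) \<kappa>0 _ _ _ s(1,3)] \<kappa>(3) by simp
    qed
    also have "winding_number (\<lambda>t. ?c t ^ d) 0 = of_nat d"
      using winding_number_power[of ?c d] cB(2) s(1)
      by (simp add: winding_number_circlepath_centre path_image_def image_iff)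
    finally have "winding_number (S \<circ> ?c) 0 = 1" using r(3)[OF s(1,2)] d by (simp add: comp_def)
    then show ?thesis
      using orientation_preserving_atI[of 0 1 S s] cont inj s S0 True by simp
  qed
  show thesis by (rule that[OF cont inj S0 Sd img opS])
qed

section \<open>Oriented charts and local degrees\<close>

text \<open>\<open>F\<close> is tested in the charts of the atlas around \<open>u\<close> and need
  not be a chart itself. This admits pullbacks of coordinates along the quotient map, which are
  local coordinates only near some points.\<close>

definition oriented_at :: "'a surface \<Rightarrow> ('a \<Rightarrow> complex) \<Rightarrow> 'a \<Rightarrow> bool" where
  "oriented_at S F u \<longleftrightarrow>
     (\<forall>(W, \<theta>)\<in>surf_atlas S. u \<in> W \<longrightarrow> orientation_preserving_at (F \<circ> inv_into W \<theta>) (\<theta> u))"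

lemma oriented_atD:
  "oriented_at S F u \<Longrightarrow> (W, \<theta>) \<in> surf_atlas S \<Longrightarrow> u \<in> W \<Longrightarrow>
     orientation_preserving_at (F \<circ> inv_into W \<theta>) (\<theta> u)"
  unfolding oriented_at_def by blast

context
  fixes S :: "'a surface"
  assumes atlas: "oriented_atlas (surf_top S) (surf_atlas S)"
begin

lemma atlas_chart:
  assumes "(W, \<theta>) \<in> surf_atlas S"
  shows "W \<subseteq> points S" "openin (surf_top S) W" "inj_on \<theta> W" "open (\<theta> ` W)"
    "homeomorphic_map (subtopology (surf_top S) W) (top_of_set (\<theta> ` W)) \<theta>"
  using oriented_atlasD[OF atlas assms] atlas assms unfolding oriented_atlas_def by auto

lemma ex_atlas_chart:
  assumes "u \<in> points S" obtains W \<theta> where "(W, \<theta>) \<in> surf_atlas S" "u \<in> W"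
  using atlas assms unfolding oriented_atlas_def by blast

lemma open_chart_image:
  assumes W: "(W, \<theta>) \<in> surf_atlas S" and N: "openin (surf_top S) N"
  shows "open (\<theta> ` (N \<inter> W))"
proof -
  have "openin (subtopology (surf_top S) W) (N \<inter> W)" using N by (rule openin_subtopology_Int)
  then have "openin (top_of_set (\<theta> ` W)) (\<theta> ` (N \<inter> W))"
    using homeomorphic_imp_open_map[OF atlas_chart(5)[OF W]] open_map_def by blast
  then show ?thesis using atlas_chart(4)[OF W] openin_open_trans by blast
qed

lemma continuous_on_chart:
  assumes W: "(W, \<theta>) \<in> surf_atlas S"
    and F: "continuous_map (subtopology (surf_top S) N) euclidean F"
  shows "continuous_on (\<theta> ` (N \<inter> W)) (F \<circ> inv_into W \<theta>)"
proof -
  have top: "topspace (subtopology (surf_top S) W) = W" using atlas_chart(1)[OF W] by auto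
  have "homeomorphic_maps (subtopology (surf_top S) W) (top_of_set (\<theta> ` W)) \<theta> (inv_into W \<theta>)"
  proof -
    obtain k where k: "homeomorphic_maps (subtopology (surf_top S) W) (top_of_set (\<theta> ` W)) \<theta> k"
      using atlas_chart(5)[OF W] homeomorphic_map_maps by blast
    have "k z = inv_into W \<theta> z" if "z \<in> \<theta> ` W" for z
      using k that atlas_chart(3)[OF W] top unfolding homeomorphic_maps_def by auto
    then show ?thesis using k by (auto simp: homeomorphic_maps_def top intro: continuous_map_eq)
  qed
  then have "continuous_map (top_of_set (\<theta> ` W)) (surf_top S) (inv_into W \<theta>)"
    unfolding homeomorphic_maps_def by (simp add: continuous_map_in_subtopology)
  then have "continuous_map (top_of_set (\<theta> ` (N \<inter> W))) (surf_top S) (inv_into W \<theta>)"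
    by (rule continuous_map_from_subtopology_mono) auto
  moreover have "inv_into W \<theta> z \<in> N" if "z \<in> \<theta> ` (N \<inter> W)" for z
    using that atlas_chart(3)[OF W] by auto
  ultimately have "continuous_map (top_of_set (\<theta> ` (N \<inter> W))) (subtopology (surf_top S) N) (inv_into W \<theta>)"
    by (auto simp: continuous_map_in_subtopology)
  then show ?thesis using F continuous_map_compose by fastforce
qed

lemma inj_on_chart:
  assumes W: "(W, \<theta>) \<in> surf_atlas S" and F: "inj_on F N"
  shows "inj_on (F \<circ> inv_into W \<theta>) (\<theta> ` (N \<inter> W))"
  using F atlas_chart(3)[OF W] by (auto simp: inj_on_def)

lemma oriented_at_cong:
  assumes F: "oriented_at S F u" and N: "openin (surf_top S) N" "u \<in> N" "\<And>v. v \<in> N \<Longrightarrow> F v = G v"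
  shows "oriented_at S G u"
  unfolding oriented_at_def
proof clarify
  fix W \<theta> assume W: "(W, \<theta>) \<in> surf_atlas S" "u \<in> W"
  show "orientation_preserving_at (G \<circ> inv_into W \<theta>) (\<theta> u)"
  proof (rule orientation_preserving_at_cong[OF oriented_atD[OF F W] open_chart_image[OF W(1) N(1)]])
    show "\<theta> u \<in> \<theta> ` (N \<inter> W)" using W N by blast
    show "(F \<circ> inv_into W \<theta>) w = (G \<circ> inv_into W \<theta>) w" if "w \<in> \<theta> ` (N \<inter> W)" for w
      using that N(3) atlas_chart(3)[OF W(1)] by auto
  qed
qed

lemma oriented_at_compose:
  assumes G: "oriented_at S G u" and k: "orientation_preserving_at k (G u)"
  shows "oriented_at S (k \<circ> G) u"
  unfolding oriented_at_def
proof clarify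
  fix W \<theta> assume W: "(W, \<theta>) \<in> surf_atlas S" "u \<in> W"
  have "(G \<circ> inv_into W \<theta>) (\<theta> u) = G u" using W atlas_chart(3) by simp
  then show "orientation_preserving_at (k \<circ> G \<circ> inv_into W \<theta>) (\<theta> u)"
    using orientation_preserving_at_compose[OF oriented_atD[OF G W], of k] k by (simp add: comp_assoc)
qed

text \<open>\<open>k\<close> is the transition between the coordinates \<open>G\<close> and
  \<open>k \<circ> G\<close>; chart changes are shown to be oriented by this cancellation.\<close>

lemma oriented_at_cancel_right:
  assumes u: "u \<in> points S" and G: "oriented_at S G u" and kG: "oriented_at S (k \<circ> G) u"
    and k: "continuous_on (ball (G u) e) k" "inj_on k (ball (G u) e)" "e > 0"
  shows "orientation_preserving_at k (G u)"
proof -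
  obtain W \<theta> where W: "(W, \<theta>) \<in> surf_atlas S" "u \<in> W" using ex_atlas_chart[OF u] .
  have "(G \<circ> inv_into W \<theta>) (\<theta> u) = G u" using W atlas_chart(3) by simp
  then show ?thesis
    using orientation_preserving_at_cancel_right[OF oriented_atD[OF G W], of k e]
      oriented_atD[OF kG W] k by (simp add: comp_assoc)
qed

text \<open>In each atlas chart a disk chart is continuous and injective, so the condition on sets
  may be checked at points.\<close>

lemma disk_chart_iff:
  "disk_chart S U \<phi> \<longleftrightarrow> openin (surf_top S) U \<and>
     homeomorphic_map (subtopology (surf_top S) U) (top_of_set (ball 0 1)) \<phi> \<and>
     (\<forall>u\<in>U. oriented_at S \<phi> u)"
proof -
  have "(\<forall>(W, \<theta>)\<in>surf_atlas S. orientation_preserving_on (\<theta> ` (U \<inter> W)) (\<phi> \<circ> inv_into W \<theta>)) \<longleftrightarrow>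
      (\<forall>u\<in>U. oriented_at S \<phi> u)"
    if U: "openin (surf_top S) U"
      and \<phi>: "homeomorphic_map (subtopology (surf_top S) U) (top_of_set (ball 0 1)) \<phi>"
  proof -
    have c: "continuous_map (subtopology (surf_top S) U) euclidean \<phi>"
      using homeomorphic_imp_continuous_map[OF \<phi>] continuous_map_in_subtopology by blast
    have i: "inj_on \<phi> U"
      using homeomorphic_imp_injective_map[OF \<phi>] openin_subset[OF U] by (simp add: inf.absorb2)
    have "orientation_preserving_on (\<theta> ` (U \<inter> W)) (\<phi> \<circ> inv_into W \<theta>) \<longleftrightarrow>
      (\<forall>u\<in>U \<inter> W. orientation_preserving_at (\<phi> \<circ> inv_into W \<theta>) (\<theta> u))"
      if W: "(W, \<theta>) \<in> surf_atlas S" for W \<theta>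
      using orientation_preserving_on_iff_at[OF open_chart_image[OF W U] continuous_on_chart[OF W c]
          inj_on_chart[OF W i]] by blast
    then show ?thesis unfolding oriented_at_def by blast
  qed
  then show ?thesis unfolding disk_chart_def by blast
qed

end

lemma is_surface_atlas: "is_surface S \<Longrightarrow> oriented_atlas (surf_top S) (surf_atlas S)"
  by (simp add: is_surface_def)

lemma disk_chart_props:
  assumes "disk_chart S U \<phi>"
  shows "openin (surf_top S) U" "U \<subseteq> points S" "inj_on \<phi> U" "\<phi> ` U = ball 0 1"
    "continuous_map (subtopology (surf_top S) U) euclidean \<phi>"
    "\<And>N. openin (surf_top S) N \<Longrightarrow> open (\<phi> ` (N \<inter> U))"
    "\<And>D. open D \<Longrightarrow> openin (surf_top S) {u \<in> U. \<phi> u \<in> D}"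
proof -
  show U: "openin (surf_top S) U" using assms unfolding disk_chart_def by auto
  have h: "homeomorphic_map (subtopology (surf_top S) U) (top_of_set (ball 0 1)) \<phi>"
    using assms unfolding disk_chart_def by auto
  show sub: "U \<subseteq> points S" "inj_on \<phi> U" "\<phi> ` U = ball 0 1" using disk_chartD[OF assms] by auto
  show c: "continuous_map (subtopology (surf_top S) U) euclidean \<phi>"
    using homeomorphic_imp_continuous_map[OF h] continuous_map_in_subtopology by blast
  show "open (\<phi> ` (N \<inter> U))" if "openin (surf_top S) N" for N
  proof -
    have "openin (subtopology (surf_top S) U) (N \<inter> U)" using that by (rule openin_subtopology_Int)
    then have "openin (top_of_set (ball 0 1)) (\<phi> ` (N \<inter> U))"
      using homeomorphic_imp_open_map[OF h] open_map_def by blast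
    then show ?thesis using openin_open_trans by blast
  qed
  show "openin (surf_top S) {u \<in> U. \<phi> u \<in> D}" if "open D" for D
  proof -
    have "openin (subtopology (surf_top S) U) {u \<in> topspace (subtopology (surf_top S) U). \<phi> u \<in> D}"
      using c that by (intro openin_continuous_map_preimage) auto
    moreover have "topspace (subtopology (surf_top S) U) = U" using sub(1) by auto
    ultimately show ?thesis using U openin_trans_full by fastforce
  qed
qed

lemma disk_chart_oriented:
  "is_surface S \<Longrightarrow> disk_chart S U \<phi> \<Longrightarrow> u \<in> U \<Longrightarrow> oriented_at S \<phi> u"
  using disk_chart_iff is_surface_atlas by blast

lemma disk_chartI:
  assumes S: "is_surface S" and U: "openin (surf_top S) U"
    and c: "continuous_map (subtopology (surf_top S) U) euclidean \<phi>"
    and i: "inj_on \<phi> U" and im: "\<phi> ` U = ball 0 1"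
    and o: "\<And>N. openin (surf_top S) N \<Longrightarrow> N \<subseteq> U \<Longrightarrow> open (\<phi> ` N)"
    and or: "\<And>u. u \<in> U \<Longrightarrow> oriented_at S \<phi> u"
  shows "disk_chart S U \<phi>"
proof -
  have top: "topspace (subtopology (surf_top S) U) = U" using openin_subset[OF U] by auto
  have "homeomorphic_map (subtopology (surf_top S) U) (top_of_set (ball 0 1)) \<phi>"
  proof (rule bijective_open_imp_homeomorphic_map)
    show "continuous_map (subtopology (surf_top S) U) (top_of_set (ball 0 1)) \<phi>"
      using c im top by (auto simp: continuous_map_in_subtopology)
    show "open_map (subtopology (surf_top S) U) (top_of_set (ball 0 1)) \<phi>"
      unfolding open_map_def
    proof clarify
      fix N assume "openin (subtopology (surf_top S) U) N"
      then have "openin (surf_top S) N" "N \<subseteq> U"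
        using U openin_trans_full openin_imp_subset by blast+
      then show "openin (top_of_set (ball 0 1)) (\<phi> ` N)" using o im by (simp add: openin_open_eq image_mono) blast
    qed
  qed (use i im top in auto)
  then show ?thesis using U or disk_chart_iff[OF is_surface_atlas[OF S]] by blast
qed

text \<open>Together with the elimination below, this states the normal form at points of
  \<open>U\<close> and keeps \<open>inv_into\<close> out of it.\<close>

lemma branched_sheetI:
  assumes \<phi>: "disk_chart R U \<phi>" "x \<in> U" "\<phi> x = 0" and \<psi>: "disk_chart C V \<psi>" "y \<in> V" "\<psi> y = 0"
    and f: "\<And>u. u \<in> U \<Longrightarrow> f u \<in> V" "\<And>u. u \<in> U \<Longrightarrow> \<psi> (f u) = \<phi> u ^ d" and d: "1 \<le> d"
  shows "branched_sheet R C f U x V y d"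
  unfolding branched_sheet_def
proof (intro conjI exI)
  note P = disk_chart_props[OF \<phi>(1)] and Q = disk_chart_props[OF \<psi>(1)]
  show "U \<inter> fiber R f y = {x}"
  proof (intro equalityI subsetI)
    fix u assume "u \<in> U \<inter> fiber R f y"
    then have "u \<in> U" "\<phi> u ^ d = 0" using f(2) \<psi>(3) by (auto simp: fiber_def)
    then have "\<phi> u = \<phi> x" using \<phi>(3) by simp
    then show "u \<in> {x}" using P(3) \<open>u \<in> U\<close> \<phi>(2) by (auto dest: inj_onD)
  next
    fix u assume "u \<in> {x}"
    have "\<psi> (f x) = \<psi> y" using f(2)[OF \<phi>(2)] \<phi>(3) \<psi>(3) d by simp
    then have "f x = y" using Q(3) f(1)[OF \<phi>(2)] \<psi>(2) by (auto dest: inj_onD)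
    then show "u \<in> U \<inter> fiber R f y" using \<open>u \<in> {x}\<close> \<phi>(2) P(2) by (auto simp: fiber_def)
  qed
  show "\<forall>z\<in>ball 0 1. (\<psi> \<circ> f \<circ> inv_into U \<phi>) z = z ^ d"
  proof
    fix z :: complex assume "z \<in> ball 0 1"
    then have "z \<in> \<phi> ` U" using P(4) by simp
    then show "(\<psi> \<circ> f \<circ> inv_into U \<phi>) z = z ^ d"
      using f(2)[of "inv_into U \<phi> z"] by (simp add: inv_into_into f_inv_into_f)
  qed
qed (use assms disk_chart_props(1)[OF \<phi>(1)] disk_chart_props(1)[OF \<psi>(1)] in auto)

lemma branched_sheetE:
  assumes "branched_sheet R C f U x V y d"
  obtains \<phi> \<psi> where "disk_chart R U \<phi>" "x \<in> U" "\<phi> x = 0" "disk_chart C V \<psi>" "y \<in> V" "\<psi> y = 0"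
    "\<And>u. u \<in> U \<Longrightarrow> f u \<in> V" "\<And>u. u \<in> U \<Longrightarrow> \<psi> (f u) = \<phi> u ^ d" "1 \<le> d" "f x = y"
proof -
  obtain \<phi> \<psi> where *: "f ` U \<subseteq> V" "U \<inter> fiber R f y = {x}" "1 \<le> d" "disk_chart R U \<phi>"
    "disk_chart C V \<psi>" "\<phi> x = 0" "\<psi> y = 0"
    "\<And>z. z \<in> ball 0 1 \<Longrightarrow> (\<psi> \<circ> f \<circ> inv_into U \<phi>) z = z ^ d"
    using assms unfolding branched_sheet_def by blast
  have x: "x \<in> U" "f x = y" using *(2) unfolding fiber_def by auto
  have "\<psi> (f u) = \<phi> u ^ d" if "u \<in> U" for u
  proof -
    have "\<phi> u \<in> ball 0 1" using disk_chartD(3)[OF *(4)] that by blast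
    then show ?thesis using *(8) disk_chartD(2)[OF *(4)] that by fastforce
  qed
  then show thesis using that *(1,3,4,5,6,7) x by blast
qed

section \<open>Uniqueness of the local degree\<close>

lemma card_nth_roots_le:
  assumes "1 \<le> n" shows "finite {z::complex. z ^ n = c}" "card {z::complex. z ^ n = c} \<le> n"
proof -
  have "finite {z::complex. z ^ n = c} \<and> card {z::complex. z ^ n = c} \<le> n"
  proof (cases "c = 0")
    case True
    then have "{z::complex. z ^ n = c} = {0}" using assms by auto
    then show ?thesis using assms by simp
  next
    case False
    then show ?thesis using card_nth_roots[of c n] finite_nth_roots[of n c] assms by simp
  qed
  then show "finite {z::complex. z ^ n = c}" "card {z::complex. z ^ n = c} \<le> n" by auto
qed

text \<open>Used for bounding exponents: the \<open>d\<close> roots of a small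
  \<open>c \<noteq> 0\<close> give \<open>d\<close> distinct points of an arbitrary neighbourhood
  with one value of \<open>\<phi> ^ d\<close>.\<close>

lemma small_root_preimages:
  assumes \<phi>: "disk_chart R U \<phi>" "x \<in> U" "\<phi> x = 0" and N: "openin (surf_top R) N" "x \<in> N"
    and d: "1 \<le> d"
  obtains c A where "c \<noteq> 0" "A \<subseteq> N \<inter> U" "card A = d" "finite A" "\<And>a. a \<in> A \<Longrightarrow> \<phi> a ^ d = c"
proof -
  have "0 \<in> \<phi> ` (N \<inter> U)" using \<phi> N by (auto simp: image_iff)
  then obtain e where e: "e > 0" "ball 0 e \<subseteq> \<phi> ` (N \<inter> U)"
    using disk_chart_props(6)[OF \<phi>(1) N(1)] open_contains_ball by blast
  \<comment> \<open>All \<open>d\<close>-th roots of this \<open>c\<close> lie on the circle of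
    radius \<open>e / 2\<close>, inside the ball of radius \<open>e\<close>.\<close>
  define c :: complex where "c = of_real (e / 2) ^ d"
  have c: "c \<noteq> 0" using e by (simp add: c_def)
  have "z \<in> ball 0 e" if "z ^ d = c" for z
  proof -
    have "norm z ^ d = (e / 2) ^ d"
      using that e(1) by (metis c_def norm_power norm_of_real abs_of_pos half_gt_zero)
    then have "norm z = e / 2" using d e(1) by (simp add: power_eq_iff_eq_base)
    then show ?thesis using e(1) by simp
  qed
  then have roots: "{z. z ^ d = c} \<subseteq> \<phi> ` (N \<inter> U)" using e(2) by blast
  define A where "A = inv_into (N \<inter> U) \<phi> ` {z. z ^ d = c}"
  have "inj_on (inv_into (N \<inter> U) \<phi>) {z. z ^ d = c}" using roots inj_on_inv_into by blast
  then have "card A = d" unfolding A_def using card_nth_roots[OF c] d by (simp add: card_image)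
  moreover have "\<phi> a ^ d = c" if a: "a \<in> A" for a
  proof -
    obtain z where z: "z ^ d = c" "a = inv_into (N \<inter> U) \<phi> z" using a unfolding A_def by blast
    then have "z \<in> \<phi> ` (N \<inter> U)" using roots by blast
    then show ?thesis using f_inv_into_f[of z \<phi> "N \<inter> U"] z by simp
  qed
  moreover have "A \<subseteq> N \<inter> U"
  proof
    fix a assume "a \<in> A"
    then obtain z where z: "z ^ d = c" "a = inv_into (N \<inter> U) \<phi> z" unfolding A_def by blast
    then have "z \<in> \<phi> ` (N \<inter> U)" using roots by blast
    then show "a \<in> N \<inter> U" using z(2) by (metis inv_into_into)
  qed
  moreover have "finite A" unfolding A_def using card_nth_roots_le(1)[OF d] by blast
  ultimately show thesis using that c by blast
qed

text \<open>The first normal form produces \<open>d\<close> points near \<open>x\<close> in one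
  fibre of \<open>f\<close>. In the second, the coordinates of such points solve one equation
  \<open>z ^ d' = const\<close>, which has at most \<open>d'\<close> solutions.\<close>

lemma branched_sheet_degree_le:
  assumes "branched_sheet R C f U x V y d" "branched_sheet R C f U' x V' y d'"
  shows "d \<le> d'"
proof -
  obtain \<phi> \<psi> where 1: "disk_chart R U \<phi>" "x \<in> U" "\<phi> x = 0" "disk_chart C V \<psi>"
    "\<And>u. u \<in> U \<Longrightarrow> f u \<in> V" "\<And>u. u \<in> U \<Longrightarrow> \<psi> (f u) = \<phi> u ^ d" "1 \<le> d"
    by (rule branched_sheetE[OF assms(1)]) blast
  obtain \<phi>' \<psi>' where 2: "disk_chart R U' \<phi>'" "x \<in> U'" "disk_chart C V' \<psi>'"
    "\<And>u. u \<in> U' \<Longrightarrow> f u \<in> V'" "\<And>u. u \<in> U' \<Longrightarrow> \<psi>' (f u) = \<phi>' u ^ d'" "1 \<le> d'"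
    by (rule branched_sheetE[OF assms(2)]) blast
  obtain c A where A: "A \<subseteq> U' \<inter> U" "card A = d" "finite A" "\<And>a. a \<in> A \<Longrightarrow> \<phi> a ^ d = c"
    by (rule small_root_preimages[OF 1(1,2,3) disk_chart_props(1)[OF 2(1)] 2(2) 1(7)]) blast
  have "A \<noteq> {}" using A(2) 1(7) by auto
  then obtain a0 where a0: "a0 \<in> A" by blast
  have "f a = f a0" if "a \<in> A" for a
  proof -
    have "\<psi> (f a) = \<psi> (f a0)" using A that a0 1(6) by (metis IntE subsetD)
    then show ?thesis using disk_chart_props(3)[OF 1(4)] A(1) 1(5) that a0 by (auto dest: inj_onD)
  qed
  then have "\<phi>' ` A \<subseteq> {z. z ^ d' = \<psi>' (f a0)}" using A(1) 2(5) by fastforce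
  then have "card (\<phi>' ` A) \<le> d'"
    using card_nth_roots_le[OF 2(6)] card_mono le_trans by blast
  moreover have "inj_on \<phi>' A" using disk_chart_props(3)[OF 2(1)] A(1) by (meson inj_on_subset le_inf_iff)
  ultimately show ?thesis using A(2) card_image by metis
qed

lemma local_degree_eq:
  assumes "branched_sheet R C f U x V (f x) d" shows "local_degree R C f x = d"
  unfolding local_degree_def
proof (rule the_equality)
  show "\<exists>U V. branched_sheet R C f U x V (f x) d" using assms by blast
  fix d' assume "\<exists>U V. branched_sheet R C f U x V (f x) d'"
  then obtain U' V' where s: "branched_sheet R C f U' x V' (f x) d'" by blast
  show "d' = d"
    by (rule le_antisym[OF branched_sheet_degree_le[OF s assms] branched_sheet_degree_le[OF assms s]])
qed

section \<open>Fibres, ramification and the global degree\<close>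

context
  fixes R :: "'a surface" and C :: "'b surface" and f :: "'a \<Rightarrow> 'b"
  assumes br: "branched_covering R C f"
begin

lemma branched_covering_surfaces: "is_surface R" "is_surface C"
  "continuous_map (surf_top R) (surf_top C) f" "\<And>x. x \<in> points R \<Longrightarrow> f x \<in> points C"
  using br continuous_map_image_subset_topspace unfolding branched_covering_def by blast+

text \<open>The family of sheets in the definition is unindexed. Each sheet contains exactly one
  point of the fibre, which serves as its index, and its exponent is the local degree there.\<close>

lemma branched_coveringE':
  assumes "y \<in> points C"
  obtains V U where "openin (surf_top C) V" "y \<in> V" "disjoint_family_on U (fiber R f y)"
    "(\<Union>x\<in>fiber R f y. U x) = {x \<in> points R. f x \<in> V}"
    "\<And>x. x \<in> fiber R f y \<Longrightarrow> branched_sheet R C f (U x) x V y (local_degree R C f x)"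
    "fiber R f y \<noteq> {}"
proof -
  obtain V \<U> where V: "openin (surf_top C) V" "y \<in> V" "\<U> \<noteq> {}" "disjoint \<U>"
      "\<Union>\<U> = {x \<in> points R. f x \<in> V}" "\<forall>U\<in>\<U>. \<exists>x d. branched_sheet R C f U x V y d"
    by (rule branched_coveringE[OF br assms])
  have sheet: "\<exists>U\<in>\<U>. x \<in> U \<and> branched_sheet R C f U x V y (local_degree R C f x)"
    if x: "x \<in> fiber R f y" for x
  proof -
    have "x \<in> \<Union>\<U>" using x V(2,5) by (simp add: fiber_def)
    then obtain U where U: "U \<in> \<U>" "x \<in> U" by blast
    then obtain x' d where s: "branched_sheet R C f U x' V y d" using V(6) by blast
    then have "U \<inter> fiber R f y = {x'}" unfolding branched_sheet_def by blast
    then have "x' = x" using U(2) x by auto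
    moreover have "f x = y" using x by (simp add: fiber_def)
    ultimately have "local_degree R C f x = d" using s local_degree_eq[of R C f U x V d] by simp
    then show ?thesis using U s \<open>x' = x\<close> by blast
  qed
  then obtain U where U: "\<And>x. x \<in> fiber R f y \<Longrightarrow> U x \<in> \<U> \<and> x \<in> U x \<and>
      branched_sheet R C f (U x) x V y (local_degree R C f x)"
    by metis
  have single: "U x \<inter> fiber R f y = {x}" if "x \<in> fiber R f y" for x
    using U[OF that] unfolding branched_sheet_def by blast
  have onto: "\<exists>x\<in>fiber R f y. U x = A" if A: "A \<in> \<U>" for A
  proof -
    obtain x d where "branched_sheet R C f A x V y d" using A V(6) by blast
    then have x: "x \<in> A" "x \<in> fiber R f y" unfolding branched_sheet_def by blast+
    have "U x = A"
    proof (rule ccontr)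
      assume "U x \<noteq> A"
      then have "U x \<inter> A = {}" using V(4) A U[OF x(2)] by (meson disjointD)
      then show False using U[OF x(2)] x by blast
    qed
    then show ?thesis using x by blast
  qed
  show thesis
  proof (rule that[OF V(1,2)])
    show "disjoint_family_on U (fiber R f y)"
      unfolding disjoint_family_on_def
    proof (intro ballI impI)
      fix a b assume ab: "a \<in> fiber R f y" "b \<in> fiber R f y" "a \<noteq> b"
      then have "U a \<noteq> U b" using single by blast
      then show "U a \<inter> U b = {}" using V(4) U ab by (meson disjointD)
    qed
    have "(\<Union>x\<in>fiber R f y. U x) = \<Union>\<U>" using U onto by blast
    then show "(\<Union>x\<in>fiber R f y. U x) = {x \<in> points R. f x \<in> V}" using V(5) by simp
    show "fiber R f y \<noteq> {}" using onto V(3) by blast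
  qed (use U in blast)
qed

lemma branched_covering_sheet:
  assumes "x \<in> points R"
  obtains U V where "branched_sheet R C f U x V (f x) (local_degree R C f x)"
proof -
  have x: "x \<in> fiber R f (f x)" using assms by (simp add: fiber_def)
  show thesis
    by (rule branched_coveringE'[OF branched_covering_surfaces(4)[OF assms]]) (use that x in blast)
qed

lemma local_degree_ge_1: "x \<in> points R \<Longrightarrow> 1 \<le> local_degree R C f x"
  by (erule branched_covering_sheet) (simp add: branched_sheet_def)

text \<open>Near \<open>x\<close> there are as many distinct points with one image as the local
  degree says; injectivity collapses them.\<close>

lemma local_degree_eq_1:
  assumes x: "x \<in> points R" and N: "openin (surf_top R) N" "x \<in> N" "inj_on f N"
  shows "local_degree R C f x = 1"
proof -
  let ?d = "local_degree R C f x"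
  obtain U V where "branched_sheet R C f U x V (f x) ?d" by (rule branched_covering_sheet[OF x])
  then obtain \<phi> \<psi> where 1: "disk_chart R U \<phi>" "x \<in> U" "\<phi> x = 0" "disk_chart C V \<psi>"
    "\<And>u. u \<in> U \<Longrightarrow> f u \<in> V" "\<And>u. u \<in> U \<Longrightarrow> \<psi> (f u) = \<phi> u ^ ?d" "1 \<le> ?d"
    by (rule branched_sheetE) blast
  obtain c A where A: "A \<subseteq> N \<inter> U" "card A = ?d" "finite A" "\<And>a. a \<in> A \<Longrightarrow> \<phi> a ^ ?d = c"
    by (rule small_root_preimages[OF 1(1,2,3) N(1,2) 1(7)]) blast
  have "a = b" if "a \<in> A" "b \<in> A" for a b
  proof -
    have "\<psi> (f a) = \<psi> (f b)" using A that 1(6) by (metis IntE subsetD)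
    then have "f a = f b" using disk_chart_props(3)[OF 1(4)] A(1) 1(5) that by (auto dest: inj_onD)
    then show ?thesis using N(3) A(1) that by (auto dest: inj_onD)
  qed
  then have "card A \<le> 1" using A(3) by (simp add: card_le_Suc0_iff_eq)
  then show ?thesis using A(2) 1(7) by simp
qed

text \<open>The power map is injective near the nonzero coordinate of \<open>u\<close>.\<close>

lemma local_degree_off_center:
  assumes s: "branched_sheet R C f U x V y d" and u: "u \<in> U" "u \<noteq> x"
  shows "local_degree R C f u = 1"
proof -
  obtain \<phi> \<psi> where 1: "disk_chart R U \<phi>" "x \<in> U" "\<phi> x = 0" "disk_chart C V \<psi>"
    "\<And>u. u \<in> U \<Longrightarrow> \<psi> (f u) = \<phi> u ^ d" "1 \<le> d"
    using s by (rule branched_sheetE) blast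
  have "\<phi> u \<noteq> 0" using disk_chart_props(3)[OF 1(1)] 1(2,3) u by (metis inj_onD)
  then obtain r where r: "r > 0" "inj_on (\<lambda>z. z ^ d) (ball (\<phi> u) r)"
    using orientation_preserving_at_power[OF _ 1(6)] unfolding orientation_preserving_at_def by blast
  let ?N = "{v \<in> U. \<phi> v \<in> ball (\<phi> u) r}"
  have "inj_on f ?N"
  proof (rule inj_onI)
    fix a b assume ab: "a \<in> ?N" "b \<in> ?N" "f a = f b"
    then have "\<phi> a ^ d = \<phi> b ^ d" using 1(5) by (metis (mono_tags, lifting) mem_Collect_eq)
    then have "\<phi> a = \<phi> b" using r(2) ab by (auto dest: inj_onD)
    then show "a = b" using disk_chart_props(3)[OF 1(1)] ab by (auto dest: inj_onD)
  qed
  moreover have "openin (surf_top R) ?N" by (rule disk_chart_props(7)[OF 1(1)]) simp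
  moreover have "u \<in> points R" using u disk_chart_props(2)[OF 1(1)] by blast
  ultimately show ?thesis using local_degree_eq_1[of u ?N] u r(1) by simp
qed

lemma closedin_fiber: "y \<in> points C \<Longrightarrow> closedin (surf_top R) (fiber R f y)"
proof -
  assume "y \<in> points C"
  then have "closedin (surf_top C) {y}"
    using branched_covering_surfaces(2) closedin_Hausdorff_singleton[of "surf_top C" y]
    unfolding is_surface_def by blast
  from closedin_continuous_map_preimage[OF branched_covering_surfaces(3) this]
  show ?thesis by (simp add: fiber_def)
qed

text \<open>Away from \<open>y\<close> the fibre in \<open>U\<close> corresponds to the
  \<open>d\<close> distinct roots of \<open>\<psi> y'\<close>, each unramified; over
  \<open>y\<close> it is the centre alone, with exponent \<open>d\<close>.\<close>

lemma sheet_degree_sum: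
  assumes s: "branched_sheet R C f U x V y d" and y': "y' \<in> V"
  shows "finite (U \<inter> fiber R f y')" "(\<Sum>u\<in>U \<inter> fiber R f y'. local_degree R C f u) = d"
proof -
  obtain \<phi> \<psi> where 1: "disk_chart R U \<phi>" "x \<in> U" "\<phi> x = 0" "disk_chart C V \<psi>" "y \<in> V" "\<psi> y = 0"
    "\<And>u. u \<in> U \<Longrightarrow> f u \<in> V" "\<And>u. u \<in> U \<Longrightarrow> \<psi> (f u) = \<phi> u ^ d" "1 \<le> d" "f x = y"
    using s by (rule branched_sheetE) blast
  note P = disk_chart_props[OF 1(1)] and Q = disk_chart_props[OF 1(4)]
  have "finite (U \<inter> fiber R f y') \<and> (\<Sum>u\<in>U \<inter> fiber R f y'. local_degree R C f u) = d"
  proof (cases "y' = y")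
    case True
    have "U \<inter> fiber R f y' = {x}" using s True unfolding branched_sheet_def by blast
    moreover have "local_degree R C f x = d" using s 1(10) local_degree_eq[of R C f U x V d] by simp
    ultimately show ?thesis by simp
  next
    case False
    have c: "\<psi> y' \<noteq> 0" using False Q(3) y' 1(5,6) by (metis inj_onD)
    have "bij_betw \<phi> (U \<inter> fiber R f y') {z. z ^ d = \<psi> y'}"
      unfolding bij_betw_def
    proof
      show "inj_on \<phi> (U \<inter> fiber R f y')" using P(3) inj_on_subset by blast
      show "\<phi> ` (U \<inter> fiber R f y') = {z. z ^ d = \<psi> y'}"
      proof (intro equalityI subsetI)
        fix z assume "z \<in> \<phi> ` (U \<inter> fiber R f y')"
        then show "z \<in> {z. z ^ d = \<psi> y'}" using 1(8) by (auto simp: fiber_def)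
      next
        fix z assume z: "z \<in> {z. z ^ d = \<psi> y'}"
        have "\<psi> y' \<in> ball 0 1" using Q(4) y' by blast
        then have "norm z ^ d < 1" using z by (auto simp flip: norm_power)
        then have "z \<in> ball 0 1" using 1(9) by (simp add: power_less_one_iff)
        then have "z \<in> \<phi> ` U" using P(4) by simp
        then obtain u where u: "u \<in> U" "\<phi> u = z" by blast
        then have "\<psi> (f u) = \<psi> y'" using 1(8) z by simp
        then have "f u = y'" using Q(3) 1(7)[OF u(1)] y' by (auto dest: inj_onD)
        then show "z \<in> \<phi> ` (U \<inter> fiber R f y')" using u P(2) by (auto simp: fiber_def)
      qed
    qed
    then have "card (U \<inter> fiber R f y') = d" "finite (U \<inter> fiber R f y')"
      using card_nth_roots[OF c, of d] card_nth_roots_le(1)[OF 1(9)] 1(9)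
      by (simp_all add: bij_betw_same_card bij_betw_finite)
    moreover have "local_degree R C f u = 1" if "u \<in> U \<inter> fiber R f y'" for u
    proof -
      have "u \<noteq> x" using that False 1(10) by (auto simp: fiber_def)
      then show ?thesis using local_degree_off_center[OF s] that by blast
    qed
    ultimately show ?thesis by simp
  qed
  then show "finite (U \<inter> fiber R f y')" "(\<Sum>u\<in>U \<inter> fiber R f y'. local_degree R C f u) = d"
    by blast+
qed

context
  assumes compact: "compact_space (surf_top R)"
begin

lemma finite_fiber:
  assumes y: "y \<in> points C" shows "finite (fiber R f y)"
proof -
  obtain V U where V: "openin (surf_top C) V" "y \<in> V"
    "(\<Union>x\<in>fiber R f y. U x) = {x \<in> points R. f x \<in> V}"
    "\<And>x. x \<in> fiber R f y \<Longrightarrow> branched_sheet R C f (U x) x V y (local_degree R C f x)"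
    by (rule branched_coveringE'[OF y]) blast
  have "compactin (surf_top R) (fiber R f y)"
    by (rule closedin_compact_space[OF compact closedin_fiber[OF y]])
  moreover have "\<forall>A\<in>U ` fiber R f y. openin (surf_top R) A"
    using V(4) unfolding branched_sheet_def by blast
  moreover have "fiber R f y \<subseteq> \<Union>(U ` fiber R f y)" using V(2,3) by (auto simp: fiber_def)
  ultimately obtain F where F: "finite F" "F \<subseteq> U ` fiber R f y" "fiber R f y \<subseteq> \<Union>F"
    unfolding compactin_def by meson
  have "finite (A \<inter> fiber R f y)" if "A \<in> F" for A
  proof -
    have "A \<in> U ` fiber R f y" using F(2) that by blast
    then show ?thesis using sheet_degree_sum(1)[OF V(4) V(2)] by blast
  qed
  then have "finite (\<Union>A\<in>F. A \<inter> fiber R f y)" using F(1) by blast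
  moreover have "fiber R f y \<subseteq> (\<Union>A\<in>F. A \<inter> fiber R f y)" using F(3) by blast
  ultimately show ?thesis using finite_subset by blast
qed

text \<open>The sheets over \<open>V\<close> partition every nearby fibre, and each contributes the
  local degree at its centre.\<close>

lemma sum_local_degree_locally_constant:
  assumes y: "y \<in> points C"
  obtains V where "openin (surf_top C) V" "y \<in> V"
    "\<And>y'. y' \<in> V \<Longrightarrow>
       (\<Sum>x\<in>fiber R f y'. local_degree R C f x) = (\<Sum>x\<in>fiber R f y. local_degree R C f x)"
proof -
  obtain V U where V: "openin (surf_top C) V" "y \<in> V" "disjoint_family_on U (fiber R f y)"
    "(\<Union>x\<in>fiber R f y. U x) = {x \<in> points R. f x \<in> V}"
    "\<And>x. x \<in> fiber R f y \<Longrightarrow> branched_sheet R C f (U x) x V y (local_degree R C f x)"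
    by (rule branched_coveringE'[OF y]) blast
  have "(\<Sum>x\<in>fiber R f y'. local_degree R C f x) = (\<Sum>x\<in>fiber R f y. local_degree R C f x)"
    if y': "y' \<in> V" for y'
  proof -
    have "fiber R f y' = (\<Union>x\<in>fiber R f y. U x \<inter> fiber R f y')"
      using V(4) y' by (auto simp: fiber_def)
    then have "(\<Sum>x\<in>fiber R f y'. local_degree R C f x)
        = (\<Sum>u\<in>(\<Union>x\<in>fiber R f y. U x \<inter> fiber R f y'). local_degree R C f u)" by simp
    also have "\<dots> = (\<Sum>x\<in>fiber R f y. \<Sum>u\<in>U x \<inter> fiber R f y'. local_degree R C f u)"
    proof (rule sum.UNION_disjoint)
      show "finite (fiber R f y)" by (rule finite_fiber[OF y])
      show "\<forall>x\<in>fiber R f y. finite (U x \<inter> fiber R f y')"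
        using sheet_degree_sum(1)[OF V(5) y'] by blast
      show "\<forall>i\<in>fiber R f y. \<forall>j\<in>fiber R f y. i \<noteq> j \<longrightarrow>
          U i \<inter> fiber R f y' \<inter> (U j \<inter> fiber R f y') = {}"
        using V(3) unfolding disjoint_family_on_def by blast
    qed
    also have "\<dots> = (\<Sum>x\<in>fiber R f y. local_degree R C f x)"
      by (rule sum.cong[OF refl sheet_degree_sum(2)[OF V(5) y']])
    finally show ?thesis .
  qed
  then show thesis using that V(1,2) by blast
qed

text \<open>A locally constant function on a connected surface is constant, so the definite
  description in \<open>global_degree\<close> denotes its value.\<close>

lemma sum_local_degree:
  assumes y: "y \<in> points C"
  shows "(\<Sum>x\<in>fiber R f y. local_degree R C f x) = global_degree R C f"
proof -
  let ?N = "\<lambda>y. \<Sum>x\<in>fiber R f y. local_degree R C f x"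
  have op: "openin (surf_top C) {z \<in> points C. P (?N z)}" for P
    unfolding openin_subopen[of _ "{z \<in> points C. P (?N z)}"]
  proof clarify
    fix z assume z: "z \<in> points C" "P (?N z)"
    obtain V where V: "openin (surf_top C) V" "z \<in> V" "\<And>z'. z' \<in> V \<Longrightarrow> ?N z' = ?N z"
      by (rule sum_local_degree_locally_constant[OF z(1)]) blast
    have "V \<subseteq> {z \<in> points C. P (?N z)}"
    proof
      fix v assume v: "v \<in> V"
      then have "v \<in> points C" "P (?N v)" using openin_subset[OF V(1)] V(3)[OF v] z(2) by auto
      then show "v \<in> {z \<in> points C. P (?N z)}" by blast
    qed
    then show "\<exists>T. openin (surf_top C) T \<and> z \<in> T \<and> T \<subseteq> {z \<in> points C. P (?N z)}"
      using V(1,2) by blast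
  qed
  have const: "?N z = ?N y" if z: "z \<in> points C" for z
  proof -
    let ?A = "{z \<in> points C. ?N z = ?N y}"
    have "openin (surf_top C) ?A" using op[of "\<lambda>n. n = ?N y"] by simp
    moreover have "closedin (surf_top C) ?A"
    proof -
      have "points C - ?A = {z \<in> points C. ?N z \<noteq> ?N y}" by auto
      then show ?thesis using op[of "\<lambda>n. n \<noteq> ?N y"] by (auto simp: closedin_def)
    qed
    ultimately have "?A = {} \<or> ?A = points C"
      using branched_covering_surfaces(2) unfolding is_surface_def connected_space_clopen_in by blast
    then show ?thesis using y z by blast
  qed
  have "global_degree R C f = ?N y"
    unfolding global_degree_def
  proof (rule the_equality)
    show "\<forall>z\<in>points C. ?N z = ?N y" using const by blast
    show "n = ?N y" if "\<forall>z\<in>points C. ?N z = n" for n using bspec[OF that y] by (rule sym)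
  qed
  then show ?thesis ..
qed

text \<open>Compactness reduces this to sheets, each of which is ramified at most at its
  centre.\<close>

lemma finite_ramification: "finite {x \<in> points R. local_degree R C f x \<noteq> 1}"
proof -
  define Q where "Q = {U. openin (surf_top R) U \<and> finite {x \<in> U. local_degree R C f x \<noteq> 1}}"
  have "points R \<subseteq> \<Union>Q"
  proof
    fix x assume x: "x \<in> points R"
    obtain U V where s: "branched_sheet R C f U x V (f x) (local_degree R C f x)"
      by (rule branched_covering_sheet[OF x])
    then have "{u \<in> U. local_degree R C f u \<noteq> 1} \<subseteq> {x}" using local_degree_off_center by blast
    then have "U \<in> Q" "x \<in> U" using s finite_subset unfolding Q_def branched_sheet_def by blast+
    then show "x \<in> \<Union>Q" by blast
  qed
  moreover have "\<forall>U\<in>Q. openin (surf_top R) U" by (simp add: Q_def)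
  ultimately obtain F where F: "finite F" "F \<subseteq> Q" "points R \<subseteq> \<Union>F"
    using compact unfolding compact_space_def compactin_def by meson
  have "finite (\<Union>U\<in>F. {x \<in> U. local_degree R C f x \<noteq> 1})" using F(1,2) by (auto simp: Q_def)
  moreover have "{x \<in> points R. local_degree R C f x \<noteq> 1} \<subseteq> (\<Union>U\<in>F. {x \<in> U. local_degree R C f x \<noteq> 1})"
    using F(3) by blast
  ultimately show ?thesis using finite_subset by blast
qed

end
end

section \<open>Simultaneous normal forms over a disk\<close>

text \<open>\<open>k\<close> is a change of coordinate on part of the disk; rotations, rescalings
  and lifted chart changes are instances. Openness of the new coordinate is invariance of
  domain.\<close>

lemma disk_chart_post:
  assumes S: "is_surface S" and \<phi>: "disk_chart S U \<phi>" and D: "open D" "D \<subseteq> ball 0 1"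
    and k: "continuous_on D k" "inj_on k D" "k ` D = ball 0 1"
      "\<And>z. z \<in> D \<Longrightarrow> orientation_preserving_at k z"
  shows "disk_chart S {u \<in> U. \<phi> u \<in> D} (k \<circ> \<phi>)"
proof (rule disk_chartI[OF S])
  note P = disk_chart_props[OF \<phi>]
  let ?U = "{u \<in> U. \<phi> u \<in> D}"
  have im: "\<phi> ` ?U = D" using P(4) D(2) by auto
  show U: "openin (surf_top S) ?U" by (rule P(7)[OF D(1)])
  have c: "continuous_map (subtopology (surf_top S) ?U) euclidean \<phi>"
    by (rule continuous_map_from_subtopology_mono[OF P(5)]) auto
  then have "continuous_map (subtopology (surf_top S) ?U) (top_of_set D) \<phi>"
    by (auto simp: continuous_map_in_subtopology)
  then show "continuous_map (subtopology (surf_top S) ?U) euclidean (k \<circ> \<phi>)"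
    using k(1) by (intro continuous_map_compose) auto
  have "inj_on \<phi> ?U" using P(3) by (rule inj_on_subset) auto
  then show "inj_on (k \<circ> \<phi>) ?U" using im k(2) by (simp add: comp_inj_on)
  show "(k \<circ> \<phi>) ` ?U = ball 0 1" using im k(3) by (metis image_comp)
  show "open ((k \<circ> \<phi>) ` N)" if N: "openin (surf_top S) N" "N \<subseteq> ?U" for N
  proof -
    have "N \<inter> U = N" using N(2) by auto
    then have "open (\<phi> ` N)" using P(6)[OF N(1)] by simp
    moreover have "\<phi> ` N \<subseteq> D" using N(2) by auto
    ultimately have "open (k ` \<phi> ` N)"
      using invariance_of_domain[of "\<phi> ` N" k] continuous_on_subset[OF k(1)] inj_on_subset[OF k(2)] by blast
    then show ?thesis by (simp add: image_comp)
  qed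
  show "oriented_at S (k \<circ> \<phi>) u" if "u \<in> ?U" for u
    using that by (intro oriented_at_compose[OF is_surface_atlas[OF S]] disk_chart_oriented[OF S \<phi>] k(4)) auto
qed

section \<open>Rotated and rescaled charts, transitions\<close>

lemma disk_chart_rotate:
  assumes "is_surface S" "disk_chart S U \<phi>" "norm c = 1"
  shows "disk_chart S U (\<lambda>u. c * \<phi> u)"
proof -
  have c: "c \<noteq> 0" using assms(3) by auto
  have "{u \<in> U. \<phi> u \<in> ball 0 1} = U" using disk_chart_props(4)[OF assms(2)] by blast
  moreover have "disk_chart S {u \<in> U. \<phi> u \<in> ball 0 1} ((*) c \<circ> \<phi>)"
  proof (rule disk_chart_post[OF assms(1,2)])
    show "(*) c ` ball 0 1 = ball 0 1"
    proof (intro equalityI subsetI)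
      fix z :: complex assume "z \<in> ball 0 1"
      then have "z / c \<in> ball 0 1" using assms(3) by (simp add: norm_divide)
      then show "z \<in> (*) c ` ball 0 1" using c by (intro image_eqI[of _ _ "z / c"]) auto
    qed (use assms(3) in \<open>auto simp: norm_mult\<close>)
    show "orientation_preserving_at ((*) c) z" for z by (rule orientation_preserving_at_mult[OF c])
  qed (use c in \<open>auto intro!: continuous_intros simp: inj_on_def\<close>)
  ultimately show ?thesis by (simp add: comp_def)
qed

abbreviation shrink_dom :: "real \<Rightarrow> 'a set \<Rightarrow> ('a \<Rightarrow> complex) \<Rightarrow> 'a set" where
  "shrink_dom r U \<phi> \<equiv> {u \<in> U. norm (\<phi> u) < r}"

abbreviation shrink_map :: "real \<Rightarrow> ('a \<Rightarrow> complex) \<Rightarrow> 'a \<Rightarrow> complex" where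
  "shrink_map r \<phi> \<equiv> (\<lambda>u. \<phi> u / of_real r)"

lemma disk_chart_shrink:
  assumes "is_surface S" "disk_chart S U \<phi>" "0 < r" "r \<le> 1"
  shows "disk_chart S (shrink_dom r U \<phi>) (shrink_map r \<phi>)"
proof -
  have "disk_chart S {u \<in> U. \<phi> u \<in> ball 0 r} ((*) (1 / of_real r) \<circ> \<phi>)"
  proof (rule disk_chart_post[OF assms(1,2)])
    show "(*) (1 / of_real r) ` ball 0 r = (ball 0 1 :: complex set)"
    proof (intro equalityI subsetI)
      fix z :: complex assume "z \<in> ball 0 1"
      then have "of_real r * z \<in> ball 0 r" using assms(3) by (simp add: norm_mult)
      then show "z \<in> (*) (1 / of_real r) ` ball 0 r"
        using assms(3) by (intro image_eqI[of _ _ "of_real r * z"]) auto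
    qed (use assms(3) in \<open>auto simp: norm_divide divide_less_eq\<close>)
    show "orientation_preserving_at ((*) (1 / of_real r)) z" for z
      by (rule orientation_preserving_at_mult) (use assms(3) in simp)
  qed (use assms(3,4) in \<open>auto intro!: continuous_intros simp: inj_on_def\<close>)
  then show ?thesis by (simp add: comp_def)
qed

lemma disk_chart_transition:
  assumes S: "is_surface S" and \<psi>: "disk_chart S V \<psi>" and \<theta>: "disk_chart S W \<theta>"
    and D: "open D" "D \<subseteq> \<psi> ` (V \<inter> W)"
  shows "continuous_on D (\<theta> \<circ> inv_into V \<psi>)" "inj_on (\<theta> \<circ> inv_into V \<psi>) D"
    "\<And>z. z \<in> D \<Longrightarrow> orientation_preserving_at (\<theta> \<circ> inv_into V \<psi>) z"
proof -
  note P = disk_chart_props[OF \<psi>] and Q = disk_chart_props[OF \<theta>]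
  let ?k = "\<theta> \<circ> inv_into V \<psi>"
  have inv: "inv_into V \<psi> (\<psi> v) = v" if "v \<in> V" for v using P(3) that by simp
  show c: "continuous_on D ?k"
    unfolding continuous_on_open_vimage[OF D(1)]
  proof (intro allI impI)
    fix B :: "complex set" assume "open B"
    have "?k -` B \<inter> D = \<psi> ` ({w \<in> W. \<theta> w \<in> B} \<inter> V) \<inter> D"
      using D(2) inv by force
    then show "open (?k -` B \<inter> D)" using P(6)[OF Q(7)[OF \<open>open B\<close>]] D(1) by auto
  qed
  show i: "inj_on ?k D"
  proof (rule inj_onI)
    fix a b assume ab: "a \<in> D" "b \<in> D" "?k a = ?k b"
    then obtain v v' where v: "v \<in> V \<inter> W" "v' \<in> V \<inter> W" "a = \<psi> v" "b = \<psi> v'" using D(2) by blast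
    then have "\<theta> v = \<theta> v'" using ab(3) inv by simp
    then show "a = b" using v Q(3) by (auto dest: inj_onD)
  qed
  show "orientation_preserving_at ?k z" if z: "z \<in> D" for z
  proof -
    obtain v where v: "v \<in> V" "v \<in> W" "z = \<psi> v" using D(2) z by blast
    obtain e where e: "e > 0" "ball z e \<subseteq> D" using D(1) z open_contains_ball by blast
    have "oriented_at S (?k \<circ> \<psi>) v"
    proof (rule oriented_at_cong[OF is_surface_atlas[OF S] disk_chart_oriented[OF S \<theta> v(2)]])
      show "openin (surf_top S) (V \<inter> W)" using P(1) Q(1) by blast
    qed (use v inv in auto)
    moreover have "v \<in> points S" using v(1) P(2) by blast
    ultimately show ?thesis
      using oriented_at_cancel_right[OF is_surface_atlas[OF S] _ disk_chart_oriented[OF S \<psi> v(1)], of ?k e]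
        continuous_on_subset[OF c e(2)] inj_on_subset[OF i e(2)] e(1) v(3) by simp
  qed
qed

text \<open>In \<open>branched_covering\<close> each sheet over \<open>V\<close> may come with its
  own coordinate of \<open>V\<close>. Here one \<open>\<psi>\<close> serves all sheets over
  \<open>y\<close>, which makes different sheets comparable.\<close>

definition uniform_charts ::
  "'a surface \<Rightarrow> 'b surface \<Rightarrow> ('a \<Rightarrow> 'b) \<Rightarrow> 'b set \<Rightarrow> ('b \<Rightarrow> complex) \<Rightarrow> 'b \<Rightarrow>
     ('a \<Rightarrow> 'a set) \<Rightarrow> ('a \<Rightarrow> 'a \<Rightarrow> complex) \<Rightarrow> bool" where
  "uniform_charts R C f V \<psi> y U \<phi> \<longleftrightarrow>
     disk_chart C V \<psi> \<and> y \<in> V \<and> \<psi> y = 0 \<and>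
     (\<forall>x\<in>fiber R f y. disk_chart R (U x) (\<phi> x) \<and> x \<in> U x \<and> \<phi> x x = 0 \<and>
        (\<forall>u\<in>U x. f u \<in> V \<and> \<psi> (f u) = \<phi> x u ^ local_degree R C f x)) \<and>
     disjoint_family_on U (fiber R f y) \<and> (\<Union>x\<in>fiber R f y. U x) = {u \<in> points R. f u \<in> V}"

lemma uniform_chartsD:
  assumes "uniform_charts R C f V \<psi> y U \<phi>"
  shows "disk_chart C V \<psi>" "y \<in> V" "\<psi> y = 0"
    "\<And>x. x \<in> fiber R f y \<Longrightarrow> disk_chart R (U x) (\<phi> x)"
    "\<And>x. x \<in> fiber R f y \<Longrightarrow> x \<in> U x"
    "\<And>x. x \<in> fiber R f y \<Longrightarrow> \<phi> x x = 0"
    "\<And>x u. x \<in> fiber R f y \<Longrightarrow> u \<in> U x \<Longrightarrow> f u \<in> V"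
    "\<And>x u. x \<in> fiber R f y \<Longrightarrow> u \<in> U x \<Longrightarrow> \<psi> (f u) = \<phi> x u ^ local_degree R C f x"
    "disjoint_family_on U (fiber R f y)" "(\<Union>x\<in>fiber R f y. U x) = {u \<in> points R. f u \<in> V}"
  using assms unfolding uniform_charts_def by blast+

context
  fixes R :: "'a surface" and C :: "'b surface" and f :: "'a \<Rightarrow> 'b"
  assumes br: "branched_covering R C f"
begin

text \<open>To keep the form \<open>\<psi> (f u) = \<phi> u ^ d\<close>, rescaling the base by
  \<open>r\<close> forces rescaling the sheet by the \<open>d\<close>-th root of
  \<open>r\<close>.\<close>

lemma uniform_charts_shrink:
  assumes u: "uniform_charts R C f V \<psi> y U \<phi>" and r: "0 < r" "r \<le> 1"
  defines "s \<equiv> \<lambda>x. root (local_degree R C f x) r"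
  shows "uniform_charts R C f (shrink_dom r V \<psi>) (shrink_map r \<psi>) y
    (\<lambda>x. shrink_dom (s x) (U x) (\<phi> x)) (\<lambda>x. shrink_map (s x) (\<phi> x))"
proof -
  note H = uniform_chartsD[OF u]
  have d: "1 \<le> local_degree R C f x" if "x \<in> fiber R f y" for x
    using local_degree_ge_1[OF br] that by (simp add: fiber_def)
  have s: "0 < s x" "s x \<le> 1" "s x ^ local_degree R C f x = r" if "x \<in> fiber R f y" for x
    using d[OF that] r by (auto simp: s_def)
  have lt: "norm z < s x \<longleftrightarrow> norm z ^ local_degree R C f x < r" if "x \<in> fiber R f y" for x and z :: complex
  proof -
    have "norm z < s x \<longleftrightarrow> norm z ^ local_degree R C f x < s x ^ local_degree R C f x"
      using s[OF that] d[OF that] by (metis linorder_not_less norm_ge_zero order_less_imp_le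
          power_mono power_strict_mono zero_less_one order.strict_trans2)
    then show ?thesis using s(3)[OF that] by simp
  qed
  show ?thesis
    unfolding uniform_charts_def
  proof (intro conjI ballI)
    show "disk_chart C (shrink_dom r V \<psi>) (shrink_map r \<psi>)"
      by (rule disk_chart_shrink[OF branched_covering_surfaces(2)[OF br] H(1) r])
    show "y \<in> shrink_dom r V \<psi>" "shrink_map r \<psi> y = 0" using H(2,3) r by auto
    show "disjoint_family_on (\<lambda>x. shrink_dom (s x) (U x) (\<phi> x)) (fiber R f y)"
      using H(9) unfolding disjoint_family_on_def by blast
    show "(\<Union>x\<in>fiber R f y. shrink_dom (s x) (U x) (\<phi> x)) = {u \<in> points R. f u \<in> shrink_dom r V \<psi>}"
    proof (intro equalityI subsetI)
      fix u assume "u \<in> (\<Union>x\<in>fiber R f y. shrink_dom (s x) (U x) (\<phi> x))"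
      then obtain x where x: "x \<in> fiber R f y" "u \<in> U x" "norm (\<phi> x u) < s x" by blast
      then have "norm (\<psi> (f u)) < r" using lt[OF x(1)] H(8)[OF x(1,2)] by (simp add: norm_power)
      moreover have "u \<in> points R" using H(10) x by blast
      ultimately show "u \<in> {u \<in> points R. f u \<in> shrink_dom r V \<psi>}" using H(7)[OF x(1,2)] by simp
    next
      fix u assume u: "u \<in> {u \<in> points R. f u \<in> shrink_dom r V \<psi>}"
      then have "u \<in> (\<Union>x\<in>fiber R f y. U x)" using H(10) by simp
      then obtain x where x: "x \<in> fiber R f y" "u \<in> U x" by blast
      then have "norm (\<phi> x u) < s x" using lt[OF x(1)] H(8)[OF x] u by (simp add: norm_power)
      then show "u \<in> (\<Union>x\<in>fiber R f y. shrink_dom (s x) (U x) (\<phi> x))" using x by blast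
    qed
    fix x assume x: "x \<in> fiber R f y"
    show "disk_chart R (shrink_dom (s x) (U x) (\<phi> x)) (shrink_map (s x) (\<phi> x))"
      by (rule disk_chart_shrink[OF branched_covering_surfaces(1)[OF br] H(4)[OF x] s(1,2)[OF x]])
    show "x \<in> shrink_dom (s x) (U x) (\<phi> x)" "shrink_map (s x) (\<phi> x) x = 0"
      using H(5,6)[OF x] s[OF x] by auto
    fix u assume u: "u \<in> shrink_dom (s x) (U x) (\<phi> x)"
    then show "f u \<in> shrink_dom r V \<psi>"
      using lt[OF x] H(7,8)[OF x, of u] by (simp add: norm_power)
    show "shrink_map r \<psi> (f u) = shrink_map (s x) (\<phi> x) u ^ local_degree R C f x"
      using H(8)[OF x, of u] u s(3)[OF x] by (simp add: power_divide flip: of_real_power)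
  qed
qed

text \<open>The base coordinate \<open>\<psi>\<close> is prescribed up to rescaling. The normal form
  at \<open>x\<close> uses some other coordinate \<open>\<theta>\<close>; the chart change
  \<open>\<kappa>\<close> from \<open>\<psi>\<close> to \<open>\<theta>\<close> lifts through the
  power map to \<open>S\<close>, and composing \<open>\<phi>\<close> with the inverse of
  \<open>S\<close> gives a sheet coordinate adapted to \<open>\<psi>\<close>.\<close>

lemma ex_uniform_charts:
  assumes \<psi>: "disk_chart C V \<psi>" "y \<in> V" "\<psi> y = 0"
  obtains r U \<phi> where "0 < r" "r \<le> 1"
    "uniform_charts R C f (shrink_dom r V \<psi>) (shrink_map r \<psi>) y U \<phi>"
proof -
  note P = disk_chart_props[OF \<psi>(1)]
  note sR = branched_covering_surfaces(1)[OF br] and sC = branched_covering_surfaces(2)[OF br]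
  have y: "y \<in> points C" using P(2) \<psi>(2) by blast
  obtain W U where W: "openin (surf_top C) W" "y \<in> W" "disjoint_family_on U (fiber R f y)"
    "(\<Union>x\<in>fiber R f y. U x) = {x \<in> points R. f x \<in> W}"
    "\<And>x. x \<in> fiber R f y \<Longrightarrow> branched_sheet R C f (U x) x W y (local_degree R C f x)"
    by (rule branched_coveringE'[OF br y]) blast
  have "0 \<in> \<psi> ` (W \<inter> V)" using \<psi>(2,3) W(2) by (auto simp: image_iff)
  then obtain r0 where r0: "r0 > 0" "ball 0 r0 \<subseteq> \<psi> ` (W \<inter> V)"
    using P(6)[OF W(1)] open_contains_ball by blast
  define r where "r = min r0 1"
  have r: "0 < r" "r \<le> 1" "ball 0 r \<subseteq> \<psi> ` (V \<inter> W)" using r0 by (auto simp: r_def)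
  let ?V = "shrink_dom r V \<psi>" and ?\<psi> = "shrink_map r \<psi>"
  have sh: "disk_chart C ?V ?\<psi>" by (rule disk_chart_shrink[OF sC \<psi>(1) r(1,2)])
  note P' = disk_chart_props[OF sh]
  have VW: "?V \<subseteq> W"
  proof
    fix v assume v: "v \<in> ?V"
    then have "\<psi> v \<in> \<psi> ` (V \<inter> W)" using r(3) by auto
    then obtain w where "w \<in> V" "w \<in> W" "\<psi> v = \<psi> w" by blast
    then show "v \<in> W" using P(3) v by (auto dest: inj_onD)
  qed
  have yV: "y \<in> ?V" "?\<psi> y = 0" using \<psi> r by auto
  define U' where "U' = (\<lambda>x. {u \<in> U x. f u \<in> ?V})"
  have "\<exists>\<phi>. disk_chart R (U' x) \<phi> \<and> x \<in> U' x \<and> \<phi> x = 0 \<and>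
        (\<forall>u\<in>U' x. f u \<in> ?V \<and> ?\<psi> (f u) = \<phi> u ^ local_degree R C f x)" if x: "x \<in> fiber R f y" for x
  proof -
    let ?d = "local_degree R C f x" and ?B = "ball 0 1 :: complex set"
    obtain \<phi> \<theta> where 1: "disk_chart R (U x) \<phi>" "x \<in> U x" "\<phi> x = 0" "disk_chart C W \<theta>"
      "\<theta> y = 0" "\<And>u. u \<in> U x \<Longrightarrow> f u \<in> W" "\<And>u. u \<in> U x \<Longrightarrow> \<theta> (f u) = \<phi> u ^ ?d" "1 \<le> ?d"
      by (rule branched_sheetE[OF W(5)[OF x]]) blast
    note Q = disk_chart_props[OF 1(4)]
    define \<kappa> where "\<kappa> = \<theta> \<circ> inv_into ?V ?\<psi>"
    have "?B \<subseteq> ?\<psi> ` (?V \<inter> W)" using P'(4) VW by (simp add: inf.absorb1)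
    note T = disk_chart_transition[OF sC sh 1(4) open_ball this, folded \<kappa>_def]
    have inv: "inv_into ?V ?\<psi> (?\<psi> v) = v" if "v \<in> ?V" for v
      by (rule inv_into_f_f[OF P'(3) that])
    have \<kappa>\<psi>: "\<kappa> (?\<psi> v) = \<theta> v" if "v \<in> ?V" for v using inv[OF that] by (simp add: \<kappa>_def)
    have "\<kappa> 0 = 0" using \<kappa>\<psi>[OF yV(1)] 1(5) yV(2) by simp
    then obtain S where S: "continuous_on ?B S" "inj_on S ?B" "S 0 = 0"
      "\<And>w. w \<in> ?B \<Longrightarrow> S w ^ ?d = \<kappa> (w ^ ?d)" "S ` ?B = {v. v ^ ?d \<in> \<kappa> ` ?B}"
      "\<And>w. w \<in> ?B \<Longrightarrow> orientation_preserving_at S w"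
      by (rule root_lift[OF T(1,2) _ T(3) 1(8)]) (assumption, blast)
    have \<kappa>B: "\<kappa> ` ?B = \<theta> ` ?V" using P'(4) \<kappa>\<psi> by (metis (no_types, lifting) image_cong image_image)
    \<comment> \<open>By the description of the image of \<open>S\<close>, the new chart domain is
      exactly the part of the sheet over the shrunken base disk, so the sheets still partition its
      preimage.\<close>
    have inS: "\<phi> u \<in> S ` ?B \<longleftrightarrow> f u \<in> ?V" if u: "u \<in> U x" for u
    proof -
      have "\<phi> u \<in> S ` ?B \<longleftrightarrow> \<theta> (f u) \<in> \<theta> ` ?V" using S(5) \<kappa>B 1(7)[OF u] by simp
      also have "\<dots> \<longleftrightarrow> f u \<in> ?V"
        using inj_on_image_mem_iff[OF Q(3) 1(6)[OF u] VW] .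
      finally show ?thesis .
    qed
    have oS: "open (S ` ?B)" by (rule invariance_of_domain[OF S(1) open_ball S(2)])
    define k where "k = inv_into ?B S"
    have kS: "k (S w) = w" if "w \<in> ?B" for w using S(2) that by (simp add: k_def)
    have k: "continuous_on (S ` ?B) k"
    proof -
      obtain g where g: "homeomorphism ?B (S ` ?B) S g"
        by (rule invariance_of_domain_homeomorphism[OF open_ball S(1) order_refl S(2)])
      have "continuous_on (S ` ?B) g" using g by (rule homeomorphism_cont2)
      moreover have "g v = k v" if v: "v \<in> S ` ?B" for v
        using v homeomorphism_apply1[OF g] kS by auto
      ultimately show ?thesis by (rule continuous_on_eq)
    qed
    have ik: "inj_on k (S ` ?B)" unfolding k_def by (rule inj_on_inv_into) simp
    have "disk_chart R {u \<in> U x. \<phi> u \<in> S ` ?B} (k \<circ> \<phi>)"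
    proof (rule disk_chart_post[OF sR 1(1) oS _ k ik])
      show "S ` ?B \<subseteq> ?B"
      proof
        fix v assume "v \<in> S ` ?B"
        then have "v ^ ?d \<in> \<theta> ` ?V" using S(5) \<kappa>B by simp
        then have "v ^ ?d \<in> ?B" using Q(4) VW by blast
        then show "v \<in> ?B" using 1(8) by (simp add: norm_power power_less_one_iff)
      qed
      show "k ` S ` ?B = ?B" using kS by (auto simp: image_image)
      show "orientation_preserving_at k z" if z: "z \<in> S ` ?B" for z
      proof -
        obtain w where w: "w \<in> ?B" "z = S w" using z by blast
        obtain e where e: "e > 0" "ball z e \<subseteq> S ` ?B" using oS z open_contains_ball by blast
        have "orientation_preserving_at (k \<circ> S) w"
          by (rule orientation_preserving_at_cong[OF orientation_preserving_at_id open_ball w(1)]) (simp add: kS)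
        then show ?thesis
          using orientation_preserving_at_cancel_right[OF S(6)[OF w(1)], of k e] w(2)
            continuous_on_subset[OF k e(2)] inj_on_subset[OF ik e(2)] e(1) by simp
      qed
    qed
    moreover have "{u \<in> U x. \<phi> u \<in> S ` ?B} = {u \<in> U x. f u \<in> ?V}" using inS by blast
    ultimately have ch: "disk_chart R {u \<in> U x. f u \<in> ?V} (k \<circ> \<phi>)" by simp
    have eq: "?\<psi> (f u) = (k \<circ> \<phi>) u ^ ?d" if u: "u \<in> U x" "f u \<in> ?V" for u
    proof -
      obtain w where w: "w \<in> ?B" "\<phi> u = S w" using inS u by blast
      have "w ^ ?d \<in> ?B" using w(1) 1(8) by (simp add: norm_power power_less_one_iff)
      moreover have "?\<psi> (f u) \<in> ?B" using P'(4) u(2) by blast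
      moreover have "\<kappa> (w ^ ?d) = \<kappa> (?\<psi> (f u))" using S(4)[OF w(1)] w(2) 1(7)[OF u(1)] \<kappa>\<psi>[OF u(2)] by simp
      ultimately have "w ^ ?d = ?\<psi> (f u)" using T(2) by (auto dest: inj_onD)
      then show ?thesis using w kS by simp
    qed
    have "x \<in> {u \<in> U x. f u \<in> ?V}" using 1(2) x yV(1) by (simp add: fiber_def)
    moreover have "(k \<circ> \<phi>) x = 0" using 1(3) kS[of 0] S(3) by simp
    ultimately show ?thesis using ch eq unfolding U'_def by blast
  qed
  then have "\<forall>x\<in>fiber R f y. \<exists>\<phi>. disk_chart R (U' x) \<phi> \<and> x \<in> U' x \<and> \<phi> x = 0 \<and>
      (\<forall>u\<in>U' x. f u \<in> ?V \<and> ?\<psi> (f u) = \<phi> u ^ local_degree R C f x)" by blast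
  from bchoice[OF this] obtain \<phi>' where \<phi>': "\<forall>x\<in>fiber R f y. disk_chart R (U' x) (\<phi>' x) \<and>
      x \<in> U' x \<and> \<phi>' x x = 0 \<and>
      (\<forall>u\<in>U' x. f u \<in> ?V \<and> ?\<psi> (f u) = \<phi>' x u ^ local_degree R C f x)" ..
  have "uniform_charts R C f ?V ?\<psi> y U' \<phi>'"
    unfolding uniform_charts_def
  proof (intro conjI)
    show "\<forall>x\<in>fiber R f y. disk_chart R (U' x) (\<phi>' x) \<and> x \<in> U' x \<and> \<phi>' x x = 0 \<and>
        (\<forall>u\<in>U' x. f u \<in> ?V \<and> ?\<psi> (f u) = \<phi>' x u ^ local_degree R C f x)"
      by (rule \<phi>')
    show "disjoint_family_on U' (fiber R f y)"
      using W(3) unfolding disjoint_family_on_def U'_def by blast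
    have "(\<Union>x\<in>fiber R f y. U' x) = (\<Union>x\<in>fiber R f y. U x) \<inter> {u. f u \<in> ?V}"
      unfolding U'_def by blast
    also have "\<dots> = {x \<in> points R. f x \<in> W} \<inter> {u. f u \<in> ?V}" by (simp only: W(4))
    also have "\<dots> = {u \<in> points R. f u \<in> ?V}" using VW by auto
    finally show "(\<Union>x\<in>fiber R f y. U' x) = {u \<in> points R. f u \<in> ?V}" .
  qed (use sh yV in auto)
  then show thesis using that r by blast
qed

text \<open>All smaller radii are offered at once, so that several maps can be given one common base
  disk.\<close>

lemma ex_uniform_charts_small:
  assumes \<psi>: "disk_chart C V \<psi>" "y \<in> V" "\<psi> y = 0"
  obtains r0 where "0 < r0" "r0 \<le> 1"
    "\<And>r. 0 < r \<Longrightarrow> r \<le> r0 \<Longrightarrow> \<exists>U \<phi>. uniform_charts R C f (shrink_dom r V \<psi>) (shrink_map r \<psi>) y U \<phi>"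
proof -
  obtain r0 U \<phi> where r0: "0 < r0" "r0 \<le> 1"
    and u: "uniform_charts R C f (shrink_dom r0 V \<psi>) (shrink_map r0 \<psi>) y U \<phi>"
    by (rule ex_uniform_charts[OF \<psi>])
  have "\<exists>U \<phi>. uniform_charts R C f (shrink_dom r V \<psi>) (shrink_map r \<psi>) y U \<phi>"
    if r: "0 < r" "r \<le> r0" for r
  proof -
    have "0 < r / r0" "r / r0 \<le> 1" using r r0 by auto
    from uniform_charts_shrink[OF u this]
    have "\<exists>U \<phi>. uniform_charts R C f (shrink_dom (r / r0) (shrink_dom r0 V \<psi>) (shrink_map r0 \<psi>))
        (shrink_map (r / r0) (shrink_map r0 \<psi>)) y U \<phi>" by blast
    moreover have "shrink_dom (r / r0) (shrink_dom r0 V \<psi>) (shrink_map r0 \<psi>) = shrink_dom r V \<psi>"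
      using r r0 by (auto simp: norm_divide divide_less_cancel)
    moreover have "shrink_map (r / r0) (shrink_map r0 \<psi>) = shrink_map r \<psi>"
      using r r0 by (auto simp: fun_eq_iff)
    ultimately show ?thesis by simp
  qed
  then show thesis using that r0 by blast
qed

end

text \<open>On a circle around 0 the winding number of \<open>m\<close>, multiplied by
  \<open>a\<close>, is \<open>N\<close>, so \<open>a\<close> divides \<open>N\<close>. Then
  \<open>m z / z ^ \<beta>\<close> is continuous on the connected punctured disk with values among
  the finitely many \<open>a\<close>-th roots of unity, hence constant.\<close>

lemma power_eq_power_form:
  fixes m :: "complex \<Rightarrow> complex"
  assumes m: "continuous_on (ball 0 1) m" and a: "1 \<le> a" and N: "1 \<le> N"
    and eq: "\<And>z. z \<in> ball 0 1 \<Longrightarrow> m z ^ a = z ^ N"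
  obtains \<beta> \<omega> where "N = a * \<beta>" "1 \<le> \<beta>" "norm \<omega> = 1" "\<And>z. z \<in> ball 0 1 \<Longrightarrow> m z = \<omega> * z ^ \<beta>"
proof -
  let ?B = "ball 0 1 :: complex set" and ?c = "circlepath 0 (1/2) :: real \<Rightarrow> complex"
  have mnz: "m z \<noteq> 0" if "z \<in> ?B" "z \<noteq> 0" for z
    using eq[OF that(1)] that a by (metis power_0_left power_not_zero not_one_le_zero)
  have cB: "?c t \<in> ?B" "?c t \<noteq> 0" for t
    using circlepath_in_cball[of "1/2" 0 t] by (auto simp: circlepath)
  have pc: "path ?c" "0 \<notin> path_image ?c" by auto
  have pm: "path (m \<circ> ?c)"
    by (intro path_continuous_image continuous_on_subset[OF m]) (use cB in \<open>auto simp: path_image_def\<close>)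
  have nm: "0 \<notin> path_image (m \<circ> ?c)" using cB mnz by (auto simp: path_image_def)
  have "pathfinish (m \<circ> ?c) = pathstart (m \<circ> ?c)" by (simp add: pathfinish_compose pathstart_compose)
  then have "winding_number (m \<circ> ?c) 0 \<in> \<int>" using integer_winding_number[OF pm _ nm] by blast
  then obtain n :: int where n: "winding_number (m \<circ> ?c) 0 = of_int n" by (auto simp: Ints_def)
  have "of_nat a * winding_number (m \<circ> ?c) 0 = winding_number (\<lambda>t. (m \<circ> ?c) t ^ a) 0"
    using winding_number_power[OF pm nm] by simp
  also have "(\<lambda>t. (m \<circ> ?c) t ^ a) = (\<lambda>t. ?c t ^ N)" using eq cB by (simp add: fun_eq_iff)
  also have "winding_number (\<lambda>t. ?c t ^ N) 0 = of_nat N"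
    using winding_number_power[OF pc, of N] by (simp add: winding_number_circlepath_centre)
  finally have "(of_int (int a * n) :: complex) = of_int (int N)" using n by (simp add: comp_def)
  then have an: "int a * n = int N" using of_int_eq_iff by blast
  then have "n > 0" using a N by (metis of_nat_0_less_iff zero_less_mult_pos le_trans less_le_trans zero_less_one)
  then obtain \<beta> where \<beta>: "n = int \<beta>" by (metis zero_less_imp_eq_int)
  have N\<beta>: "N = a * \<beta>" using an \<beta> by (metis of_nat_eq_iff of_nat_mult)
  have "1 \<le> \<beta>" using \<open>n > 0\<close> \<beta> by simp
  define w where "w = (\<lambda>z. m z / z ^ \<beta>)"
  have wa: "w z ^ a = 1" if "z \<in> ?B - {0}" for z
    using eq[of z] that N\<beta> by (simp add: w_def power_divide mult.commute flip: power_mult)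
  have "continuous_on (?B - {0}) w"
    unfolding w_def by (intro continuous_intros continuous_on_subset[OF m]) auto
  moreover have "finite (w ` (?B - {0}))"
    by (rule finite_subset[OF _ card_nth_roots_le(1)[OF a, of 1]]) (use wa in blast)
  moreover have "connected (?B - {0})" by (rule connected_punctured_ball) simp
  ultimately have "w constant_on (?B - {0})" using continuous_finite_range_constant by blast
  then obtain \<omega> where \<omega>: "\<And>z. z \<in> ?B - {0} \<Longrightarrow> w z = \<omega>" unfolding constant_on_def by blast
  have half: "1/2 \<in> ?B - {0}" by simp
  have "\<omega> ^ a = 1" using wa[OF half] \<omega>[OF half] by simp
  then have "norm \<omega> ^ a = 1" by (metis norm_one norm_power)
  then have n1: "norm \<omega> = 1" using power_eq_iff_eq_base[of a "norm \<omega>" 1] a by simp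
  have "m z = \<omega> * z ^ \<beta>" if z: "z \<in> ?B" for z
  proof (cases "z = 0")
    case True
    then show ?thesis using eq[OF z] N a \<open>1 \<le> \<beta>\<close> by (simp add: power_0_left)
  next
    case False
    then show ?thesis using \<omega>[of z] z by (simp add: w_def field_simps)
  qed
  then show thesis using that N\<beta> \<open>1 \<le> \<beta>\<close> n1 by blast
qed

lemma disk_chart_connectedin:
  assumes "disk_chart S U \<phi>" shows "connectedin (surf_top S) U"
proof -
  have "homeomorphic_map (subtopology (surf_top S) U) (top_of_set (ball 0 1)) \<phi>"
    using assms unfolding disk_chart_def by blast
  then have "subtopology (surf_top S) U homeomorphic_space top_of_set (ball 0 1 :: complex set)"
    by (rule homeomorphic_map_imp_homeomorphic_space)
  then have "connected_space (subtopology (surf_top S) U)"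
    using homeomorphic_connected_space connectedin_def[of euclidean "ball 0 1 :: complex set"]
    by (metis connected_ball connectedin_iff_connected)
  then show ?thesis using disk_chart_props(2)[OF assms] by (simp add: connectedin_def)
qed

lemma uniform_charts_cong:
  assumes "uniform_charts R C f V \<psi> y U \<phi>"
    and "\<And>x. x \<in> fiber R f y \<Longrightarrow> U' x = U x \<and> \<phi>' x = \<phi> x"
  shows "uniform_charts R C f V \<psi> y U' \<phi>'"
proof -
  have "(\<Union>x\<in>fiber R f y. U' x) = (\<Union>x\<in>fiber R f y. U x)" using assms(2) by simp
  moreover have "disjoint_family_on U' (fiber R f y) \<longleftrightarrow> disjoint_family_on U (fiber R f y)"
    using assms(2) by (simp add: disjoint_family_on_def)
  ultimately show ?thesis using assms unfolding uniform_charts_def by simp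
qed

text \<open>\<open>e / b\<close> and \<open>a / d\<close> are the same fraction, so their lowest
  terms coincide. It is applied to the chain rule
  \<open>deg_p * deg_f = deg_q * deg_g\<close>.\<close>

lemma cross_ratio_nat:
  fixes e d b a :: nat
  assumes "e * d = b * a" "1 \<le> e" "1 \<le> d"
  shows "e = gcd e b * (a div gcd a d)" "b = gcd e b * (d div gcd a d)"
proof -
  have eb: "coprime (e div gcd e b) (b div gcd e b)" using assms by (intro div_gcd_coprime) auto
  have ad: "coprime (d div gcd a d) (a div gcd a d)"
    using assms by (metis coprime_commute div_gcd_coprime not_one_le_zero)
  have nz: "gcd e b \<noteq> 0" "gcd a d \<noteq> 0" using assms by auto
  have s: "e = gcd e b * (e div gcd e b)" "b = gcd e b * (b div gcd e b)"
    "a = gcd a d * (a div gcd a d)" "d = gcd a d * (d div gcd a d)" by simp_all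
  have "gcd e b * gcd a d * ((e div gcd e b) * (d div gcd a d)) = e * d"
    using s(1,4) by (metis mult.assoc mult.left_commute)
  also have "\<dots> = gcd e b * gcd a d * ((b div gcd e b) * (a div gcd a d))"
    using s(2,3) assms(1) by (metis mult.assoc mult.left_commute)
  finally have "(e div gcd e b) * (d div gcd a d) = (b div gcd e b) * (a div gcd a d)"
    using nz by (metis mult_cancel_left mult_eq_0_iff)
  then have "(e div gcd e b) * (d div gcd a d) = (a div gcd a d) * (b div gcd e b)"
    by (simp add: mult.commute)
  then have "e div gcd e b = a div gcd a d \<and> d div gcd a d = b div gcd e b"
    using coprime_crossproduct_nat[of "e div gcd e b" "b div gcd e b" "a div gcd a d" "d div gcd a d"] eb ad
    by (simp add: coprime_commute)
  then show "e = gcd e b * (a div gcd a d)" "b = gcd e b * (d div gcd a d)" using s by simp_all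
qed

text \<open>\<open>\<omega>' / \<omega>\<close> is an \<open>\<alpha>\<close>-th root of unity. As
  \<open>\<beta>\<close> is invertible modulo \<open>\<alpha>\<close>, it is the
  \<open>\<beta>\<close>-th power of another one.\<close>

lemma adjust_root:
  fixes \<omega> \<omega>' :: complex
  assumes "coprime \<alpha> \<beta>" "1 \<le> \<beta>" "\<omega> ^ \<alpha> = \<omega>' ^ \<alpha>" "\<omega> \<noteq> 0"
  obtains \<sigma> where "\<sigma> ^ \<alpha> = 1" "\<omega> * \<sigma> ^ \<beta> = \<omega>'"
proof -
  obtain s t where s: "\<beta> * s = \<alpha> * t + 1"
    using bezout_nat[of \<beta> \<alpha>] assms(1,2) by (auto simp: coprime_iff_gcd_eq_1 gcd.commute)
  define \<rho> where "\<rho> = \<omega>' / \<omega>"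
  have \<rho>: "\<rho> ^ \<alpha> = 1" using assms(4) by (simp add: \<rho>_def power_divide flip: assms(3))
  have "(\<rho> ^ s) ^ \<beta> = \<rho> ^ (\<beta> * s)" by (simp add: mult.commute flip: power_mult)
  also have "\<dots> = \<rho>" using \<rho> by (simp add: s power_add power_mult)
  finally have "\<omega> * (\<rho> ^ s) ^ \<beta> = \<omega>'" using assms(4) by (simp add: \<rho>_def)
  moreover have "(\<rho> ^ s) ^ \<alpha> = 1" using \<rho> by (metis mult.commute power_mult power_one)
  ultimately show thesis using that by blast
qed

text \<open>A choice of roots: it makes the normal forms of two sheets over the same pair of points
  coincide as soon as their images meet off the centre.\<close>

definition some_root :: "nat \<Rightarrow> complex \<Rightarrow> complex" where
  "some_root n \<tau> = (SOME \<omega>. \<omega> ^ n = \<tau>)"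

lemma some_root_power: "some_root n (\<omega> ^ n) ^ n = \<omega> ^ n"
  unfolding some_root_def by (rule someI) simp

section \<open>The commutative square over one small disk\<close>

locale branched_square =
  fixes R :: "'a surface" and C1 :: "'b surface" and C2 :: "'c surface" and C :: "'d surface"
    and p :: "'a \<Rightarrow> 'b" and q :: "'a \<Rightarrow> 'c" and f :: "'b \<Rightarrow> 'd" and g :: "'c \<Rightarrow> 'd"
  assumes closed: "closed_surface R" "closed_surface C1" "closed_surface C2" "closed_surface C"
    and p: "branched_covering R C1 p" and q: "branched_covering R C2 q"
    and f: "branched_covering C1 C f" and g: "branched_covering C2 C g"
    and comm: "\<And>x. x \<in> points R \<Longrightarrow> f (p x) = g (q x)"
begin

abbreviation "deg_p \<equiv> local_degree R C1 p"
abbreviation "deg_q \<equiv> local_degree R C2 q"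
abbreviation "deg_f \<equiv> local_degree C1 C f"
abbreviation "deg_g \<equiv> local_degree C2 C g"

abbreviation "h_fiber y \<equiv> {x \<in> points R. f (p x) = y}"

text \<open>\<open>al\<close>, \<open>be\<close> and \<open>common_deg\<close> are the \<alpha>,
  \<beta> and k of the overview. The first two depend only on \<open>p x\<close> and
  \<open>q x\<close>, hence are shared by all points over one pair.\<close>

abbreviation al :: "'a \<Rightarrow> nat" where "al x \<equiv> deg_g (q x) div gcd (deg_g (q x)) (deg_f (p x))"
abbreviation be :: "'a \<Rightarrow> nat" where "be x \<equiv> deg_f (p x) div gcd (deg_g (q x)) (deg_f (p x))"
abbreviation common_deg :: "'a \<Rightarrow> nat" where "common_deg x \<equiv> gcd (deg_p x) (deg_q x)"

lemma surfaces: "is_surface R" "is_surface C1" "is_surface C2" "is_surface C"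
  "compact_space (surf_top R)" "compact_space (surf_top C1)"
  "compact_space (surf_top C2)" "compact_space (surf_top C)"
  using closed unfolding closed_surface_def by auto

lemma p_points: "x \<in> points R \<Longrightarrow> p x \<in> points C1" by (rule branched_covering_surfaces(4)[OF p])
lemma q_points: "x \<in> points R \<Longrightarrow> q x \<in> points C2" by (rule branched_covering_surfaces(4)[OF q])
lemma f_points: "z \<in> points C1 \<Longrightarrow> f z \<in> points C" by (rule branched_covering_surfaces(4)[OF f])

lemma fiberI:
  assumes "x \<in> points R"
  shows "x \<in> fiber R p (p x)" "x \<in> fiber R q (q x)" "p x \<in> fiber C1 f (f (p x))"
    "q x \<in> fiber C2 g (f (p x))"
  using assms p_points q_points comm by (auto simp: fiber_def)

lemma degrees_ge_1:
  assumes "x \<in> points R"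
  shows "1 \<le> deg_p x" "1 \<le> deg_q x" "1 \<le> deg_f (p x)" "1 \<le> deg_g (q x)"
  using assms local_degree_ge_1[OF p] local_degree_ge_1[OF q] local_degree_ge_1[OF f]
    local_degree_ge_1[OF g] p_points q_points by blast+

text \<open>The charts are stacked: \<open>f\<close> and \<open>g\<close> share the base coordinate,
  and the sheet coordinates of \<open>f\<close> become base coordinates for
  \<open>p\<close>.\<close>

lemma ex_uniform_square:
  assumes y: "y \<in> points C"
  obtains V \<psi> A \<phi>1 B \<phi>2 U \<phi> where
    "uniform_charts C1 C f V \<psi> y A \<phi>1" "uniform_charts C2 C g V \<psi> y B \<phi>2"
    "\<And>z. z \<in> fiber C1 f y \<Longrightarrow> uniform_charts R C1 p (A z) (\<phi>1 z) z U \<phi>"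
proof -
  obtain z0 where z0: "z0 \<in> fiber C1 f y" using branched_coveringE'[OF f y] by blast
  then have z0': "z0 \<in> points C1" "f z0 = y" by (auto simp: fiber_def)
  obtain U0 V0 where "branched_sheet C1 C f U0 z0 V0 (f z0) (deg_f z0)"
    by (rule branched_covering_sheet[OF f z0'(1)])
  then obtain \<psi>0 where \<psi>0: "disk_chart C V0 \<psi>0" "y \<in> V0" "\<psi>0 y = 0"
    by (rule branched_sheetE) (use z0' in blast)
  obtain rf A0 \<phi>0 where rf: "0 < rf" "rf \<le> 1"
    and uf: "uniform_charts C1 C f (shrink_dom rf V0 \<psi>0) (shrink_map rf \<psi>0) y A0 \<phi>0"
    by (rule ex_uniform_charts[OF f \<psi>0])
  note F = uniform_chartsD[OF uf]
  obtain rg where rg: "0 < rg" "rg \<le> 1" "\<And>r. 0 < r \<Longrightarrow> r \<le> rg \<Longrightarrow>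
      \<exists>B \<phi>. uniform_charts C2 C g (shrink_dom r (shrink_dom rf V0 \<psi>0) (shrink_map rf \<psi>0))
        (shrink_map r (shrink_map rf \<psi>0)) y B \<phi>"
    by (rule ex_uniform_charts_small[OF g F(1,2,3)]) blast
  have "\<forall>z\<in>fiber C1 f y. \<exists>s>0. \<forall>r. 0 < r \<longrightarrow> r \<le> s \<longrightarrow>
      (\<exists>U \<phi>. uniform_charts R C1 p (shrink_dom r (A0 z) (\<phi>0 z)) (shrink_map r (\<phi>0 z)) z U \<phi>)"
  proof
    fix z assume z: "z \<in> fiber C1 f y"
    show "\<exists>s>0. \<forall>r. 0 < r \<longrightarrow> r \<le> s \<longrightarrow>
      (\<exists>U \<phi>. uniform_charts R C1 p (shrink_dom r (A0 z) (\<phi>0 z)) (shrink_map r (\<phi>0 z)) z U \<phi>)"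
      by (rule ex_uniform_charts_small[OF p F(4,5,6)[OF z]]) blast
  qed
  from bchoice[OF this] obtain s where s: "\<forall>z\<in>fiber C1 f y. 0 < s z \<and> (\<forall>r. 0 < r \<longrightarrow> r \<le> s z \<longrightarrow>
      (\<exists>U \<phi>. uniform_charts R C1 p (shrink_dom r (A0 z) (\<phi>0 z)) (shrink_map r (\<phi>0 z)) z U \<phi>))" ..
  \<comment> \<open>Rescaling the base by \<open>\<rho>\<close> rescales the sheet of
    \<open>f\<close> at \<open>z\<close> by the root of order \<open>deg_f z\<close>. This root must
    not exceed the radius \<open>s z\<close> acceptable to \<open>p\<close>, nor
    \<open>\<rho>\<close> the radius \<open>rg\<close> acceptable to \<open>g\<close>; the fibre is
    finite, so a minimum works.\<close>
  define \<rho> where "\<rho> = Min (insert rg ((\<lambda>z. s z ^ deg_f z) ` fiber C1 f y))"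
  have fin: "finite (insert rg ((\<lambda>z. s z ^ deg_f z) ` fiber C1 f y))"
    using finite_fiber[OF f surfaces(6) y] by simp
  have \<rho>: "0 < \<rho>" "\<rho> \<le> rg" "\<And>z. z \<in> fiber C1 f y \<Longrightarrow> \<rho> \<le> s z ^ deg_f z"
    using fin rg(1) s unfolding \<rho>_def by (auto intro: Min_le)
  have "\<rho> \<le> 1" using \<rho>(2) rg(2) by simp
  let ?\<sigma> = "\<lambda>z. root (deg_f z) \<rho>"
  note uf' = uniform_charts_shrink[OF f uf \<rho>(1) \<open>\<rho> \<le> 1\<close>]
  obtain B \<phi>2 where ug: "uniform_charts C2 C g (shrink_dom \<rho> (shrink_dom rf V0 \<psi>0) (shrink_map rf \<psi>0))
        (shrink_map \<rho> (shrink_map rf \<psi>0)) y B \<phi>2"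
    using rg(3)[OF \<rho>(1,2)] by blast
  have "\<forall>z\<in>fiber C1 f y. \<exists>P. uniform_charts R C1 p (shrink_dom (?\<sigma> z) (A0 z) (\<phi>0 z))
      (shrink_map (?\<sigma> z) (\<phi>0 z)) z (fst P) (snd P)"
  proof
    fix z assume z: "z \<in> fiber C1 f y"
    have d: "1 \<le> deg_f z" using z local_degree_ge_1[OF f] by (auto simp: fiber_def)
    have "?\<sigma> z \<le> root (deg_f z) (s z ^ deg_f z)"
      by (rule real_root_le_mono) (use d \<rho>(3)[OF z] in auto)
    also have "\<dots> = s z" using s z d by (intro real_root_power_cancel) (auto intro: less_imp_le)
    finally have "?\<sigma> z \<le> s z" .
    moreover have "0 < ?\<sigma> z" using d \<rho>(1) by simp
    ultimately obtain U \<phi> where "uniform_charts R C1 p (shrink_dom (?\<sigma> z) (A0 z) (\<phi>0 z))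
      (shrink_map (?\<sigma> z) (\<phi>0 z)) z U \<phi>" using s z by blast
    then show "\<exists>P. uniform_charts R C1 p (shrink_dom (?\<sigma> z) (A0 z) (\<phi>0 z))
      (shrink_map (?\<sigma> z) (\<phi>0 z)) z (fst P) (snd P)" by (intro exI[of _ "(U, \<phi>)"]) simp
  qed
  from bchoice[OF this] obtain P where P: "\<forall>z\<in>fiber C1 f y.
      uniform_charts R C1 p (shrink_dom (?\<sigma> z) (A0 z) (\<phi>0 z))
      (shrink_map (?\<sigma> z) (\<phi>0 z)) z (fst (P z)) (snd (P z))" ..
  \<comment> \<open>The families for the various \<open>z\<close> are merged into one, a point
    \<open>x\<close> of \<open>R\<close> belonging to \<open>z = p x\<close>.\<close>
  have "uniform_charts R C1 p (shrink_dom (?\<sigma> z) (A0 z) (\<phi>0 z)) (shrink_map (?\<sigma> z) (\<phi>0 z)) z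
      (\<lambda>x. fst (P (p x)) x) (\<lambda>x. snd (P (p x)) x)" if "z \<in> fiber C1 f y" for z
    by (rule uniform_charts_cong[OF bspec[OF P that]]) (auto simp: fiber_def)
  then show thesis using that uf' ug by blast
qed

text \<open>Both sides of \<open>f \<circ> p = g \<circ> q\<close> are the same power in the charts, so \<open>q\<close> is a power map up to
  a constant factor in the charts already used for \<open>p\<close>.\<close>

lemma q_normal_form:
  assumes uf: "uniform_charts C1 C f V \<psi> y A \<phi>1" and ug: "uniform_charts C2 C g V \<psi> y B \<phi>2"
    and up: "uniform_charts R C1 p (A (p x)) (\<phi>1 (p x)) (p x) U \<phi>"
    and x: "x \<in> h_fiber y"
  obtains \<omega> where "norm \<omega> = 1" "\<And>u. u \<in> U x \<Longrightarrow> q u \<in> B (q x)"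
    "\<And>u. u \<in> U x \<Longrightarrow> \<phi>2 (q x) (q u) = \<omega> * \<phi> x u ^ deg_q x"
    "deg_p x * deg_f (p x) = deg_q x * deg_g (q x)"
    "\<omega> ^ deg_g (q x) = 1"
proof -
  have xR: "x \<in> points R" and y: "f (p x) = y" using x by auto
  note X = fiberI[OF xR, unfolded y]
  note F = uniform_chartsD[OF uf] and G = uniform_chartsD[OF ug] and P = uniform_chartsD[OF up]
  note Px = P(4,5,6)[OF X(1)] and Gx = G(4,5,6)[OF X(4)]
  note CU = disk_chart_props[OF Px(1)] and CB = disk_chart_props[OF Gx(1)]
  let ?B = "ball 0 1 :: complex set"
  have gq: "g (q u) = f (p u) \<and> f (p u) \<in> V" if u: "u \<in> U x" for u
  proof -
    have "p u \<in> A (p x)" using P(7)[OF X(1) u] .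
    then have "f (p u) \<in> V" using F(7)[OF X(3)] by blast
    then show ?thesis using comm CU(2) u by auto
  qed
  \<comment> \<open>The image of \<open>U x\<close> under \<open>q\<close> is connected and covered
    by the disjoint open sheets of \<open>g\<close>; it meets the sheet of \<open>q x\<close>, so it
    stays in it.\<close>
  have qB: "q u \<in> B (q x)" if u: "u \<in> U x" for u
  proof (rule ccontr)
    assume nB: "q u \<notin> B (q x)"
    let ?E = "\<Union>b\<in>fiber C2 g y - {q x}. B b"
    have con: "connectedin (surf_top C2) (q ` U x)"
      by (rule connectedin_continuous_map_image[OF branched_covering_surfaces(3)[OF q]
          disk_chart_connectedin[OF Px(1)]])
    have "q ` U x \<subseteq> {v \<in> points C2. g v \<in> V}" using gq CU(2) q_points by auto
    then have sub: "q ` U x \<subseteq> B (q x) \<union> ?E" unfolding G(10)[symmetric] by blast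
    have "openin (surf_top C2) (B (q x))" by (rule CB(1))
    moreover have "openin (surf_top C2) ?E"
      by (rule openin_Union) (use G(4) disk_chart_props(1) in blast)
    moreover have "B (q x) \<inter> ?E = {}"
      using G(9) X(4) unfolding disjoint_family_on_def by blast
    moreover have "q x \<in> B (q x) \<inter> q ` U x" using Gx(2) Px(2) by blast
    moreover have "q u \<in> ?E \<inter> q ` U x" using nB sub u by blast
    ultimately show False using con sub unfolding connectedin by blast
  qed
  define m where "m = \<phi>2 (q x) \<circ> q \<circ> inv_into (U x) (\<phi> x)"
  have inv: "inv_into (U x) (\<phi> x) (\<phi> x u) = u" if "u \<in> U x" for u using CU(3) that by simp
  have m\<phi>: "m (\<phi> x u) = \<phi>2 (q x) (q u)" if "u \<in> U x" for u using inv[OF that] by (simp add: m_def)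
  have cm: "continuous_on ?B m"
    unfolding continuous_on_open_vimage[OF open_ball]
  proof (intro allI impI)
    fix D :: "complex set" assume "open D"
    let ?N = "{u \<in> points R. q u \<in> {v \<in> B (q x). \<phi>2 (q x) v \<in> D}}"
    have N: "openin (surf_top R) ?N"
      by (rule openin_continuous_map_preimage[OF branched_covering_surfaces(3)[OF q] CB(7)[OF \<open>open D\<close>]])
    have "m -` D \<inter> ?B = \<phi> x ` (?N \<inter> U x)"
    proof (intro equalityI subsetI)
      fix z assume z: "z \<in> m -` D \<inter> ?B"
      then have "z \<in> \<phi> x ` U x" using CU(4) by simp
      then obtain u where u: "u \<in> U x" "z = \<phi> x u" by blast
      then show "z \<in> \<phi> x ` (?N \<inter> U x)" using z m\<phi> qB CU(2) by auto
    next
      fix z assume "z \<in> \<phi> x ` (?N \<inter> U x)"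
      then obtain u where u: "u \<in> U x" "u \<in> ?N" "z = \<phi> x u" by blast
      then show "z \<in> m -` D \<inter> ?B" using m\<phi> CU(4) by auto
    qed
    then show "open (m -` D \<inter> ?B)" using CU(6)[OF N] by simp
  qed
  note deg = degrees_ge_1[OF xR]
  have eq: "m z ^ deg_g (q x) = z ^ (deg_p x * deg_f (p x))" if z: "z \<in> ?B" for z
  proof -
    have "z \<in> \<phi> x ` U x" using z CU(4) by simp
    then obtain u where u: "u \<in> U x" "z = \<phi> x u" by blast
    have "m z ^ deg_g (q x) = \<psi> (g (q u))" using m\<phi>[OF u(1)] G(8)[OF X(4) qB[OF u(1)]] u(2) by simp
    also have "\<dots> = \<psi> (f (p u))" using gq[OF u(1)] by simp
    also have "\<dots> = \<phi>1 (p x) (p u) ^ deg_f (p x)" using F(8)[OF X(3) P(7)[OF X(1) u(1)]] .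
    also have "\<dots> = z ^ (deg_p x * deg_f (p x))" using P(8)[OF X(1) u(1)] u(2) by (simp add: power_mult)
    finally show ?thesis .
  qed
  have "1 \<le> deg_p x * deg_f (p x)" using deg by simp
  then obtain \<beta> \<omega> where \<beta>: "deg_p x * deg_f (p x) = deg_g (q x) * \<beta>" "1 \<le> \<beta>" "norm \<omega> = 1"
    "\<And>z. z \<in> ?B \<Longrightarrow> m z = \<omega> * z ^ \<beta>"
    using power_eq_power_form[OF cm deg(4) _ eq] by metis
  have q\<beta>: "\<phi>2 (q x) (q u) = \<omega> * \<phi> x u ^ \<beta>" if u: "u \<in> U x" for u
  proof -
    have "\<phi> x u \<in> ?B" using CU(4) u by blast
    then show ?thesis using \<beta>(4) m\<phi>[OF u] by simp
  qed
  have \<omega>: "\<omega> \<noteq> 0" using \<beta>(3) by auto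
  \<comment> \<open>After rotating \<open>\<phi>2\<close> by \<open>1 / \<omega>\<close>,
    \<open>q\<close> is the power \<open>\<beta>\<close>, which is therefore its local
    degree.\<close>
  have "branched_sheet R C2 q (U x) x (B (q x)) (q x) \<beta>"
  proof (rule branched_sheetI[OF Px _ Gx(2) _ qB _ \<beta>(2)])
    show "disk_chart C2 (B (q x)) (\<lambda>v. (1 / \<omega>) * \<phi>2 (q x) v)"
      by (rule disk_chart_rotate[OF surfaces(3) Gx(1)]) (simp add: norm_divide \<beta>(3))
  qed (use Gx(3) q\<beta> \<omega> in auto)
  then have dq: "deg_q x = \<beta>" by (rule local_degree_eq)
  have "\<omega> ^ deg_g (q x) = 1"
  proof -
    \<comment> \<open>Any nonzero point of the disk would do for comparing the two expressions of
      \<open>m z ^ deg_g (q x)\<close>.\<close>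
    have "m (1/2) = \<omega> * (1/2) ^ \<beta>" using \<beta>(4)[of "1/2"] by simp
    then have "(\<omega> * (1/2) ^ \<beta>) ^ deg_g (q x) = (1/2) ^ (deg_g (q x) * \<beta>)"
      using eq[of "1/2"] \<beta>(1) by simp
    then show ?thesis by (simp add: power_mult_distrib mult.commute flip: power_mult)
  qed
  then show thesis using that \<beta> q\<beta> qB dq by (metis mult.commute)
qed

lemma degree_factors:
  assumes "x \<in> points R" "deg_p x * deg_f (p x) = deg_q x * deg_g (q x)"
  shows "deg_p x = common_deg x * al x" "deg_q x = common_deg x * be x" "1 \<le> common_deg x" "1 \<le> al x" "1 \<le> be x"
    "coprime (al x) (be x)"
proof -
  note d = degrees_ge_1[OF assms(1)]
  show *: "deg_p x = common_deg x * al x" "deg_q x = common_deg x * be x"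
    by (rule cross_ratio_nat[OF assms(2) d(1,3)])+
  show "1 \<le> common_deg x" "1 \<le> al x" "1 \<le> be x"
    using d(1,2) * by (metis mult_is_0 not_less_eq_eq One_nat_def le_0_eq)+
  show "coprime (al x) (be x)" using d by (intro div_gcd_coprime) auto
qed

end

context branched_square begin

text \<open>\<open>om\<close> records how \<open>q\<close> is twisted relative to \<open>p\<close>.
  Selecting it through \<open>some_root\<close> makes it a function of its own \<open>al\<close>-th
  power, which the local image of \<open>(p, q)\<close> determines.\<close>

definition local_model ::
  "'d \<Rightarrow> 'd set \<Rightarrow> ('b \<Rightarrow> 'b set) \<Rightarrow> ('b \<Rightarrow> 'b \<Rightarrow> complex) \<Rightarrow> ('c \<Rightarrow> 'c set) \<Rightarrow> ('c \<Rightarrow> 'c \<Rightarrow> complex)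
     \<Rightarrow> ('a \<Rightarrow> 'a set) \<Rightarrow> ('a \<Rightarrow> 'a \<Rightarrow> complex) \<Rightarrow> ('a \<Rightarrow> complex) \<Rightarrow> bool" where
  "local_model y V A \<phi>1 B \<phi>2 U \<phi> om \<longleftrightarrow>
     (\<exists>\<psi>. uniform_charts C1 C f V \<psi> y A \<phi>1) \<and> (\<exists>\<psi>. uniform_charts C2 C g V \<psi> y B \<phi>2) \<and>
     disjoint_family_on U (h_fiber y) \<and> (\<Union>x\<in>h_fiber y. U x) = {u \<in> points R. f (p u) \<in> V} \<and>
     (\<forall>x\<in>h_fiber y. disk_chart R (U x) (\<phi> x) \<and> x \<in> U x \<and> \<phi> x x = 0 \<and>
        norm (om x) = 1 \<and> om x = some_root (al x) (om x ^ al x) \<and> om x ^ deg_g (q x) = 1 \<and>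
        deg_p x * deg_f (p x) = deg_q x * deg_g (q x) \<and>
        (\<forall>u\<in>U x. p u \<in> A (p x) \<and> q u \<in> B (q x) \<and>
           \<phi>1 (p x) (p u) = \<phi> x u ^ (common_deg x * al x) \<and>
           \<phi>2 (q x) (q u) = om x * \<phi> x u ^ (common_deg x * be x)))"

text \<open>Multiplying the coordinate by \<open>1 / \<rho>\<close> keeps the form of
  \<open>p\<close> if \<open>\<sigma> = \<rho> ^ common_deg x\<close> satisfies
  \<open>\<sigma> ^ al x = 1\<close>, and it turns \<open>\<omega>\<close> into
  \<open>\<omega> * \<sigma> ^ be x\<close>. Since \<open>al x\<close> and \<open>be x\<close> are
  coprime, every root with the same \<open>al x\<close>-th power can be reached, in particular the
  selected one.\<close>

lemma normalise_sheet:
  assumes x: "x \<in> points R" and ch: "disk_chart R N \<phi>" "x \<in> N" "\<phi> x = 0"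
    and \<omega>: "norm \<omega> = 1" "\<omega> ^ deg_g (q x) = 1"
    and deg: "deg_p x * deg_f (p x) = deg_q x * deg_g (q x)"
    and P: "\<And>u. u \<in> N \<Longrightarrow> P u = \<phi> u ^ deg_p x" and Q: "\<And>u. u \<in> N \<Longrightarrow> Q u = \<omega> * \<phi> u ^ deg_q x"
  obtains \<phi>' om where "disk_chart R N \<phi>'" "\<phi>' x = 0"
    "norm om = 1" "om = some_root (al x) (om ^ al x)" "om ^ deg_g (q x) = 1"
    "\<And>u. u \<in> N \<Longrightarrow> P u = \<phi>' u ^ (common_deg x * al x)" "\<And>u. u \<in> N \<Longrightarrow> Q u = om * \<phi>' u ^ (common_deg x * be x)"
proof -
  note D = degree_factors[OF x deg]
  define om where "om = some_root (al x) (\<omega> ^ al x)"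
  have oma: "om ^ al x = \<omega> ^ al x" unfolding om_def by (rule some_root_power)
  have om: "om = some_root (al x) (om ^ al x)" unfolding oma by (simp add: om_def)
  have unit: "norm w = 1" if "norm (w ^ n) = 1" "1 \<le> n" for w :: complex and n
    using that power_eq_iff_eq_base[of n "norm w" 1] by (simp add: norm_power)
  have nom: "norm om = 1" by (rule unit[OF _ D(4)]) (simp add: oma norm_power \<omega>(1))
  have "om ^ deg_g (q x) = (om ^ al x) ^ gcd (deg_g (q x)) (deg_f (p x))"
    by (simp flip: power_mult)
  also have "\<dots> = \<omega> ^ deg_g (q x)" unfolding oma by (simp flip: power_mult)
  finally have omg: "om ^ deg_g (q x) = 1" using \<omega>(2) by simp
  have "\<omega> \<noteq> 0" using \<omega>(1) by auto
  then obtain \<sigma> where \<sigma>: "\<sigma> ^ al x = 1" "\<omega> * \<sigma> ^ be x = om"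
    using adjust_root[OF D(6,5) oma[symmetric]] by blast
  have n\<sigma>: "norm \<sigma> = 1" by (rule unit[OF _ D(4)]) (simp add: \<sigma>(1))
  define \<rho> where "\<rho> = exp (Ln \<sigma> / of_nat (common_deg x))"
  have "\<sigma> \<noteq> 0" using n\<sigma> by auto
  have \<rho>: "\<rho> ^ common_deg x = \<sigma>"
  proof -
    have "exp (Ln \<sigma> / of_nat n) ^ n = \<sigma>" if "1 \<le> n" for n
      using that \<open>\<sigma> \<noteq> 0\<close> by (simp flip: exp_of_nat_mult)
    then show ?thesis unfolding \<rho>_def using D(3) .
  qed
  have n\<rho>: "norm \<rho> = 1" by (rule unit[OF _ D(3)]) (simp add: \<rho> n\<sigma>)
  then have \<rho>0: "\<rho> \<noteq> 0" by auto
  let ?\<phi> = "\<lambda>u. (1 / \<rho>) * \<phi> u"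
  have e: "\<phi> u = \<rho> * ?\<phi> u" for u using \<rho>0 by simp
  have pw: "\<phi> u ^ (common_deg x * n) = \<sigma> ^ n * ?\<phi> u ^ (common_deg x * n)" for u n
    by (subst e) (simp only: power_mult_distrib power_mult \<rho>)
  show thesis
  proof (rule that[of ?\<phi> om])
    show "disk_chart R N ?\<phi>"
      by (rule disk_chart_rotate[OF surfaces(1) ch(1)]) (simp add: norm_divide n\<rho>)
    show "P u = ?\<phi> u ^ (common_deg x * al x)" if "u \<in> N" for u
      using P[OF that] pw[of u "al x"] D(1) \<sigma>(1) by simp
    show "Q u = om * ?\<phi> u ^ (common_deg x * be x)" if "u \<in> N" for u
      using Q[OF that] pw[of u "be x"] D(2) \<sigma>(2) by (simp add: mult.assoc[symmetric])
  qed (use ch(3) nom om omg in auto)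
qed

lemma ex_local_model:
  assumes y: "y \<in> points C"
  shows "\<exists>V A \<phi>1 B \<phi>2 U \<phi> om. local_model y V A \<phi>1 B \<phi>2 U \<phi> om"
proof -
  obtain V \<psi> A \<phi>1 B \<phi>2 U \<phi> where uf: "uniform_charts C1 C f V \<psi> y A \<phi>1"
    and ug: "uniform_charts C2 C g V \<psi> y B \<phi>2"
    and up: "\<And>z. z \<in> fiber C1 f y \<Longrightarrow> uniform_charts R C1 p (A z) (\<phi>1 z) z U \<phi>"
    by (rule ex_uniform_square[OF y]) blast
  note F = uniform_chartsD[OF uf]
  let ?P = "\<lambda>x \<phi>' om. disk_chart R (U x) \<phi>' \<and> x \<in> U x \<and> \<phi>' x = 0 \<and>
        norm om = 1 \<and> om = some_root (al x) (om ^ al x) \<and> om ^ deg_g (q x) = 1 \<and>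
        deg_p x * deg_f (p x) = deg_q x * deg_g (q x) \<and>
        (\<forall>u\<in>U x. p u \<in> A (p x) \<and> q u \<in> B (q x) \<and>
           \<phi>1 (p x) (p u) = \<phi>' u ^ (common_deg x * al x) \<and> \<phi>2 (q x) (q u) = om * \<phi>' u ^ (common_deg x * be x))"
  have "\<forall>x\<in>h_fiber y. \<exists>M. ?P x (fst M) (snd M)"
  proof
    fix x assume x: "x \<in> h_fiber y"
    then have xR: "x \<in> points R" and yx: "f (p x) = y" by auto
    note X = fiberI[OF xR, unfolded yx]
    note upx = up[OF X(3)]
    note Px = uniform_chartsD(4,5,6)[OF upx X(1)]
    obtain \<omega> where \<omega>: "norm \<omega> = 1" "\<And>u. u \<in> U x \<Longrightarrow> q u \<in> B (q x)"
      "\<And>u. u \<in> U x \<Longrightarrow> \<phi>2 (q x) (q u) = \<omega> * \<phi> x u ^ deg_q x"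
      "deg_p x * deg_f (p x) = deg_q x * deg_g (q x)" "\<omega> ^ deg_g (q x) = 1"
      by (rule q_normal_form[OF uf ug upx x]) blast
    obtain \<phi>' om where M: "disk_chart R (U x) \<phi>'" "\<phi>' x = 0"
      "norm om = 1" "om = some_root (al x) (om ^ al x)" "om ^ deg_g (q x) = 1"
      "\<And>u. u \<in> U x \<Longrightarrow> \<phi>1 (p x) (p u) = \<phi>' u ^ (common_deg x * al x)"
      "\<And>u. u \<in> U x \<Longrightarrow> \<phi>2 (q x) (q u) = om * \<phi>' u ^ (common_deg x * be x)"
      by (rule normalise_sheet[OF xR Px \<omega>(1,5,4), of "\<lambda>u. \<phi>1 (p x) (p u)" "\<lambda>u. \<phi>2 (q x) (q u)"])
        (use uniform_chartsD(8)[OF upx X(1)] \<omega>(3) in blast)+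
    have "?P x \<phi>' om"
      using M \<omega>(2,4) Px(2) uniform_chartsD(7)[OF upx X(1)] by blast
    then show "\<exists>M. ?P x (fst M) (snd M)" by (intro exI[of _ "(\<phi>', om)"]) simp
  qed
  from bchoice[OF this] obtain M where M: "\<forall>x\<in>h_fiber y. ?P x (fst (M x)) (snd (M x))" ..
  \<comment> \<open>Sheets of \<open>R\<close> that lie over different sheets of \<open>f\<close>
    are disjoint because their images under \<open>p\<close> are.\<close>
  have Up: "p u = p x \<or> U u \<inter> U x = {}" if "x \<in> h_fiber y" "u \<in> h_fiber y" for x u
  proof (rule ccontr)
    assume "\<not> ?thesis"
    then obtain v where v: "v \<in> U u" "v \<in> U x" "p u \<noteq> p x" by blast
    note X = fiberI[of x] fiberI[of u]
    have "p v \<in> A (p x)" "p v \<in> A (p u)" using M that v(1,2) by blast+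
    moreover have "p x \<in> fiber C1 f y" "p u \<in> fiber C1 f y" using that X by auto
    ultimately show False using F(9) v(3) unfolding disjoint_family_on_def by blast
  qed
  have dis: "disjoint_family_on U (h_fiber y)"
    unfolding disjoint_family_on_def
  proof (intro ballI impI)
    fix x u assume xu: "x \<in> h_fiber y" "u \<in> h_fiber y" "x \<noteq> u"
    show "U x \<inter> U u = {}"
    proof (cases "p u = p x")
      case True
      have "p x \<in> fiber C1 f y" using xu(1) p_points by (auto simp: fiber_def)
      from uniform_chartsD(9)[OF up[OF this]] show ?thesis
        using xu True unfolding disjoint_family_on_def fiber_def by auto
    next
      case False then show ?thesis using Up[OF xu(1,2)] by blast
    qed
  qed
  have cov: "(\<Union>x\<in>h_fiber y. U x) = {u \<in> points R. f (p u) \<in> V}"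
  proof (intro equalityI subsetI)
    fix u assume "u \<in> (\<Union>x\<in>h_fiber y. U x)"
    then obtain x where x: "x \<in> h_fiber y" "u \<in> U x" by blast
    have u: "u \<in> points R" using M x disk_chart_props(2) by blast
    have "p x \<in> fiber C1 f y" using x(1) p_points by (auto simp: fiber_def)
    then have "f (p u) \<in> V" using F(7) M x by blast
    then show "u \<in> {u \<in> points R. f (p u) \<in> V}" using u by simp
  next
    fix u assume "u \<in> {u \<in> points R. f (p u) \<in> V}"
    then have u: "u \<in> points R" "f (p u) \<in> V" by auto
    then have "p u \<in> (\<Union>z\<in>fiber C1 f y. A z)" using p_points F(10) by simp
    then obtain z where z: "z \<in> fiber C1 f y" "p u \<in> A z" by blast
    then have "u \<in> (\<Union>x\<in>fiber R p z. U x)" using uniform_chartsD(10)[OF up[OF z(1)]] u(1) by simp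
    then show "u \<in> (\<Union>x\<in>h_fiber y. U x)" using z(1) by (auto simp: fiber_def)
  qed
  have "local_model y V A \<phi>1 B \<phi>2 U (\<lambda>x. fst (M x)) (\<lambda>x. snd (M x))"
    unfolding local_model_def using uf ug dis cov M by blast
  then show ?thesis by blast
qed

end

section \<open>Local models over all points of the base\<close>

lemma uniform_charts_family:
  assumes br: "branched_covering S C f"
    and ch: "\<forall>y\<in>points C. \<exists>\<psi>. uniform_charts S C f (V y) \<psi> y A \<phi>"
    and z: "z \<in> points S"
  shows "disk_chart S (A z) (\<phi> z)" "z \<in> A z" "\<phi> z z = 0" "\<And>u. u \<in> A z \<Longrightarrow> f u \<in> V (f z)"
    "\<And>z'. z' \<in> points S \<Longrightarrow> f z = f z' \<Longrightarrow> A z \<inter> A z' \<noteq> {} \<Longrightarrow> z = z'"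
proof -
  obtain \<psi> where u: "uniform_charts S C f (V (f z)) \<psi> (f z) A \<phi>"
    using bspec[OF ch branched_covering_surfaces(4)[OF br z]] ..
  have zf: "z \<in> fiber S f (f z)" using z by (simp add: fiber_def)
  show "disk_chart S (A z) (\<phi> z)" "z \<in> A z" "\<phi> z z = 0"
    by (rule uniform_chartsD(4,5,6)[OF u zf])+
  show "\<And>u. u \<in> A z \<Longrightarrow> f u \<in> V (f z)" by (rule uniform_chartsD(7)[OF u zf])
  show "\<And>z'. z' \<in> points S \<Longrightarrow> f z = f z' \<Longrightarrow> A z \<inter> A z' \<noteq> {} \<Longrightarrow> z = z'"
    using uniform_chartsD(9)[OF u] zf unfolding disjoint_family_on_def fiber_def by auto
qed

locale charted_square = branched_square +
  fixes V :: "'d \<Rightarrow> 'd set" and A :: "'b \<Rightarrow> 'b set" and \<phi>1 :: "'b \<Rightarrow> 'b \<Rightarrow> complex"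
    and B :: "'c \<Rightarrow> 'c set" and \<phi>2 :: "'c \<Rightarrow> 'c \<Rightarrow> complex"
    and U :: "'a \<Rightarrow> 'a set" and \<phi> :: "'a \<Rightarrow> 'a \<Rightarrow> complex" and om :: "'a \<Rightarrow> complex"
  assumes model: "\<And>y. y \<in> points C \<Longrightarrow> local_model y (V y) A \<phi>1 B \<phi>2 U \<phi> om"

text \<open>A point determines the base point below it, so the charts chosen separately for each
  \<open>y\<close> combine into families indexed by points alone.\<close>

lemma (in branched_square) ex_charted_square:
  "\<exists>V A \<phi>1 B \<phi>2 U \<phi> om. charted_square R C1 C2 C p q f g V A \<phi>1 B \<phi>2 U \<phi> om"
proof -
  have "\<forall>y. \<exists>V A \<phi>1 B \<phi>2 U \<phi> om. y \<in> points C \<longrightarrow> local_model y V A \<phi>1 B \<phi>2 U \<phi> om"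
    using ex_local_model by blast
  then obtain V A \<phi>1 B \<phi>2 U \<phi> om where
    M: "\<And>y. y \<in> points C \<Longrightarrow> local_model y (V y) (A y) (\<phi>1 y) (B y) (\<phi>2 y) (U y) (\<phi> y) (om y)"
    by metis
  have "local_model y (V y) (\<lambda>z. A (f z) z) (\<lambda>z. \<phi>1 (f z) z) (\<lambda>b. B (g b) b) (\<lambda>b. \<phi>2 (g b) b)
      (\<lambda>x. U (f (p x)) x) (\<lambda>x. \<phi> (f (p x)) x) (\<lambda>x. om (f (p x)) x)" if y: "y \<in> points C" for y
  proof -
    note m = M[OF y, unfolded local_model_def]
    have "\<exists>\<psi>. uniform_charts C1 C f (V y) \<psi> y (\<lambda>z. A (f z) z) (\<lambda>z. \<phi>1 (f z) z)"
    proof -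
      obtain \<psi> where "uniform_charts C1 C f (V y) \<psi> y (A y) (\<phi>1 y)" using m by blast
      from uniform_charts_cong[OF this, of "\<lambda>z. A (f z) z" "\<lambda>z. \<phi>1 (f z) z"]
      show ?thesis by (auto simp: fiber_def)
    qed
    moreover have "\<exists>\<psi>. uniform_charts C2 C g (V y) \<psi> y (\<lambda>b. B (g b) b) (\<lambda>b. \<phi>2 (g b) b)"
    proof -
      obtain \<psi> where "uniform_charts C2 C g (V y) \<psi> y (B y) (\<phi>2 y)" using m by blast
      from uniform_charts_cong[OF this, of "\<lambda>b. B (g b) b" "\<lambda>b. \<phi>2 (g b) b"]
      show ?thesis by (auto simp: fiber_def)
    qed
    moreover have "disjoint_family_on (\<lambda>x. U (f (p x)) x) (h_fiber y)"
      using m by (simp add: disjoint_family_on_def)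
    moreover have "(\<Union>x\<in>h_fiber y. U (f (p x)) x) = {u \<in> points R. f (p u) \<in> V y}"
      using m by simp
    moreover have "g (q x) = y" if "x \<in> h_fiber y" for x using that comm[of x] by auto
    ultimately show ?thesis using m unfolding local_model_def by simp
  qed
  then have "charted_square R C1 C2 C p q f g V (\<lambda>z. A (f z) z) (\<lambda>z. \<phi>1 (f z) z) (\<lambda>b. B (g b) b)
      (\<lambda>b. \<phi>2 (g b) b) (\<lambda>x. U (f (p x)) x) (\<lambda>x. \<phi> (f (p x)) x) (\<lambda>x. om (f (p x)) x)"
    by unfold_locales
  then show ?thesis by blast
qed

context charted_square begin

lemma f_charts: "\<forall>y\<in>points C. \<exists>\<psi>. uniform_charts C1 C f (V y) \<psi> y A \<phi>1"
  and g_charts: "\<forall>y\<in>points C. \<exists>\<psi>. uniform_charts C2 C g (V y) \<psi> y B \<phi>2"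
  using model unfolding local_model_def by blast+

lemmas A = uniform_charts_family[OF f f_charts]
lemmas B = uniform_charts_family[OF g g_charts]

lemma h_points: "x \<in> points R \<Longrightarrow> f (p x) \<in> points C"
  using f_points p_points by blast

lemma U:
  assumes "x \<in> points R"
  shows "disk_chart R (U x) (\<phi> x)" "x \<in> U x" "\<phi> x x = 0" "norm (om x) = 1"
    "om x = some_root (al x) (om x ^ al x)" "om x ^ deg_g (q x) = 1"
    "deg_p x * deg_f (p x) = deg_q x * deg_g (q x)"
    "\<And>u. u \<in> U x \<Longrightarrow> p u \<in> A (p x)" "\<And>u. u \<in> U x \<Longrightarrow> q u \<in> B (q x)"
    "\<And>u. u \<in> U x \<Longrightarrow> \<phi>1 (p x) (p u) = \<phi> x u ^ (common_deg x * al x)"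
    "\<And>u. u \<in> U x \<Longrightarrow> \<phi>2 (q x) (q u) = om x * \<phi> x u ^ (common_deg x * be x)"
proof -
  have "x \<in> h_fiber (f (p x))" using assms by simp
  then show "disk_chart R (U x) (\<phi> x)" "x \<in> U x" "\<phi> x x = 0" "norm (om x) = 1"
    "om x = some_root (al x) (om x ^ al x)" "om x ^ deg_g (q x) = 1"
    "deg_p x * deg_f (p x) = deg_q x * deg_g (q x)"
    "\<And>u. u \<in> U x \<Longrightarrow> p u \<in> A (p x)" "\<And>u. u \<in> U x \<Longrightarrow> q u \<in> B (q x)"
    "\<And>u. u \<in> U x \<Longrightarrow> \<phi>1 (p x) (p u) = \<phi> x u ^ (common_deg x * al x)"
    "\<And>u. u \<in> U x \<Longrightarrow> \<phi>2 (q x) (q u) = om x * \<phi> x u ^ (common_deg x * be x)"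
    using model[OF h_points[OF assms]] unfolding local_model_def by blast+
qed

lemma U_disjoint:
  assumes "x \<in> points R" "x' \<in> points R" "f (p x) = f (p x')" "U x \<inter> U x' \<noteq> {}" shows "x = x'"
proof -
  have "disjoint_family_on U (h_fiber (f (p x)))"
    using model[OF h_points[OF assms(1)]] unfolding local_model_def by blast
  then show ?thesis using assms unfolding disjoint_family_on_def by auto
qed

lemma U_cover:
  assumes "u \<in> points R" "y \<in> points C" "f (p u) \<in> V y"
  obtains x where "x \<in> points R" "f (p x) = y" "u \<in> U x"
proof -
  have "(\<Union>x\<in>h_fiber y. U x) = {u \<in> points R. f (p u) \<in> V y}"
    using model[OF assms(2)] unfolding local_model_def by (elim conjE)
  then have "u \<in> (\<Union>x\<in>h_fiber y. U x)" using assms by simp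
  then show thesis using that by blast
qed

lemma U_points: "x \<in> points R \<Longrightarrow> u \<in> U x \<Longrightarrow> u \<in> points R"
  using U(1) disk_chart_props(2) by blast

lemma degrees:
  assumes "x \<in> points R"
  shows "deg_p x = common_deg x * al x" "deg_q x = common_deg x * be x" "1 \<le> common_deg x" "1 \<le> al x" "1 \<le> be x"
    "coprime (al x) (be x)"
  by (rule degree_factors[OF assms U(7)[OF assms]])+

end

section \<open>The quotient through which both maps factor\<close>

text \<open>The ratio of the two numbers has order dividing both \<alpha> and \<beta>, so it is 1 by
  Bezout.\<close>

lemma complex_coprime_powers_eq:
  fixes \<zeta> \<zeta>' :: complex
  assumes "\<zeta> ^ \<alpha> = \<zeta>' ^ \<alpha>" "\<zeta> ^ \<beta> = \<zeta>' ^ \<beta>" "coprime \<alpha> \<beta>" "1 \<le> \<alpha>"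
  shows "\<zeta> = \<zeta>'"
proof (cases "\<zeta>' = 0")
  case True
  then show ?thesis using assms(1,4) by (simp add: power_0_left)
next
  case False
  define \<rho> where "\<rho> = \<zeta> / \<zeta>'"
  have \<rho>: "\<rho> ^ \<alpha> = 1" "\<rho> ^ \<beta> = 1" using False assms(1,2) by (simp_all add: \<rho>_def power_divide)
  obtain s t where "\<alpha> * s = \<beta> * t + 1"
    using bezout_nat[of \<alpha> \<beta>] assms(3,4) by (auto simp: coprime_iff_gcd_eq_1)
  then have "\<rho> ^ (\<alpha> * s) = \<rho> ^ (\<beta> * t + 1)" by simp
  then have "\<rho> = 1" using \<rho> by (simp add: power_mult power_add)
  then show ?thesis using False by (simp add: \<rho>_def)
qed

lemma open_power_image:
  assumes "open (S :: complex set)" "1 \<le> k" shows "open ((\<lambda>z. z ^ k) ` S)"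
proof (rule open_mapping_thm[of "\<lambda>z. z ^ k" UNIV])
  show "\<not> (\<lambda>z::complex. z ^ k) constant_on UNIV"
  proof
    assume "(\<lambda>z::complex. z ^ k) constant_on UNIV"
    then have "(0::complex) ^ k = 1 ^ k" unfolding constant_on_def by (metis UNIV_I)
    then show False using assms(2) by (simp add: power_0_left)
  qed
qed (use assms in \<open>auto intro!: holomorphic_intros\<close>)

lemma power_image_ball: "1 \<le> k \<Longrightarrow> (\<lambda>z. z ^ k) ` ball 0 1 = (ball 0 1 :: complex set)"
proof (intro equalityI subsetI)
  fix z :: complex assume k: "1 \<le> k" and z: "z \<in> ball 0 1"
  obtain w where w: "w ^ k = z"
  proof (cases "z = 0")
    case True then show thesis using that[of 0] k by simp
  next
    case False then show thesis using that[of "exp (Ln z / of_nat k)"] k by (simp flip: exp_of_nat_mult)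
  qed
  then have "norm w ^ k < 1" using z by (simp flip: norm_power)
  then have "norm w < 1" using k by (simp add: power_less_one_iff)
  then show "z \<in> (\<lambda>z. z ^ k) ` ball 0 1" using w by auto
qed (auto simp: norm_power power_less_one_iff)

section \<open>The equivalence relation on R in charts\<close>

context charted_square begin

text \<open>The coordinate that descends to the quotient: \<open>p\<close> and \<open>q\<close> are
  both expressed through it, with coprime exponents.\<close>

definition xi :: "'a \<Rightarrow> 'a \<Rightarrow> complex" where "xi x u = \<phi> x u ^ common_deg x"

lemma xi_forms:
  assumes "x \<in> points R" "u \<in> U x"
  shows "\<phi>1 (p x) (p u) = xi x u ^ al x" "\<phi>2 (q x) (q u) = om x * xi x u ^ be x"
  using U(10,11)[OF assms] by (simp_all add: xi_def power_mult)

lemma om_nz: "x \<in> points R \<Longrightarrow> om x \<noteq> 0" using U(4) by fastforce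

lemma xi_center: "x \<in> points R \<Longrightarrow> xi x x = 0"
  using U(3)[of x] degrees_ge_1(1)[of x] by (simp add: xi_def power_0_left)

lemma xi_eq_0_iff:
  assumes "x \<in> points R" "u \<in> U x" shows "xi x u = 0 \<longleftrightarrow> u = x"
proof
  assume "xi x u = 0"
  then have "\<phi> x u = \<phi> x x" using U(3)[OF assms(1)] by (simp add: xi_def)
  then show "u = x"
    using disk_chart_props(3)[OF U(1)[OF assms(1)]] assms U(2) by (auto dest: inj_onD)
qed (use xi_center assms in auto)

lemma xi_image: assumes "x \<in> points R" shows "xi x ` U x = ball 0 1"
proof -
  have "xi x ` U x = (\<lambda>z. z ^ common_deg x) ` \<phi> x ` U x" by (simp add: xi_def image_image)
  then show ?thesis
    using power_image_ball[OF degrees(3)[OF assms]] disk_chart_props(4)[OF U(1)[OF assms]] by simp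
qed

lemma open_xi_image:
  assumes "x \<in> points R" "openin (surf_top R) N" shows "open (xi x ` (N \<inter> U x))"
  using open_power_image[OF disk_chart_props(6)[OF U(1)[OF assms(1)] assms(2)] degrees(3)[OF assms(1)]]
  unfolding xi_def by (simp add: image_image)

lemma openin_xi_preimage:
  assumes "x \<in> points R" "open D" shows "openin (surf_top R) {u \<in> U x. xi x u \<in> D}"
proof -
  have "open ((\<lambda>z. z ^ common_deg x) -` D)"
    by (rule open_vimage[OF assms(2)]) (intro continuous_intros)
  from disk_chart_props(7)[OF U(1)[OF assms(1)] this] show ?thesis by (simp add: xi_def)
qed

lemma p_eqI:
  assumes "x \<in> points R" "x' \<in> points R" "u \<in> U x" "u' \<in> U x'" "p x = p x'"
    "\<phi>1 (p x) (p u) = \<phi>1 (p x) (p u')"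
  shows "p u = p u'"
  using disk_chart_props(3)[OF A(1)[OF p_points[OF assms(1)]]] U(8)[OF assms(1,3)] U(8)[OF assms(2,4)]
    assms(5,6) by (auto dest: inj_onD)

lemma q_eqI:
  assumes "x \<in> points R" "x' \<in> points R" "u \<in> U x" "u' \<in> U x'" "q x = q x'"
    "\<phi>2 (q x) (q u) = \<phi>2 (q x) (q u')"
  shows "q u = q u'"
  using disk_chart_props(3)[OF B(1)[OF q_points[OF assms(1)]]] U(9)[OF assms(1,3)] U(9)[OF assms(2,4)]
    assms(5,6) by (auto dest: inj_onD)

text \<open>This does not refer to the charts; inside them it says that the local images of \<open>(p, q)\<close> at
  the two points agree.\<close>

definition eqv :: "'a \<Rightarrow> 'a \<Rightarrow> bool" where
  "eqv x x' \<longleftrightarrow> x \<in> points R \<and> x' \<in> points R \<and> p x = p x' \<and> q x = q x' \<and>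
     (\<forall>N N'. openin (surf_top R) N \<and> openin (surf_top R) N' \<and> x \<in> N \<and> x' \<in> N' \<longrightarrow>
        (\<exists>u\<in>N. \<exists>u'\<in>N'. p u \<noteq> p x \<and> p u = p u' \<and> q u = q u'))"

text \<open>Raising the equation for \<open>q\<close> to the power \<alpha> and cancelling the power
  of \<open>xi\<close> known from \<open>p\<close> leaves equality of the \<open>al\<close>-th
  powers of \<open>om\<close>, which determine \<open>om\<close> by its selection. Both powers of
  \<open>xi\<close> then agree, and their exponents are coprime.\<close>

lemma om_eqI:
  assumes x: "x \<in> points R" "x' \<in> points R" "p x = p x'" "q x = q x'" and u: "u \<in> U x" "u' \<in> U x'"
    and pq: "p u = p u'" "q u = q u'" and nz: "xi x u \<noteq> 0"
  shows "om x = om x'" "xi x u = xi x' u'"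
proof -
  note X = xi_forms[OF x(1) u(1)] and X' = xi_forms[OF x(2) u(2)]
  have same: "al x' = al x" "be x' = be x" using x(3,4) by simp_all
  have 1: "xi x u ^ al x = xi x' u' ^ al x" using X(1) X'(1) x(3,4) pq(1) by simp
  have 2: "om x * xi x u ^ be x = om x' * xi x' u' ^ be x" using X(2) X'(2) x(3,4) pq(2) by simp
  have swap: "(z ^ m) ^ n = (z ^ n) ^ m" for z :: complex and m n
    by (simp add: mult.commute flip: power_mult)
  have pw: "(xi x u ^ be x) ^ al x = (xi x' u' ^ be x) ^ al x"
    unfolding swap[of _ "be x" "al x"] by (simp only: 1)
  have "om x ^ al x * (xi x u ^ be x) ^ al x = om x' ^ al x * (xi x' u' ^ be x) ^ al x"
    by (simp only: 2 flip: power_mult_distrib)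
  then have "om x ^ al x * (xi x u ^ be x) ^ al x = om x' ^ al x * (xi x u ^ be x) ^ al x"
    by (simp only: pw)
  then have "om x ^ al x = om x' ^ al x" using nz by simp
  then show om: "om x = om x'" using U(5)[OF x(1)] U(5)[OF x(2)] unfolding same by metis
  then have "xi x u ^ be x = xi x' u' ^ be x" using 2 om_nz[OF x(1)] by simp
  then show "xi x u = xi x' u'"
    using complex_coprime_powers_eq[OF 1 _ degrees(6)[OF x(1)] degrees(4)[OF x(1)]] by blast
qed

lemma eqv_center_imp_om:
  assumes "eqv x x'" shows "om x = om x'"
proof -
  have x: "x \<in> points R" "x' \<in> points R" "p x = p x'" "q x = q x'" using assms unfolding eqv_def by auto
  have "openin (surf_top R) (U x)" "openin (surf_top R) (U x')" "x \<in> U x" "x' \<in> U x'"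
    using U(1,2) x disk_chart_props(1) by blast+
  then obtain u u' where u: "u \<in> U x" "u' \<in> U x'" "p u \<noteq> p x" "p u = p u'" "q u = q u'"
    using assms unfolding eqv_def by blast
  then have "xi x u \<noteq> 0" using xi_eq_0_iff[OF x(1)] by blast
  then show ?thesis using om_eqI[OF x u(1,2,4,5)] by blast
qed

lemma p_neq_center:
  assumes x: "x \<in> points R" and u: "u \<in> U x" "v \<in> U x" and neq: "xi x u ^ al x \<noteq> xi x v ^ al x"
  shows "p u \<noteq> p v"
  using xi_forms(1)[OF x u(1)] xi_forms(1)[OF x u(2)] neq by metis

text \<open>Points with coordinates \<open>t ^ common_deg x'\<close> at \<open>x\<close> and
  \<open>t ^ common_deg x\<close> at \<open>x'\<close> have the same \<open>xi\<close>, so with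
  equal \<open>om\<close> they agree under \<open>p\<close> and \<open>q\<close>; \<open>t\<close>
  may be arbitrarily small.\<close>

lemma eqv_centerI:
  assumes x: "x \<in> points R" "x' \<in> points R" "p x = p x'" "q x = q x'" and om: "om x = om x'"
  shows "eqv x x'"
  unfolding eqv_def
proof (intro conjI allI impI x)
  fix N N' assume N: "openin (surf_top R) N \<and> openin (surf_top R) N' \<and> x \<in> N \<and> x' \<in> N'"
  have "0 \<in> \<phi> x ` (N \<inter> U x)" "0 \<in> \<phi> x' ` (N' \<inter> U x')"
    using N U(2,3)[OF x(1)] U(2,3)[OF x(2)] by (metis IntI image_eqI)+
  moreover have "open (\<phi> x ` (N \<inter> U x))" "open (\<phi> x' ` (N' \<inter> U x'))"
    using N disk_chart_props(6) U(1) x by blast+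
  ultimately obtain e e' where e: "e > 0" "ball 0 e \<subseteq> \<phi> x ` (N \<inter> U x)"
    "e' > 0" "ball 0 e' \<subseteq> \<phi> x' ` (N' \<inter> U x')"
    by (meson open_contains_ball)
  define t where "t = min (min e e') 1 / 2"
  have t: "0 < t" "t < e" "t < e'" "t < 1" using e by (auto simp: t_def)
  have small: "norm (of_real t ^ n :: complex) \<le> t" if "1 \<le> n" for n
    using power_decreasing[OF that, of t] t by (simp add: norm_power)
  have "of_real t ^ common_deg x' \<in> ball (0::complex) e" "of_real t ^ common_deg x \<in> ball (0::complex) e'"
    using small[OF degrees(3)] x t by fastforce+
  then have im: "of_real t ^ common_deg x' \<in> \<phi> x ` (N \<inter> U x)" "of_real t ^ common_deg x \<in> \<phi> x' ` (N' \<inter> U x')"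
    using e(2,4) by blast+
  obtain u where u0: "of_real t ^ common_deg x' = \<phi> x u" "u \<in> N \<inter> U x" by (rule imageE[OF im(1)])
  obtain u' where u1: "of_real t ^ common_deg x = \<phi> x' u'" "u' \<in> N' \<inter> U x'" by (rule imageE[OF im(2)])
  have u: "u \<in> N" "u \<in> U x" "\<phi> x u = of_real t ^ common_deg x'"
    "u' \<in> N'" "u' \<in> U x'" "\<phi> x' u' = of_real t ^ common_deg x" using u0 u1 by auto
  have xi: "xi x u = xi x' u'" using u by (simp add: xi_def mult.commute flip: power_mult)
  have same: "al x' = al x" "be x' = be x" using x(3,4) by simp_all
  have "xi x u ^ al x \<noteq> 0" using u(3) t by (simp add: xi_def)
  then have "p u \<noteq> p x"
    using p_neq_center[OF x(1) u(2) U(2)[OF x(1)]] xi_center[OF x(1)] degrees(4)[OF x(1)] by fastforce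
  moreover have "p u = p u'"
    using p_eqI[OF x(1,2) u(2,5) x(3)] xi_forms(1)[OF x(1) u(2)] xi_forms(1)[OF x(2) u(5)] xi x(3) x(4) by simp
  moreover have "q u = q u'"
    using q_eqI[OF x(1,2) u(2,5) x(4)] xi_forms(2)[OF x(1) u(2)] xi_forms(2)[OF x(2) u(5)] xi om x(3) x(4) by simp
  ultimately show "\<exists>u\<in>N. \<exists>u'\<in>N'. p u \<noteq> p x \<and> p u = p u' \<and> q u = q u'" using u by blast
qed

text \<open>Every point is the centre of its own chart, so this describes the relation everywhere
  and makes it visibly an equivalence.\<close>

lemma eqv_iff_om: "eqv x x' \<longleftrightarrow> x \<in> points R \<and> x' \<in> points R \<and> p x = p x' \<and> q x = q x' \<and> om x = om x'"
proof
  assume e: "eqv x x'"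
  then have "x \<in> points R" "x' \<in> points R" "p x = p x'" "q x = q x'" unfolding eqv_def by simp_all
  then show "x \<in> points R \<and> x' \<in> points R \<and> p x = p x' \<and> q x = q x' \<and> om x = om x'"
    using eqv_center_imp_om[OF e] by simp
qed (use eqv_centerI in simp)

lemma eqv_refl: "x \<in> points R \<Longrightarrow> eqv x x" by (simp add: eqv_iff_om)
lemma eqv_sym: "eqv x x' \<Longrightarrow> eqv x' x" by (simp add: eqv_iff_om)
lemma eqv_trans: "eqv x x' \<Longrightarrow> eqv x' x'' \<Longrightarrow> eqv x x''" by (simp add: eqv_iff_om)
lemma eqv_points: "eqv x x' \<Longrightarrow> x \<in> points R" "eqv x x' \<Longrightarrow> x' \<in> points R" by (auto simp: eqv_iff_om)

text \<open>Shrinking both points towards the centres by compatible powers of \<open>s < 1\<close> keeps their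
  images under \<open>(p, q)\<close> equal.\<close>

lemma eqv_off_centerI:
  assumes x: "x \<in> points R" "x' \<in> points R" "p x = p x'" "q x = q x'" and om: "om x = om x'"
    and u: "u \<in> U x" "u' \<in> U x'" and xi: "xi x u = xi x' u'" and nz: "xi x u \<noteq> 0"
  shows "eqv u u'"
  unfolding eqv_def
proof (intro conjI allI impI)
  show uR: "u \<in> points R" "u' \<in> points R" using U_points x u by blast+
  have same: "al x' = al x" "be x' = be x" using x(3,4) by simp_all
  have pq: "p v = p v' \<and> q v = q v'" if "v \<in> U x" "v' \<in> U x'" "xi x v = xi x' v'" for v v'
    using p_eqI[OF x(1,2) that(1,2) x(3)] xi_forms(1)[OF x(1) that(1)] xi_forms(1)[OF x(2) that(2)]
      q_eqI[OF x(1,2) that(1,2) x(4)] xi_forms(2)[OF x(1) that(1)] xi_forms(2)[OF x(2) that(2)]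
      that(3) om x(3,4) by simp
  show "p u = p u'" "q u = q u'" using pq[OF u xi] by blast+
  fix N N' assume N: "openin (surf_top R) N \<and> openin (surf_top R) N' \<and> u \<in> N \<and> u' \<in> N'"
  have op: "open (\<phi> x ` (N \<inter> U x))" "open (\<phi> x' ` (N' \<inter> U x'))"
    using N disk_chart_props(6) U(1) x by blast+
  have mem: "\<phi> x u \<in> \<phi> x ` (N \<inter> U x)" "\<phi> x' u' \<in> \<phi> x' ` (N' \<inter> U x')" using N u by blast+
  have lim: "((\<lambda>s. of_real s ^ n * z) \<longlongrightarrow> z) (at_left (1::real))" for n and z :: complex
  proof -
    have "((\<lambda>s. of_real s ^ n * z) \<longlongrightarrow> of_real 1 ^ n * z) (at_left (1::real))" by (intro tendsto_intros)
    then show ?thesis by simp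
  qed
  have "\<forall>\<^sub>F s in at_left (1::real). of_real s ^ common_deg x' * \<phi> x u \<in> \<phi> x ` (N \<inter> U x)"
    by (rule topological_tendstoD[OF lim op(1) mem(1)])
  moreover have "\<forall>\<^sub>F s in at_left (1::real). of_real s ^ common_deg x * \<phi> x' u' \<in> \<phi> x' ` (N' \<inter> U x')"
    by (rule topological_tendstoD[OF lim op(2) mem(2)])
  moreover have "\<forall>\<^sub>F s in at_left (1::real). 0 < s \<and> s < 1"
    using eventually_at_left_real[of 0 "1::real"] by simp
  ultimately have "\<forall>\<^sub>F s in at_left (1::real). of_real s ^ common_deg x' * \<phi> x u \<in> \<phi> x ` (N \<inter> U x) \<and>
      of_real s ^ common_deg x * \<phi> x' u' \<in> \<phi> x' ` (N' \<inter> U x') \<and> 0 < s \<and> s < 1"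
    by eventually_elim blast
  then obtain s where s: "of_real s ^ common_deg x' * \<phi> x u \<in> \<phi> x ` (N \<inter> U x)"
    "of_real s ^ common_deg x * \<phi> x' u' \<in> \<phi> x' ` (N' \<inter> U x')" "0 < s" "s < (1::real)"
    using eventually_happens'[OF trivial_limit_at_left_real] by blast
  obtain v where v: "v \<in> N" "v \<in> U x" "\<phi> x v = of_real s ^ common_deg x' * \<phi> x u" using s(1) by (auto simp: image_iff)
  obtain v' where v': "v' \<in> N'" "v' \<in> U x'" "\<phi> x' v' = of_real s ^ common_deg x * \<phi> x' u'"
    using s(2) by (auto simp: image_iff)
  \<comment> \<open>The factors \<open>s ^ common_deg x'\<close> and \<open>s ^ common_deg x\<close>
    on the two coordinates both multiply \<open>xi\<close> by \<open>s ^ ?n\<close>.\<close>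
  let ?n = "common_deg x * common_deg x'"
  have xv: "xi x v = of_real s ^ ?n * xi x u" "xi x' v' = of_real s ^ ?n * xi x' u'"
    using v(3) v'(3) by (simp_all add: xi_def power_mult_distrib mult.commute flip: power_mult)
  then have "p v = p v' \<and> q v = q v'" using pq[OF v(2) v'(2)] xi by simp
  moreover have "p v \<noteq> p u"
  proof (rule p_neq_center[OF x(1) v(2) u(1)])
    have "1 \<le> ?n" using degrees(3) x by (metis One_nat_def Suc_leI le_less_trans less_eq_Suc_le nat_0_less_mult_iff)
    then have "?n * al x \<noteq> 0" using degrees(4)[OF x(1)] by (metis mult_is_0 not_one_le_zero)
    then have "s ^ (?n * al x) < 1" using s(3,4) power_less_one_iff[of s "?n * al x"] by simp
    then have "norm (of_real s ^ (?n * al x) :: complex) < 1" using s(3) by (simp add: norm_power)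
    then have "of_real s ^ (?n * al x) \<noteq> (1::complex)" by (metis less_irrefl norm_one)
    moreover have "xi x v ^ al x = of_real s ^ (?n * al x) * xi x u ^ al x"
      unfolding xv(1) by (simp only: power_mult_distrib power_mult)
    ultimately show "xi x v ^ al x \<noteq> xi x u ^ al x" using nz by simp
  qed
  ultimately show "\<exists>v\<in>N. \<exists>v'\<in>N'. p v \<noteq> p u \<and> p v = p v' \<and> q v = q v'" using v(1) v'(1) by blast
qed

text \<open>Charts centred elsewhere also detect the relation. Where \<open>xi\<close> is nonzero,
  agreement under \<open>p\<close> and \<open>q\<close> at the single pair \<open>u\<close>,
  \<open>u'\<close> already yields equal \<open>om\<close> and \<open>xi\<close>; where it is zero,
  both points are the centres.\<close>

lemma eqv_iff:
  assumes x: "x \<in> points R" "x' \<in> points R" "f (p x) = f (p x')" and u: "u \<in> U x" "u' \<in> U x'"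
  shows "eqv u u' \<longleftrightarrow> eqv x x' \<and> xi x u = xi x' u'"
proof
  assume e: "eqv u u'"
  then have pq: "p u = p u'" "q u = q u'" by (auto simp: eqv_iff_om)
  \<comment> \<open>Sheets of \<open>f\<close> over one base point are disjoint, so a common value
    forces \<open>p x = p x'\<close>; likewise for \<open>g\<close> and \<open>q\<close>.\<close>
  have "p u \<in> A (p x) \<inter> A (p x')" using U(8) x u pq by (metis IntI)
  then have px: "p x = p x'" using A(5)[OF p_points[OF x(1)] p_points[OF x(2)] x(3)] by blast
  have "q u \<in> B (q x) \<inter> B (q x')" using U(9) x u pq by (metis IntI)
  moreover have "g (q x) = g (q x')" using x comm by metis
  ultimately have qx: "q x = q x'" using B(5)[OF q_points[OF x(1)] q_points[OF x(2)]] by blast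
  show "eqv x x' \<and> xi x u = xi x' u'"
  proof (cases "xi x u = 0")
    case True
    have "xi x' u' ^ al x' = xi x u ^ al x"
      using xi_forms(1)[OF x(1) u(1)] xi_forms(1)[OF x(2) u(2)] px pq by simp
    then have "xi x' u' = 0" using True degrees(4)[OF x(1)] by (simp add: power_0_left)
    then have "u = x" "u' = x'" using True xi_eq_0_iff x u by blast+
    then show ?thesis using e True \<open>xi x' u' = 0\<close> by simp
  next
    case False
    show ?thesis using om_eqI[OF x(1,2) px qx u pq False] x px qx by (simp add: eqv_iff_om)
  qed
next
  assume e: "eqv x x' \<and> xi x u = xi x' u'"
  then have px: "p x = p x'" "q x = q x'" "om x = om x'" by (auto simp: eqv_iff_om)
  show "eqv u u'"
  proof (cases "xi x u = 0")
    case True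
    then have "u = x" "u' = x'" using e xi_eq_0_iff[OF x(1) u(1)] xi_eq_0_iff[OF x(2) u(2)] by auto
    then show ?thesis using e by simp
  next
    case False
    show ?thesis using eqv_off_centerI[OF x(1,2) px u _ False] e by blast
  qed
qed

lemma eqv_sheet:
  assumes x: "x \<in> points R" "v \<in> U x" and e: "eqv u v"
  obtains x' where "eqv x x'" "u \<in> U x'" "xi x' u = xi x v"
proof -
  have "f (p v) \<in> V (f (p x))" using A(4)[OF p_points[OF x(1)] U(8)[OF x]] .
  then have "f (p u) \<in> V (f (p x))" using e by (simp add: eqv_iff_om)
  then obtain x' where x': "x' \<in> points R" "f (p x') = f (p x)" "u \<in> U x'"
    using U_cover[OF eqv_points(1)[OF e] h_points[OF x(1)]] by metis
  from eqv_iff[OF x'(1) x(1) x'(2,3) x(2)] e show thesis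
    using that x'(3) eqv_sym by blast
qed

lemma eqv_partner:
  assumes e: "eqv x x'" and u: "u \<in> U x'"
  obtains v where "v \<in> U x" "xi x v = xi x' u" "eqv v u"
proof -
  note x = eqv_points[OF e]
  have "xi x' u \<in> xi x ` U x" using xi_image[OF x(1)] xi_image[OF x(2)] u by blast
  then obtain v where v: "v \<in> U x" "xi x v = xi x' u" by auto
  moreover have "f (p x) = f (p x')" using e by (simp add: eqv_iff_om)
  ultimately show thesis using that eqv_iff[OF x _ v(1) u] e by blast
qed

section \<open>Topology and disks of the quotient\<close>

definition cls :: "'a \<Rightarrow> 'a set" where "cls x = {x'. eqv x x'}"

lemma cls_eq_iff: "x \<in> points R \<Longrightarrow> cls x = cls x' \<longleftrightarrow> eqv x x'"
  unfolding cls_def using eqv_refl eqv_sym eqv_trans by blast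

definition quot_top :: "'a set topology" where
  "quot_top = topology (\<lambda>S. S \<subseteq> cls ` points R \<and> openin (surf_top R) {x \<in> points R. cls x \<in> S})"

lemma openin_quot:
  "openin quot_top S \<longleftrightarrow> S \<subseteq> cls ` points R \<and> openin (surf_top R) {x \<in> points R. cls x \<in> S}"
proof -
  have "istopology (\<lambda>S. S \<subseteq> cls ` points R \<and> openin (surf_top R) {x \<in> points R. cls x \<in> S})"
    unfolding istopology_def
  proof (intro conjI allI impI)
    fix S S' assume S: "S \<subseteq> cls ` points R \<and> openin (surf_top R) {x \<in> points R. cls x \<in> S}"
      "S' \<subseteq> cls ` points R \<and> openin (surf_top R) {x \<in> points R. cls x \<in> S'}"
    have "{x \<in> points R. cls x \<in> S \<inter> S'} = {x \<in> points R. cls x \<in> S} \<inter> {x \<in> points R. cls x \<in> S'}" by auto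
    then show "openin (surf_top R) {x \<in> points R. cls x \<in> S \<inter> S'}" using S by auto
    show "S \<inter> S' \<subseteq> cls ` points R" using S by blast
  next
    fix \<K> assume K: "\<forall>S\<in>\<K>. S \<subseteq> cls ` points R \<and> openin (surf_top R) {x \<in> points R. cls x \<in> S}"
    have "{x \<in> points R. cls x \<in> \<Union>\<K>} = (\<Union>S\<in>\<K>. {x \<in> points R. cls x \<in> S})" by auto
    then show "openin (surf_top R) {x \<in> points R. cls x \<in> \<Union>\<K>}" using K by auto
    show "\<Union>\<K> \<subseteq> cls ` points R" using K by blast
  qed
  then show ?thesis unfolding quot_top_def by (simp add: topology_inverse')
qed

lemma topspace_quot: "topspace quot_top = cls ` points R"
proof -
  have "{x \<in> points R. cls x \<in> cls ` points R} = points R" by blast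
  then have "openin quot_top (cls ` points R)" unfolding openin_quot by simp
  then show ?thesis using openin_quot openin_subset by (metis openin_topspace subset_antisym)
qed

lemma quotient_map_cls: "quotient_map (surf_top R) quot_top cls"
  unfolding quotient_map_def topspace_quot using openin_quot by blast

lemma continuous_cls: "continuous_map (surf_top R) quot_top cls"
  by (rule quotient_imp_continuous_map[OF quotient_map_cls])

text \<open>\<open>xi\<close> is an open map on each sheet. So near a point equivalent to
  \<open>u\<close> every value of \<open>xi\<close> is also taken by points of \<open>N\<close> near
  \<open>u\<close>, and points with equal values are equivalent.\<close>

lemma open_map_cls: assumes N: "openin (surf_top R) N" shows "openin quot_top (cls ` N)"
  unfolding openin_quot
proof
  have sub: "N \<subseteq> points R" by (rule openin_subset[OF N])
  then show "cls ` N \<subseteq> cls ` points R" by blast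
  show "openin (surf_top R) {x \<in> points R. cls x \<in> cls ` N}"
    unfolding openin_subopen[of _ "{x \<in> points R. cls x \<in> cls ` N}"]
  proof
    fix x assume "x \<in> {x \<in> points R. cls x \<in> cls ` N}"
    then obtain u where x: "x \<in> points R" and u: "u \<in> N" "eqv x u" using cls_eq_iff by auto
    have uR: "u \<in> points R" using u sub by blast
    let ?M = "{v \<in> U x. xi x v \<in> xi u ` (N \<inter> U u)}"
    have "openin (surf_top R) ?M" by (rule openin_xi_preimage[OF x open_xi_image[OF uR N]])
    moreover have "x \<in> ?M"
      using U(2)[OF x] U(2)[OF uR] u(1) xi_center[OF x] xi_center[OF uR] by (auto simp: image_iff)
    moreover have "?M \<subseteq> {x \<in> points R. cls x \<in> cls ` N}"
    proof
      fix v assume "v \<in> ?M"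
      then obtain w where v: "v \<in> U x" and w: "w \<in> N" "w \<in> U u" "xi x v = xi u w" by auto
      have "f (p x) = f (p u)" using u(2) by (simp add: eqv_iff_om)
      then have "eqv v w" using eqv_iff[OF x uR _ v w(2)] u(2) w(3) by blast
      then show "v \<in> {x \<in> points R. cls x \<in> cls ` N}" using cls_eq_iff eqv_points(1) w(1) by blast
    qed
    ultimately show "\<exists>T. openin (surf_top R) T \<and> x \<in> T \<and> T \<subseteq> {x \<in> points R. cls x \<in> cls ` N}" by blast
  qed
qed

definition W :: "'a \<Rightarrow> 'a set set" where "W x = cls ` U x"

text \<open>The choice is harmless: members of one class in \<open>U x\<close> have the same
  \<open>xi x\<close>, by \<open>eqv_iff\<close>.\<close>

definition Xi :: "'a \<Rightarrow> 'a set \<Rightarrow> complex" where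
  "Xi x s = xi x (SOME u. u \<in> U x \<and> cls u = s)"

lemma Xi_cls:
  assumes e: "eqv x x'" and u: "u \<in> U x'"
  shows "cls u \<in> W x" "Xi x (cls u) = xi x' u"
proof -
  note x = eqv_points[OF e]
  obtain v where v: "v \<in> U x" "xi x v = xi x' u" "eqv v u" by (rule eqv_partner[OF e u])
  then have "cls v = cls u" using cls_eq_iff eqv_points by blast
  then show "cls u \<in> W x" using v(1) unfolding W_def by (metis image_eqI)
  let ?w = "SOME w. w \<in> U x \<and> cls w = cls u"
  have w: "?w \<in> U x \<and> cls ?w = cls u" by (rule someI[of _ v]) (use v(1) \<open>cls v = cls u\<close> in blast)
  then have "eqv ?w u" using cls_eq_iff U_points[OF x(1)] by blast
  moreover have "f (p x) = f (p x')" using e by (simp add: eqv_iff_om)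
  ultimately have "xi x ?w = xi x' u" using eqv_iff[OF x _ _ u] w by blast
  then show "Xi x (cls u) = xi x' u" by (simp add: Xi_def)
qed

lemma W_E:
  assumes "x \<in> points R" "s \<in> W x" obtains u where "u \<in> U x" "s = cls u" "Xi x s = xi x u"
  using assms Xi_cls(2)[OF eqv_refl[OF assms(1)]] unfolding W_def by blast

lemma cls_in_W_iff:
  assumes "x \<in> points R" "u \<in> points R" shows "cls u \<in> W x \<longleftrightarrow> (\<exists>x'. eqv x x' \<and> u \<in> U x')"
proof
  assume "cls u \<in> W x"
  then obtain v where "v \<in> U x" "cls u = cls v" unfolding W_def by blast
  then show "\<exists>x'. eqv x x' \<and> u \<in> U x'" using eqv_sheet[OF assms(1)] cls_eq_iff assms(2) by metis
qed (use Xi_cls in blast)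

lemma W_eq:
  assumes "eqv x x'" shows "W x = W x'" "\<And>s. s \<in> W x \<Longrightarrow> Xi x s = Xi x' s"
proof -
  have "W y' \<subseteq> W y" if "eqv y y'" for y y' using Xi_cls(1)[OF that] unfolding W_def by blast
  then show "W x = W x'" using assms eqv_sym by blast
  fix s assume "s \<in> W x"
  then obtain u where "u \<in> U x'" "s = cls u" using \<open>W x = W x'\<close> unfolding W_def by blast
  then show "Xi x s = Xi x' s" using Xi_cls(2)[OF assms] Xi_cls(2)[OF eqv_refl] eqv_points[OF assms] by metis
qed

lemma W_overlap:
  assumes "x \<in> points R" "x' \<in> points R" "f (p x) = f (p x')" "W x \<inter> W x' \<noteq> {}" shows "eqv x x'"
proof -
  obtain u u' where "u \<in> U x" "u' \<in> U x'" "cls u = cls u'" using assms(4) unfolding W_def by blast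
  then show ?thesis using eqv_iff[OF assms(1,2,3)] cls_eq_iff U_points[OF assms(1)] by blast
qed

lemma openin_W: "x \<in> points R \<Longrightarrow> openin quot_top (W x)"
  unfolding W_def using open_map_cls U(1) disk_chart_props(1) by blast

lemma Xi_props:
  assumes x: "x \<in> points R"
  shows "inj_on (Xi x) (W x)" "Xi x ` W x = ball 0 1"
    "\<And>D. open D \<Longrightarrow> openin quot_top {s \<in> W x. Xi x s \<in> D}"
    "\<And>N. openin quot_top N \<Longrightarrow> open (Xi x ` (N \<inter> W x))"
    "homeomorphic_map (subtopology quot_top (W x)) (top_of_set (ball 0 1)) (Xi x)"
proof -
  note X = Xi_cls(2)[OF eqv_refl[OF x]]
  show inj: "inj_on (Xi x) (W x)"
  proof (rule inj_onI)
    fix s s' assume s: "s \<in> W x" "s' \<in> W x" "Xi x s = Xi x s'"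
    obtain u where u: "u \<in> U x" "s = cls u" "Xi x s = xi x u" by (rule W_E[OF x s(1)])
    obtain u' where u': "u' \<in> U x" "s' = cls u'" "Xi x s' = xi x u'" by (rule W_E[OF x s(2)])
    have "eqv u u'" using eqv_iff[OF x x refl u(1) u'(1)] eqv_refl[OF x] s(3) u u' by simp
    then show "s = s'" using u(2) u'(2) cls_eq_iff eqv_points by blast
  qed
  have "Xi x ` W x = xi x ` U x" unfolding W_def image_image using X by (rule image_cong[OF refl])
  then show im: "Xi x ` W x = ball 0 1" using xi_image[OF x] by simp
  show pre: "openin quot_top {s \<in> W x. Xi x s \<in> D}" if D: "open D" for D
  proof -
    have "{s \<in> W x. Xi x s \<in> D} = cls ` {u \<in> U x. xi x u \<in> D}" unfolding W_def using X by auto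
    then show ?thesis using open_map_cls[OF openin_xi_preimage[OF x D]] by simp
  qed
  show op: "open (Xi x ` (N \<inter> W x))" if N: "openin quot_top N" for N
  proof -
    have "Xi x ` (N \<inter> W x) = xi x ` ({u \<in> points R. cls u \<in> N} \<inter> U x)"
    proof (intro equalityI subsetI)
      fix z assume "z \<in> Xi x ` (N \<inter> W x)"
      then obtain s where s: "s \<in> N" "s \<in> W x" "z = Xi x s" by blast
      obtain u where u: "u \<in> U x" "s = cls u" "Xi x s = xi x u" by (rule W_E[OF x s(2)])
      then show "z \<in> xi x ` ({u \<in> points R. cls u \<in> N} \<inter> U x)" using s U_points[OF x] by blast
    next
      fix z assume "z \<in> xi x ` ({u \<in> points R. cls u \<in> N} \<inter> U x)"
      then obtain u where u: "u \<in> U x" "cls u \<in> N" "z = xi x u" by blast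
      then have "cls u \<in> N \<inter> W x" "z = Xi x (cls u)" using X unfolding W_def by auto
      then show "z \<in> Xi x ` (N \<inter> W x)" by blast
    qed
    moreover have "openin (surf_top R) {u \<in> points R. cls u \<in> N}" using N openin_quot by blast
    ultimately show ?thesis using open_xi_image[OF x] by simp
  qed
  have top: "topspace (subtopology quot_top (W x)) = W x"
    using openin_subset[OF openin_W[OF x]] by (simp add: inf.absorb2)
  show "homeomorphic_map (subtopology quot_top (W x)) (top_of_set (ball 0 1)) (Xi x)"
  proof (rule bijective_open_imp_homeomorphic_map)
    have "continuous_map (subtopology quot_top (W x)) euclidean (Xi x)"
      unfolding continuous_map_def
    proof (intro conjI allI impI)
      fix D :: "complex set" assume "openin euclidean D"
      then have D: "open D" by simp
      have "{s \<in> topspace (subtopology quot_top (W x)). Xi x s \<in> D} = {s \<in> W x. Xi x s \<in> D} \<inter> W x"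
        unfolding top by blast
      then show "openin (subtopology quot_top (W x)) {s \<in> topspace (subtopology quot_top (W x)). Xi x s \<in> D}"
        using openin_subtopology_Int[OF pre[OF D], of "W x"] by simp
    qed simp
    then show "continuous_map (subtopology quot_top (W x)) (top_of_set (ball 0 1)) (Xi x)"
      using im top by (auto simp: continuous_map_in_subtopology)
    show "open_map (subtopology quot_top (W x)) (top_of_set (ball 0 1)) (Xi x)"
      unfolding open_map_def
    proof (intro allI impI)
      fix N assume "openin (subtopology quot_top (W x)) N"
      then have N: "openin quot_top N" "N \<subseteq> W x"
        using openin_W[OF x] openin_trans_full openin_imp_subset by blast+
      then have "open (Xi x ` N)" using op[OF N(1)] by (simp add: inf.absorb1)
      moreover have "Xi x ` N \<subseteq> ball 0 1" using N(2) im by blast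
      ultimately show "openin (top_of_set (ball 0 1)) (Xi x ` N)" by (simp add: openin_open_eq)
    qed
  qed (use inj im top in auto)
qed

end

section \<open>Orientation of the quotient atlas\<close>

context charted_square begin

text \<open>Away from the centre of one of the two charts the quotient map is locally injective, so both
  charts pull back to oriented local coordinates of \<open>R\<close> there.\<close>

lemma oriented_Xi_off_center:
  assumes x: "x \<in> points R" and v: "v \<in> points R" "cls v \<in> W x" "cls v \<noteq> cls x"
  shows "oriented_at R (Xi x \<circ> cls) v" "\<exists>N. openin (surf_top R) N \<and> v \<in> N \<and> inj_on cls N"
proof -
  obtain x' where x': "eqv x x'" "v \<in> U x'" using v cls_in_W_iff[OF x v(1)] by blast
  note xR' = eqv_points(2)[OF x'(1)]
  have "v \<noteq> x'" using v(3) x'(1) cls_eq_iff[OF x] by metis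
  then have "xi x' v \<noteq> 0" using xi_eq_0_iff[OF xR' x'(2)] by blast
  then have nz: "\<phi> x' v \<noteq> 0" unfolding xi_def using degrees(3)[OF xR'] by (metis power_0_left not_one_le_zero)
  note op = orientation_preserving_at_power[OF nz degrees(3)[OF xR']]
  have "oriented_at R ((\<lambda>z. z ^ common_deg x') \<circ> \<phi> x') v"
    by (rule oriented_at_compose[OF is_surface_atlas[OF surfaces(1)]
        disk_chart_oriented[OF surfaces(1) U(1)[OF xR'] x'(2)] op])
  then show "oriented_at R (Xi x \<circ> cls) v"
    by (rule oriented_at_cong[OF is_surface_atlas[OF surfaces(1)] _ disk_chart_props(1)[OF U(1)[OF xR']] x'(2)])
      (simp add: Xi_cls(2)[OF x'(1)] xi_def)
  obtain r where r: "r > 0" "inj_on (\<lambda>z. z ^ common_deg x') (ball (\<phi> x' v) r)"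
    using op unfolding orientation_preserving_at_def by blast
  let ?N = "{u \<in> U x'. \<phi> x' u \<in> ball (\<phi> x' v) r}"
  have "inj_on cls ?N"
  proof (rule inj_onI)
    fix a b assume ab: "a \<in> ?N" "b \<in> ?N" "cls a = cls b"
    have "xi x' a = xi x' b" using Xi_cls(2)[OF x'(1)] ab by (metis (mono_tags, lifting) mem_Collect_eq)
    then have "\<phi> x' a = \<phi> x' b" using r(2) ab(1,2) unfolding xi_def by (auto dest: inj_onD)
    then show "a = b" using disk_chart_props(3)[OF U(1)[OF xR']] ab(1,2) by (auto dest: inj_onD)
  qed
  moreover have "openin (surf_top R) ?N" by (rule disk_chart_props(7)[OF U(1)[OF xR']]) simp
  ultimately show "\<exists>N. openin (surf_top R) N \<and> v \<in> N \<and> inj_on cls N" using x'(2) r(1) by (intro exI[of _ ?N]) auto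
qed

text \<open>If \<open>common_deg v\<close> exceeded 1, that many distinct points near
  \<open>v\<close> would share \<open>xi v\<close> and thus their class. So injectivity of
  \<open>cls\<close> makes \<open>xi v\<close> the sheet coordinate itself, which is
  oriented.\<close>

lemma oriented_Xi_center:
  assumes x: "x \<in> points R" and v: "v \<in> points R" "cls v = cls x"
    and N: "openin (surf_top R) N" "v \<in> N" "inj_on cls N"
  shows "oriented_at R (Xi x \<circ> cls) v"
proof -
  have e: "eqv x v" using cls_eq_iff[OF x] v(2) by metis
  obtain c S where S: "S \<subseteq> N \<inter> U v" "card S = common_deg v" "finite S" "\<And>a. a \<in> S \<Longrightarrow> \<phi> v a ^ common_deg v = c"
    by (rule small_root_preimages[OF U(1,2,3)[OF v(1)] N(1,2) degrees(3)[OF v(1)]]) blast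
  have "a = b" if ab: "a \<in> S" "b \<in> S" for a b
  proof -
    have U: "a \<in> U v" "b \<in> U v" using S(1) ab by auto
    have "xi v a = xi v b" unfolding xi_def using S(4) ab by simp
    then have "eqv a b" using eqv_iff[OF v(1) v(1) refl U] eqv_refl[OF v(1)] by blast
    then have "cls a = cls b" using cls_eq_iff eqv_points by blast
    then show ?thesis using N(3) S(1) ab by (auto dest: inj_onD)
  qed
  then have "card S \<le> 1" using S(3) by (simp add: card_le_Suc0_iff_eq)
  then have m: "common_deg v = 1" using S(2) degrees(3)[OF v(1)] by simp
  show ?thesis
    by (rule oriented_at_cong[OF is_surface_atlas[OF surfaces(1)]
        disk_chart_oriented[OF surfaces(1) U(1)[OF v(1)] U(2)[OF v(1)]]
        disk_chart_props(1)[OF U(1)[OF v(1)]] U(2)[OF v(1)]])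
      (simp only: comp_def Xi_cls(2)[OF e] xi_def m power_one_right)
qed

text \<open>A class is the centre of at most one of the two charts. If it is that of
  \<open>x\<close>, it is off-centre for \<open>x'\<close>, which supplies local injectivity of
  \<open>cls\<close>.\<close>

lemma oriented_Xi:
  assumes x: "x \<in> points R" "x' \<in> points R" and v: "v \<in> points R" "cls v \<in> W x" "cls v \<in> W x'"
    and ne: "cls x \<noteq> cls x'"
  shows "oriented_at R (Xi x \<circ> cls) v"
proof (cases "cls v = cls x")
  case True
  then have "cls v \<noteq> cls x'" using ne by simp
  then obtain N where "openin (surf_top R) N" "v \<in> N" "inj_on cls N"
    using oriented_Xi_off_center(2)[OF x(2) v(1,3)] by blast
  then show ?thesis by (rule oriented_Xi_center[OF x(1) v(1) True])
qed (use oriented_Xi_off_center(1)[OF x(1) v(1,2)] in blast)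

text \<open>Equal classes have equal charts, and the transition is the identity. Otherwise it is
  tested at a preimage \<open>v\<close>, where both pullbacks are oriented coordinates of
  \<open>R\<close>.\<close>

lemma Xi_transition:
  assumes x: "x \<in> points R" "x' \<in> points R"
  shows "orientation_preserving_on (Xi x' ` (W x \<inter> W x')) (Xi x \<circ> inv_into (W x') (Xi x'))"
proof -
  let ?D = "Xi x' ` (W x \<inter> W x')" and ?k = "Xi x \<circ> inv_into (W x') (Xi x')"
  note X = Xi_props[OF x(1)] and X' = Xi_props[OF x(2)]
  have inv: "inv_into (W x') (Xi x') (Xi x' s) = s" if "s \<in> W x'" for s using X'(1) that by simp
  have oD: "open ?D" using X'(4)[OF openin_W[OF x(1)]] .
  have c: "continuous_on ?D ?k"
    unfolding continuous_on_open_vimage[OF oD]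
  proof (intro allI impI)
    fix D :: "complex set" assume "open D"
    have "?k -` D \<inter> ?D = Xi x' ` ({s \<in> W x. Xi x s \<in> D} \<inter> W x')" using inv by force
    then show "open (?k -` D \<inter> ?D)" using X'(4)[OF X(3)[OF \<open>open D\<close>]] by simp
  qed
  have i: "inj_on ?k ?D"
  proof (rule inj_onI)
    fix a b assume ab: "a \<in> ?D" "b \<in> ?D" "?k a = ?k b"
    then obtain s s' where s: "s \<in> W x \<inter> W x'" "s' \<in> W x \<inter> W x'" "a = Xi x' s" "b = Xi x' s'" by blast
    then have "Xi x s = Xi x s'" using ab(3) inv by simp
    then show "a = b" using s X(1) by (auto dest: inj_onD)
  qed
  have "orientation_preserving_at ?k z" if z: "z \<in> ?D" for z
  proof -
    obtain s where s: "s \<in> W x" "s \<in> W x'" "z = Xi x' s" using z by blast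
    obtain v where v: "v \<in> U x" "s = cls v" by (rule W_E[OF x(1) s(1)]) blast
    have vR: "v \<in> points R" using v U_points[OF x(1)] by blast
    obtain e where e: "e > 0" "ball z e \<subseteq> ?D" using oD z open_contains_ball by blast
    show ?thesis
    proof (cases "cls x = cls x'")
      case True
      then have "eqv x x'" using cls_eq_iff[OF x(1)] by blast
      note E = W_eq[OF this]
      have "?k w = w" if w: "w \<in> ?D" for w
      proof -
        obtain s' where "s' \<in> W x'" "w = Xi x' s'" using w by blast
        then show ?thesis using inv E by simp
      qed
      then show ?thesis
        using orientation_preserving_at_cong[OF orientation_preserving_at_id oD z, of ?k] by metis
    next
      case False
      have 1: "oriented_at R (Xi x' \<circ> cls) v"
        by (rule oriented_Xi[OF x(2,1) vR]) (use s v False in auto)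
      have 2: "oriented_at R (Xi x \<circ> cls) v"
        by (rule oriented_Xi[OF x vR]) (use s v False in auto)
      let ?N = "{u \<in> points R. cls u \<in> W x \<inter> W x'}"
      have "openin (surf_top R) ?N"
        by (rule openin_continuous_map_preimage[OF continuous_cls openin_Int[OF openin_W[OF x(1)] openin_W[OF x(2)]]])
      then have "oriented_at R (?k \<circ> (Xi x' \<circ> cls)) v"
        by (rule oriented_at_cong[OF is_surface_atlas[OF surfaces(1)] 2]) (use s v vR inv in auto)
      then have "orientation_preserving_at ?k ((Xi x' \<circ> cls) v)"
        by (rule oriented_at_cancel_right[OF is_surface_atlas[OF surfaces(1)] vR 1])
          (use continuous_on_subset[OF c e(2)] inj_on_subset[OF i e(2)] e(1) s(3) v(2) in auto)
      then show ?thesis using s(3) v(2) by simp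
    qed
  qed
  then show ?thesis using orientation_preserving_on_iff_at[OF oD c i] by blast
qed

definition quot :: "'a set surface" where
  "quot = \<lparr>surf_top = quot_top, surf_atlas = (\<lambda>x. (W x, Xi x)) ` points R\<rparr>"

lemma quot_simps: "surf_top quot = quot_top" "points quot = cls ` points R"
  "surf_atlas quot = (\<lambda>x. (W x, Xi x)) ` points R"
  by (simp_all add: quot_def topspace_quot)

lemma cls_in_W: "x \<in> points R \<Longrightarrow> cls x \<in> W x"
  unfolding W_def using U(2) by blast

lemma W_subset: "x \<in> points R \<Longrightarrow> W x \<subseteq> cls ` points R"
  using openin_subset[OF openin_W] topspace_quot by metis

lemma quot_atlas: "oriented_atlas (surf_top quot) (surf_atlas quot)"
  unfolding oriented_atlas_def
proof (intro conjI)
  have "(\<Union>(U, \<phi>)\<in>surf_atlas quot. U) = (\<Union>x\<in>points R. W x)" by (simp add: quot_simps)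
  also have "\<dots> = cls ` points R" using W_subset cls_in_W by blast
  finally show "(\<Union>(U, \<phi>)\<in>surf_atlas quot. U) = points quot" by (simp only: quot_simps topspace_quot)
  show "\<forall>(U, \<phi>)\<in>surf_atlas quot. openin (surf_top quot) U \<and> open (\<phi> ` U) \<and>
      homeomorphic_map (subtopology (surf_top quot) U) (top_of_set (\<phi> ` U)) \<phi>"
    using openin_W Xi_props(2,5) by (auto simp: quot_simps)
  show "\<forall>(U, \<phi>)\<in>surf_atlas quot. \<forall>(W, \<theta>)\<in>surf_atlas quot.
      orientation_preserving_on (\<theta> ` (U \<inter> W)) (\<phi> \<circ> inv_into W \<theta>)"
    using Xi_transition by (auto simp: quot_simps)
qed

lemma disk_chart_Xi: "x \<in> points R \<Longrightarrow> disk_chart quot (W x) (Xi x)"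
  unfolding disk_chart_def using openin_W Xi_props(5) Xi_transition by (auto simp: quot_simps)

section \<open>The factor maps and the degree of the quotient map\<close>

definition on_quot :: "('a \<Rightarrow> 'e) \<Rightarrow> 'a set \<Rightarrow> 'e" where "on_quot F s = F (SOME x. x \<in> s)"

lemma on_quot_cls:
  assumes "x \<in> points R" "\<And>u v. eqv u v \<Longrightarrow> F u = F v" shows "on_quot F (cls x) = F x"
proof -
  have "(SOME u. u \<in> cls x) \<in> cls x" by (rule someI[of _ x]) (simp add: cls_def eqv_refl[OF assms(1)])
  then show ?thesis unfolding on_quot_def using assms(2) by (simp add: cls_def)
qed

abbreviation "p' \<equiv> on_quot p"
abbreviation "q' \<equiv> on_quot q"

lemma p'_cls: "x \<in> points R \<Longrightarrow> p' (cls x) = p x"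
  by (rule on_quot_cls) (simp_all add: eqv_iff_om)

lemma q'_cls: "x \<in> points R \<Longrightarrow> q' (cls x) = q x"
  by (rule on_quot_cls) (simp_all add: eqv_iff_om)

lemma continuous_p': "continuous_map quot_top (surf_top C1) p'"
proof (rule continuous_compose_quotient_map[OF quotient_map_cls])
  show "continuous_map (surf_top R) (surf_top C1) (p' \<circ> cls)"
    by (rule continuous_map_eq[OF branched_covering_surfaces(3)[OF p]]) (simp add: p'_cls)
qed

lemma continuous_q': "continuous_map quot_top (surf_top C2) q'"
proof (rule continuous_compose_quotient_map[OF quotient_map_cls])
  show "continuous_map (surf_top R) (surf_top C2) (q' \<circ> cls)"
    by (rule continuous_map_eq[OF branched_covering_surfaces(3)[OF q]]) (simp add: q'_cls)
qed

text \<open>Classes that \<open>p\<close> or \<open>q\<close> tells apart are separated in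
  \<open>C1\<close> or \<open>C2\<close>. The remaining ones are centres over the same base point,
  and their disks are disjoint by \<open>W_overlap\<close>.\<close>

lemma Hausdorff_quot: "Hausdorff_space quot_top"
  unfolding Hausdorff_space_def
proof (intro allI impI)
  fix s s' assume s: "s \<in> topspace quot_top \<and> s' \<in> topspace quot_top \<and> s \<noteq> s'"
  then obtain x x' where x: "x \<in> points R" "x' \<in> points R" "s = cls x" "s' = cls x'"
    by (auto simp: topspace_quot)
  have sep: "\<exists>G H. openin quot_top G \<and> openin quot_top H \<and> s \<in> G \<and> s' \<in> H \<and> disjnt G H"
    if F: "continuous_map quot_top Y F" "Hausdorff_space Y" "F s \<noteq> F s'" for Y and F :: "'a set \<Rightarrow> 'e"
  proof -
    have "F s \<in> topspace Y" "F s' \<in> topspace Y"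
      using continuous_map_image_subset_topspace[OF F(1)] s by blast+
    then obtain G H where GH: "openin Y G" "openin Y H" "F s \<in> G" "F s' \<in> H" "disjnt G H"
      using F(2,3) unfolding Hausdorff_space_def by metis
    let ?G = "{t \<in> topspace quot_top. F t \<in> G}" and ?H = "{t \<in> topspace quot_top. F t \<in> H}"
    have "openin quot_top ?G" "openin quot_top ?H"
      using GH(1,2) by (simp_all add: openin_continuous_map_preimage[OF F(1)])
    moreover have "disjnt ?G ?H" using GH(5) by (auto simp: disjnt_def)
    moreover have "s \<in> ?G" "s' \<in> ?H" using s GH(3,4) by auto
    ultimately show ?thesis by blast
  qed
  have H: "Hausdorff_space (surf_top C1)" "Hausdorff_space (surf_top C2)"
    using surfaces(2,3) unfolding is_surface_def by auto
  show "\<exists>G H. openin quot_top G \<and> openin quot_top H \<and> s \<in> G \<and> s' \<in> H \<and> disjnt G H"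
  proof (cases "p x = p x' \<and> q x = q x'")
    case False
    then have "p' s \<noteq> p' s' \<or> q' s \<noteq> q' s'" using x p'_cls q'_cls by simp
    then show ?thesis using sep[OF continuous_p' H(1)] sep[OF continuous_q' H(2)] by blast
  next
    case True
    have "\<not> eqv x x'" using s x cls_eq_iff[OF x(1)] by blast
    then have "W x \<inter> W x' = {}" using W_overlap[OF x(1,2)] True by auto
    then show ?thesis
      by (intro exI[of _ "W x"] exI[of _ "W x'"]) (simp add: openin_W x cls_in_W disjnt_def)
  qed
qed

lemma closed_surface_quot: "closed_surface quot"
  unfolding closed_surface_def is_surface_def quot_simps(1)
proof (intro conjI)
  have R: "points R \<noteq> {}" "connected_space (surf_top R)" "second_countable (surf_top R)"
    using surfaces(1) unfolding is_surface_def by auto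
  show "topspace quot_top \<noteq> {}" using R(1) by (simp add: topspace_quot)
  have onto: "cls ` points R = topspace quot_top" by (simp add: topspace_quot)
  show "connected_space quot_top"
    using connected_space_quotient_map_image[OF quotient_map_cls R(2)] .
  show "second_countable quot_top"
    by (rule second_countable_open_map_image[OF continuous_cls _ onto R(3)])
      (simp add: open_map_def open_map_cls)
  show "compact_space quot_top"
    using image_compactin[of "surf_top R" "points R" quot_top cls] continuous_cls surfaces(5) onto
    unfolding compact_space_def by simp
qed (use Hausdorff_quot quot_atlas quot_simps(1) in auto)

lemma surface_quot: "is_surface quot"
  using closed_surface_quot unfolding closed_surface_def by blast

lemma cls_sheet:
  assumes "eqv x x'" shows "branched_sheet R quot cls (U x') x' (W x) (cls x') (common_deg x')"
proof -
  note xR = eqv_points[OF assms]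
  have "cls x' = cls x" using assms cls_eq_iff[OF xR(1)] by metis
  show ?thesis
  proof (rule branched_sheetI[OF U(1,2,3)[OF xR(2)] disk_chart_Xi[OF xR(1)]
        Xi_cls(1)[OF assms U(2)[OF xR(2)]] _ _ _ degrees(3)[OF xR(2)]])
    show "Xi x (cls x') = 0" using Xi_cls(2)[OF assms U(2)[OF xR(2)]] xi_center[OF xR(2)] by simp
    show "cls u \<in> W x" "Xi x (cls u) = \<phi> x' u ^ common_deg x'" if "u \<in> U x'" for u
      using Xi_cls[OF assms that] by (simp_all only: xi_def)
  qed
qed

lemma branched_covering_cls: "branched_covering R quot cls"
  unfolding branched_covering_def quot_simps topspace_quot
proof (intro conjI ballI surfaces(1) surface_quot continuous_cls)
  fix s assume "s \<in> cls ` points R"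
  then obtain x where x: "x \<in> points R" "s = cls x" by blast
  let ?\<U> = "U ` {x'. eqv x x'}"
  have "disjoint ?\<U>"
  proof (rule disjointI)
    fix G H assume "G \<in> ?\<U>" "H \<in> ?\<U>" "G \<noteq> H"
    then obtain u v where uv: "eqv x u" "eqv x v" "G = U u" "H = U v" "u \<noteq> v" by auto
    then have "f (p u) = f (p v)" by (simp add: eqv_iff_om)
    then show "G \<inter> H = {}" using U_disjoint uv eqv_points by metis
  qed
  moreover have "\<Union>?\<U> = {u \<in> points R. cls u \<in> W x}"
  proof (intro equalityI subsetI)
    fix u assume "u \<in> \<Union>?\<U>"
    then obtain x' where x': "eqv x x'" "u \<in> U x'" by blast
    then show "u \<in> {u \<in> points R. cls u \<in> W x}"
      using Xi_cls(1)[OF x'] U_points[OF eqv_points(2)[OF x'(1)]] by simp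
  next
    fix u assume "u \<in> {u \<in> points R. cls u \<in> W x}"
    then show "u \<in> \<Union>?\<U>" using cls_in_W_iff[OF x(1)] by auto
  qed
  moreover have "\<exists>x' d. branched_sheet R quot cls G x' (W x) s d" if G: "G \<in> ?\<U>" for G
  proof -
    obtain x' where x': "eqv x x'" "G = U x'" using G by blast
    moreover have "cls x' = s" using x x'(1) cls_eq_iff by blast
    ultimately show ?thesis using cls_sheet[OF x'(1)] by metis
  qed
  moreover have "?\<U> \<noteq> {}" using eqv_refl[OF x(1)] by blast
  ultimately show "\<exists>V \<U>. openin quot_top V \<and> s \<in> V \<and> \<U> \<noteq> {} \<and> disjoint \<U> \<and>
      \<Union>\<U> = {u \<in> points R. cls u \<in> V} \<and> (\<forall>G\<in>\<U>. \<exists>x' d. branched_sheet R quot cls G x' V s d)"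
    using openin_W[OF x(1)] cls_in_W[OF x(1)] x(2)
    by (intro exI[of _ "W x"] exI[of _ ?\<U>] conjI ballI) simp_all
qed

lemma disjoint_W:
  assumes "\<And>x. x \<in> X \<Longrightarrow> x \<in> points R \<and> f (p x) = y" shows "disjoint (W ` X)"
proof (rule disjointI)
  fix G H assume "G \<in> W ` X" "H \<in> W ` X" "G \<noteq> H"
  then obtain u v where uv: "u \<in> X" "v \<in> X" "G = W u" "H = W v" by auto
  show "G \<inter> H = {}"
  proof (rule ccontr)
    assume "G \<inter> H \<noteq> {}"
    then have "eqv u v" using W_overlap assms uv by metis
    then show False using W_eq(1) uv \<open>G \<noteq> H\<close> by blast
  qed
qed

lemma W_cover:
  assumes F: "\<And>x. x \<in> points R \<Longrightarrow> F' (cls x) = F x"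
    and X: "\<And>u. u \<in> points R \<Longrightarrow> F u \<in> G \<longleftrightarrow> (\<exists>x\<in>X. u \<in> U x)" "X \<subseteq> points R"
  shows "\<Union>(W ` X) = {s \<in> cls ` points R. F' s \<in> G}"
proof (intro equalityI subsetI)
  fix s assume "s \<in> \<Union>(W ` X)"
  then obtain x u where xu: "x \<in> X" "u \<in> U x" "s = cls u" unfolding W_def by blast
  then have u: "u \<in> points R" using X(2) U_points by blast
  then have "F u \<in> G" using X(1) xu by blast
  then show "s \<in> {s \<in> cls ` points R. F' s \<in> G}" using F[OF u] u xu(3) by simp
next
  fix s assume "s \<in> {s \<in> cls ` points R. F' s \<in> G}"
  then obtain u where u: "u \<in> points R" "s = cls u" "F' s \<in> G" by blast
  then obtain x where "x \<in> X" "u \<in> U x" using F X(1) by metis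
  then show "s \<in> \<Union>(W ` X)" using u(2) unfolding W_def by blast
qed

text \<open>Common to \<open>p\<close> and \<open>q\<close>: over \<open>z\<close> the sheets are
  the disks \<open>W x\<close> with \<open>F x = z\<close>, equivalent points giving the same disk.
  The target coordinate \<open>\<theta> x\<close> may depend on the sheet.\<close>

lemma branched_covering_factor:
  fixes D :: "'e surface"
  assumes D: "is_surface D" "continuous_map quot_top (surf_top D) F'"
    and F: "\<And>x. x \<in> points R \<Longrightarrow> F' (cls x) = F x" and surj: "points D \<subseteq> F ` points R"
    and h: "\<And>x. x \<in> points R \<Longrightarrow> f (p x) = k (F x)"
    and N: "\<And>z. z \<in> points D \<Longrightarrow> openin (surf_top D) (N z)" "\<And>z. z \<in> points D \<Longrightarrow> z \<in> N z"
    and cover: "\<And>z u. z \<in> points D \<Longrightarrow> u \<in> points R \<Longrightarrow>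
      F u \<in> N z \<longleftrightarrow> (\<exists>x\<in>{x \<in> points R. F x = z}. u \<in> U x)"
    and sheet: "\<And>x. x \<in> points R \<Longrightarrow> disk_chart D (N (F x)) (\<theta> x)" "\<And>x. x \<in> points R \<Longrightarrow> \<theta> x (F x) = 0"
      "\<And>x. x \<in> points R \<Longrightarrow> 1 \<le> e x"
      "\<And>x u. x \<in> points R \<Longrightarrow> u \<in> U x \<Longrightarrow> \<theta> x (F u) = xi x u ^ e x"
  shows "branched_covering quot D F'"
  unfolding branched_covering_def quot_simps topspace_quot
proof (intro conjI ballI D surface_quot)
  fix z assume z: "z \<in> points D"
  let ?X = "{x \<in> points R. F x = z}"
  have "disjoint (W ` ?X)" by (rule disjoint_W[of _ "k z"]) (use h in auto)
  moreover have "\<Union>(W ` ?X) = {s \<in> cls ` points R. F' s \<in> N z}"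
    by (rule W_cover[where F = F, OF F cover[OF z]]) auto
  moreover have "\<exists>s d. branched_sheet quot D F' G s (N z) z d" if G: "G \<in> W ` ?X" for G
  proof -
    obtain x where x: "x \<in> points R" "F x = z" "G = W x" using G by blast
    have "branched_sheet quot D F' (W x) (cls x) (N z) z (e x)"
    proof (rule branched_sheetI[OF disk_chart_Xi[OF x(1)] cls_in_W[OF x(1)] _ sheet(1)[OF x(1), unfolded x(2)]
          N(2)[OF z] _ _ _ sheet(3)[OF x(1)]])
      show "Xi x (cls x) = 0" using Xi_cls(2)[OF eqv_refl U(2)] xi_center x(1) by simp
      show "\<theta> x z = 0" using sheet(2)[OF x(1)] x(2) by simp
      fix s assume "s \<in> W x"
      then obtain u where u: "u \<in> U x" "s = cls u" "Xi x s = xi x u" by (rule W_E[OF x(1)])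
      have uR: "u \<in> points R" by (rule U_points[OF x(1) u(1)])
      have Fs: "F' s = F u" using u(2) F[OF uR] by simp
      show "F' s \<in> N z" using Fs cover[OF z uR] u(1) x(1,2) by auto
      show "\<theta> x (F' s) = Xi x s ^ e x" using Fs u(3) sheet(4)[OF x(1) u(1)] by simp
    qed
    then show ?thesis using x(3) by blast
  qed
  moreover have "W ` ?X \<noteq> {}" using surj z by blast
  ultimately show "\<exists>V \<U>. openin (surf_top D) V \<and> z \<in> V \<and> \<U> \<noteq> {} \<and> disjoint \<U> \<and>
      \<Union>\<U> = {s \<in> cls ` points R. F' s \<in> V} \<and> (\<forall>G\<in>\<U>. \<exists>s d. branched_sheet quot D F' G s V z d)"
    using N[OF z] by (intro exI[of _ "N z"] exI[of _ "W ` ?X"] conjI ballI)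
qed

lemma branched_covering_p': "branched_covering quot C1 p'"
proof (rule branched_covering_factor[where F = p and k = f and N = A and \<theta> = "\<lambda>x. \<phi>1 (p x)" and e = al])
  fix z u assume z: "z \<in> points C1" and u: "u \<in> points R"
  show "p u \<in> A z \<longleftrightarrow> (\<exists>x\<in>{x \<in> points R. p x = z}. u \<in> U x)"
  proof
    assume pu: "p u \<in> A z"
    then have "f (p u) \<in> V (f z)" by (rule A(4)[OF z])
    then obtain x where x: "x \<in> points R" "f (p x) = f z" "u \<in> U x"
      by (rule U_cover[OF u f_points[OF z]])
    then have "p x = z" using A(5)[OF p_points[OF x(1)] z x(2)] pu U(8)[OF x(1,3)] by blast
    then show "\<exists>x\<in>{x \<in> points R. p x = z}. u \<in> U x" using x by blast
  qed (use U(8) in blast)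
qed (use A p_points disk_chart_props(1)[OF A(1)] branched_covering_surj[OF p] surfaces continuous_p' p'_cls
    degrees(4) xi_forms(1) in auto)

text \<open>The target coordinate absorbs the factor \<open>om x\<close> and so varies from sheet to
  sheet.\<close>

lemma branched_covering_q': "branched_covering quot C2 q'"
proof (rule branched_covering_factor[where F = q and k = g and N = B
      and \<theta> = "\<lambda>x v. (1 / om x) * \<phi>2 (q x) v" and e = be])
  fix b u assume b: "b \<in> points C2" and u: "u \<in> points R"
  show "q u \<in> B b \<longleftrightarrow> (\<exists>x\<in>{x \<in> points R. q x = b}. u \<in> U x)"
  proof
    assume qu: "q u \<in> B b"
    then have "f (p u) \<in> V (g b)" using B(4)[OF b] comm[OF u] by simp
    then obtain x where x: "x \<in> points R" "f (p x) = g b" "u \<in> U x"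
      by (rule U_cover[OF u branched_covering_surfaces(4)[OF g b]])
    then have "q x = b"
      using B(5)[OF q_points[OF x(1)] b] comm[OF x(1)] qu U(9)[OF x(1,3)] by auto
    then show "\<exists>x\<in>{x \<in> points R. q x = b}. u \<in> U x" using x by blast
  qed (use U(9) in blast)
next
  fix x assume x: "x \<in> points R"
  show "disk_chart C2 (B (q x)) (\<lambda>v. (1 / om x) * \<phi>2 (q x) v)"
    by (rule disk_chart_rotate[OF surfaces(3) B(1)[OF q_points[OF x]]]) (simp add: norm_divide U(4)[OF x])
qed (use B q_points disk_chart_props(1)[OF B(1)] branched_covering_surj[OF q] surfaces continuous_q' q'_cls
    degrees(5) xi_forms(2) om_nz comm in auto)

text \<open>The class of \<open>x\<close> is a fibre of \<open>cls\<close>, with local degrees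
  \<open>common_deg\<close>. These are positive and add up to the degree 1 of \<open>cls\<close>,
  leaving room for a single term equal to 1.\<close>

lemma no_common_factor_imp_injective:
  assumes ncf: "no_common_right_factor R C1 C2 p q" and x: "x \<in> points R"
  shows "common_deg x = 1" "\<And>x'. eqv x x' \<Longrightarrow> x' = x"
proof -
  have deg1: "global_degree R quot cls = 1"
    by (rule no_common_right_factorD[OF ncf closed_surface_quot branched_covering_cls
        branched_covering_p' branched_covering_q']) (simp_all add: p'_cls q'_cls)
  have c: "cls x \<in> points quot" using x by (simp add: quot_simps topspace_quot)
  note br = branched_covering_cls
  have fin: "finite (fiber R cls (cls x))" by (rule finite_fiber[OF br surfaces(5) c])
  have sum: "(\<Sum>u\<in>fiber R cls (cls x). local_degree R quot cls u) = 1"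
    using sum_local_degree[OF br surfaces(5) c] deg1 by simp
  have d: "local_degree R quot cls u = common_deg u" if "eqv x u" for u
    by (rule local_degree_eq[OF cls_sheet[OF that]])
  have xf: "x \<in> fiber R cls (cls x)" using x by (simp add: fiber_def)
  have "local_degree R quot cls x + (\<Sum>u\<in>fiber R cls (cls x) - {x}. local_degree R quot cls u) = 1"
    using sum sum.remove[OF fin xf] by metis
  moreover have "1 \<le> common_deg x" by (rule degrees(3)[OF x])
  ultimately have m: "common_deg x = 1" and rest: "(\<Sum>u\<in>fiber R cls (cls x) - {x}. local_degree R quot cls u) = 0"
    using d[OF eqv_refl[OF x]] by linarith+
  show "common_deg x = 1" by (rule m)
  fix x' assume e: "eqv x x'"
  show "x' = x"
  proof (rule ccontr)
    assume "x' \<noteq> x"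
    then have "x' \<in> fiber R cls (cls x) - {x}"
      using e eqv_points(2)[OF e] cls_eq_iff[OF x] by (auto simp: fiber_def)
    then have "local_degree R quot cls x' = 0" using rest fin by simp
    then show False using d[OF e] degrees(3)[OF eqv_points(2)[OF e]] by simp
  qed
qed

end

section \<open>Counting preimages\<close>

lemma lcm_div_eq:
  fixes a d :: nat assumes "1 \<le> d" shows "lcm a d div d = a div gcd a d"
proof -
  have "lcm a d = a div gcd a d * d"
    by (simp add: lcm_nat_def div_mult_swap dvd_div_mult)
  then show ?thesis using assms by simp
qed

text \<open>Multiplication by \<open>d\<close> commutes with \<open>lcm\<close>, and
  \<open>d\<close> times each entry is \<open>lcm a d\<close>.\<close>

lemma Lcm_lcm_div:
  fixes S :: "nat set" assumes "finite S" "1 \<le> d"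
  shows "Lcm ((\<lambda>a. lcm a d div d) ` S) = lcm (Lcm S) d div d"
  using assms(1)
proof (induction S)
  case empty
  then show ?case using assms(2) by simp
next
  case (insert a S)
  have div: "d * (lcm b d div d) = lcm b d" for b by simp
  have "d * lcm (lcm a d div d) (lcm (Lcm S) d div d) = lcm (lcm a d) (lcm (Lcm S) d)"
    using lcm_mult_left[of d "lcm a d div d" "lcm (Lcm S) d div d"] div by simp
  also have "\<dots> = lcm (lcm a (Lcm S)) d" by (simp add: lcm.assoc lcm.left_commute lcm.commute)
  finally have "lcm (lcm a d div d) (lcm (Lcm S) d div d) = lcm (lcm a (Lcm S)) d div d"
    using assms(2) by (metis div_mult_self1_is_m not_one_le_zero neq0_conv)
  then show ?case using insert by simp
qed

text \<open>Minimality of \<open>q\<close> in terms of numbers: \<open>a\<close> and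
  \<open>d\<close> are local degrees of \<open>g\<close> and \<open>f\<close>, and \<open>A\<close>
  is the least common multiple of the local degrees in a fibre of \<open>g\<close>. With
  \<open>a = G * a'\<close>, \<open>d = G * d'\<close>, \<open>A = a * B\<close> it becomes
  \<open>B = (B div gcd B d') * gcd d' B\<close>.\<close>

lemma orbifold_quotient_identity:
  fixes a d A :: nat
  assumes "a dvd A" "1 \<le> a" "1 \<le> d" "1 \<le> A"
  shows "A div a = (A div gcd A d) div (a div gcd a d) * gcd (d div gcd a d) (A div a)"
proof -
  define G where "G = gcd a d"
  obtain a' d' where ad: "a = G * a'" "d = G * d'" "coprime a' d'"
    using gcd_coprime_exists[of a d] assms(2) unfolding G_def by (metis gcd_eq_0_iff mult.commute not_one_le_zero)
  obtain B where B: "A = a * B" using assms(1) by blast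
  have pos: "0 < G" "0 < a'" "0 < d'" "0 < B" using assms ad B by (auto intro!: Nat.gr0I)
  have "gcd A d = G * gcd (a' * B) d'"
    unfolding B ad(1,2) by (metis gcd_mult_distrib_nat mult.assoc)
  also have "gcd (a' * B) d' = gcd B d'" using ad(3) by (simp add: gcd_mult_left_left_cancel coprime_commute)
  finally have g: "gcd A d = G * gcd B d'" .
  have "A div gcd A d = a' * B div gcd B d'"
    unfolding g unfolding B ad(1) using pos by (simp add: mult.assoc)
  also have "\<dots> = a' * (B div gcd B d')" by (simp add: div_mult_swap mult.commute)
  finally have 1: "A div gcd A d = a' * (B div gcd B d')" .
  have 2: "a div gcd a d = a'" "d div gcd a d = d'" "A div a = B"
    using pos ad assms(2) B unfolding G_def[symmetric] by auto
  show ?thesis unfolding 1 2 using pos by (simp add: gcd.commute)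
qed

lemma image_mset_mset_set_eq_sum: "finite S \<Longrightarrow> image_mset h (mset_set S) = (\<Sum>x\<in>S. {#h x#})"
  by (induction S rule: finite_induct) auto

lemma sum_singleton_mset_const: "finite S \<Longrightarrow> (\<Sum>x\<in>S. {#c#}) = replicate_mset (card S) c"
  by (induction S rule: finite_induct) auto

lemma partition_power_image:
  assumes "finite S" "1 \<le> d"
  shows "partition_power (image_mset h (mset_set S)) d
    = (\<Sum>b\<in>S. replicate_mset (gcd (h b) d) (h b div gcd (h b) d))"
  unfolding partition_power_def using assms
  by (simp add: image_mset.compositionality comp_def lcm_div_eq sum_unfold_sum_mset)

section \<open>The fibre of p grouped by the values of q\<close>

context charted_square begin

context
  assumes ncf: "no_common_right_factor R C1 C2 p q"
    and deg_eq: "global_degree R C1 p = global_degree C2 C g"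
begin

lemma degrees_reduced:
  assumes "x \<in> points R" shows "deg_p x = al x" "deg_q x = be x"
  using degrees(1,2)[OF assms] no_common_factor_imp_injective(1)[OF ncf assms] by simp_all

text \<open>Classes are singletons, so points over \<open>(z, b)\<close> have distinct
  \<open>om\<close>, hence distinct \<open>al\<close>-th powers of it; these are roots of unity of
  order dividing the gcd.\<close>

lemma fiber_pairs:
  assumes z: "z \<in> points C1" and b: "b \<in> fiber C2 g (f z)"
  shows "finite {x \<in> fiber R p z. q x = b}"
    "card {x \<in> fiber R p z. q x = b} \<le> gcd (deg_g b) (deg_f z)"
proof -
  let ?X = "{x \<in> fiber R p z. q x = b}" and ?a = "deg_g b div gcd (deg_g b) (deg_f z)"
  let ?G = "gcd (deg_g b) (deg_f z)"
  show fin: "finite ?X" using finite_fiber[OF p surfaces(5) z] by simp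
  have X: "x \<in> points R" "p x = z" "q x = b" if "x \<in> ?X" for x using that by (auto simp: fiber_def)
  have inj: "inj_on (\<lambda>x. om x ^ ?a) ?X"
  proof (rule inj_onI)
    fix x x' assume x: "x \<in> ?X" "x' \<in> ?X" "om x ^ ?a = om x' ^ ?a"
    have "om x = some_root ?a (om x ^ ?a)" "om x' = some_root ?a (om x' ^ ?a)"
      using U(5)[OF X(1)[OF x(1)]] U(5)[OF X(1)[OF x(2)]] X[OF x(1)] X[OF x(2)] by simp_all
    then have "om x = om x'" using x(3) by metis
    then have "eqv x' x" using X[OF x(1)] X[OF x(2)] by (simp add: eqv_iff_om)
    then show "x = x'" by (rule no_common_factor_imp_injective(2)[OF ncf X(1)[OF x(2)]])
  qed
  have im: "(\<lambda>x. om x ^ ?a) ` ?X \<subseteq> {\<tau>. \<tau> ^ ?G = 1}"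
  proof clarify
    fix x assume x: "x \<in> fiber R p z" "b = q x"
    then have "om x ^ deg_g b = 1" using U(6)[of x] by (simp add: fiber_def)
    then show "(om x ^ (deg_g (q x) div gcd (deg_g (q x)) (deg_f z))) ^ gcd (deg_g (q x)) (deg_f z) = 1"
      using x(2) by (simp flip: power_mult)
  qed
  have "1 \<le> deg_f z" by (rule local_degree_ge_1[OF f z])
  then have G: "1 \<le> ?G" by (simp add: Suc_leI)
  have "card ?X = card ((\<lambda>x. om x ^ ?a) ` ?X)" by (rule card_image[OF inj, symmetric])
  also have "\<dots> \<le> card {\<tau>::complex. \<tau> ^ ?G = 1}" by (rule card_mono[OF card_nth_roots_le(1)[OF G] im])
  also have "\<dots> \<le> ?G" by (rule card_nth_roots_le(2)[OF G])
  finally show "card ?X \<le> ?G" .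
qed

text \<open>Over each \<open>b\<close> the points contribute at most \<open>deg_g b\<close> to \<open>deg p\<close>; as \<open>deg p = deg g\<close>, all
  these bounds are attained.\<close>

lemma fiber_pairs_card:
  assumes z: "z \<in> points C1" and b: "b \<in> fiber C2 g (f z)"
  shows "card {x \<in> fiber R p z. q x = b} = gcd (deg_g b) (deg_f z)"
proof -
  let ?X = "\<lambda>b. {x \<in> fiber R p z. q x = b}" and ?G = "\<lambda>b. gcd (deg_g b) (deg_f z)"
  let ?F = "fiber C2 g (f z)"
  have finF: "finite ?F" by (rule finite_fiber[OF g surfaces(7) f_points[OF z]])
  have finP: "finite (fiber R p z)" by (rule finite_fiber[OF p surfaces(5) z])
  have qF: "q ` fiber R p z \<subseteq> ?F" using q_points comm by (auto simp: fiber_def)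
  have "(\<Sum>b\<in>?F. card (?X b) * (deg_g b div ?G b)) = (\<Sum>b\<in>?F. \<Sum>x\<in>?X b. deg_p x)"
  proof (rule sum.cong[OF refl])
    fix b
    have "deg_p x = deg_g b div ?G b" if "x \<in> ?X b" for x
      using that degrees_reduced(1)[of x] by (auto simp: fiber_def)
    then show "card (?X b) * (deg_g b div ?G b) = (\<Sum>x\<in>?X b. deg_p x)" by simp
  qed
  also have "\<dots> = (\<Sum>x\<in>fiber R p z. deg_p x)" by (rule sum.group[OF finP finF qF])
  also have "\<dots> = global_degree R C1 p" by (rule sum_local_degree[OF p surfaces(5) z])
  also have "\<dots> = (\<Sum>b\<in>?F. deg_g b)"
    using deg_eq sum_local_degree[OF g surfaces(7) f_points[OF z]] by simp
  also have "\<dots> = (\<Sum>b\<in>?F. ?G b * (deg_g b div ?G b))" by simp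
  \<comment> \<open>The two totals are sums of termwise comparable numbers over a finite fibre, so
    equality holds in each term.\<close>
  finally have eq: "card (?X b) * (deg_g b div ?G b) = ?G b * (deg_g b div ?G b)"
    by (rule sum_mono_inv[OF _ _ b finF]) (intro mult_right_mono fiber_pairs(2)[OF z], simp_all)
  have "1 \<le> deg_g b" using local_degree_ge_1[OF g] b by (simp add: fiber_def)
  then have nz: "deg_g b div ?G b \<noteq> 0"
    by (metis dvd_div_eq_0_iff gcd_dvd1 not_one_le_zero)
  show ?thesis using mult_cancel2[THEN iffD1, OF eq] nz by blast
qed

text \<open>Grouped by the value of \<open>q\<close>, the fibre contributes over each
  \<open>b\<close> exactly \<open>gcd a d\<close> copies of
  \<open>a div gcd a d = lcm a d div d\<close>, where \<open>a = deg_g b\<close> and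
  \<open>d = deg_f z\<close>.\<close>

lemma partition_p:
  assumes z: "z \<in> points C1"
  shows "local_degrees R C1 p z = partition_power (local_degrees C2 C g (f z)) (deg_f z)"
proof -
  let ?X = "\<lambda>b. {x \<in> fiber R p z. q x = b}" and ?G = "\<lambda>b. gcd (deg_g b) (deg_f z)"
  let ?F = "fiber C2 g (f z)"
  have finF: "finite ?F" by (rule finite_fiber[OF g surfaces(7) f_points[OF z]])
  have finP: "finite (fiber R p z)" by (rule finite_fiber[OF p surfaces(5) z])
  have qF: "q ` fiber R p z \<subseteq> ?F" using q_points comm by (auto simp: fiber_def)
  have "local_degrees R C1 p z = (\<Sum>x\<in>fiber R p z. {#deg_p x#})"
    unfolding local_degrees_def by (rule image_mset_mset_set_eq_sum[OF finP])
  also have "\<dots> = (\<Sum>b\<in>?F. \<Sum>x\<in>?X b. {#deg_p x#})" by (rule sum.group[OF finP finF qF, symmetric])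
  also have "\<dots> = (\<Sum>b\<in>?F. replicate_mset (?G b) (deg_g b div ?G b))"
  proof (rule sum.cong[OF refl])
    fix b assume b: "b \<in> ?F"
    have "(\<Sum>x\<in>?X b. {#deg_p x#}) = (\<Sum>x\<in>?X b. {#deg_g b div ?G b#})"
      by (rule sum.cong[OF refl]) (auto simp: fiber_def degrees_reduced(1))
    then show "(\<Sum>x\<in>?X b. {#deg_p x#}) = replicate_mset (?G b) (deg_g b div ?G b)"
      using sum_singleton_mset_const[OF fiber_pairs(1)[OF z b]] fiber_pairs_card[OF z b] by simp
  qed
  also have "\<dots> = partition_power (local_degrees C2 C g (f z)) (deg_f z)"
    unfolding local_degrees_def
    by (rule partition_power_image[OF finF local_degree_ge_1[OF f z], symmetric])
  finally show ?thesis .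
qed

abbreviation "nu_p z \<equiv> Lcm (deg_p ` fiber R p z)"
abbreviation "nu_g y \<equiv> Lcm (deg_g ` fiber C2 g y)"

text \<open>The local degrees of \<open>p\<close> over \<open>z\<close> are the numbers
  \<open>lcm a d div d\<close> for the local degrees \<open>a\<close> of \<open>g\<close> over
  \<open>f z\<close>, with \<open>d = deg_f z\<close>, and this operation commutes with the least
  common multiple.\<close>

lemma nu_p_eq:
  assumes z: "z \<in> points C1" shows "nu_p z = nu_g (f z) div gcd (nu_g (f z)) (deg_f z)"
proof -
  let ?F = "fiber C2 g (f z)"
  have d: "1 \<le> deg_f z" by (rule local_degree_ge_1[OF f z])
  have finF: "finite ?F" by (rule finite_fiber[OF g surfaces(7) f_points[OF z]])
  have "deg_p ` fiber R p z = (\<lambda>a. lcm a (deg_f z) div deg_f z) ` deg_g ` ?F"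
  proof (intro equalityI subsetI)
    fix e assume "e \<in> deg_p ` fiber R p z"
    then obtain x where x: "x \<in> points R" "p x = z" "e = deg_p x" by (auto simp: fiber_def)
    then have "e = lcm (deg_g (q x)) (deg_f z) div deg_f z"
      using degrees_reduced(1)[OF x(1)] lcm_div_eq[OF d] by simp
    moreover have "q x \<in> ?F" using q_points comm x by (auto simp: fiber_def)
    ultimately show "e \<in> (\<lambda>a. lcm a (deg_f z) div deg_f z) ` deg_g ` ?F" by blast
  next
    fix e assume "e \<in> (\<lambda>a. lcm a (deg_f z) div deg_f z) ` deg_g ` ?F"
    then obtain b where b: "b \<in> ?F" "e = deg_g b div gcd (deg_g b) (deg_f z)" using lcm_div_eq[OF d] by auto
    \<comment> \<open>The exact count guarantees a preimage over every \<open>b\<close>, so no local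
      degree of \<open>g\<close> is missed.\<close>
    have "card {x \<in> fiber R p z. q x = b} \<noteq> 0" using fiber_pairs_card[OF z b(1)] d by simp
    then obtain x where "x \<in> fiber R p z" "q x = b" by (auto simp: card_eq_0_iff)
    then have "e = deg_p x" using degrees_reduced(1)[of x] b(2) by (auto simp: fiber_def)
    then show "e \<in> deg_p ` fiber R p z" using \<open>x \<in> fiber R p z\<close> by blast
  qed
  then have "nu_p z = lcm (nu_g (f z)) (deg_f z) div deg_f z"
    using Lcm_lcm_div[OF finite_imageI[OF finF] d] by simp
  then show ?thesis using lcm_div_eq[OF d] by simp
qed

end

end

section \<open>Orbifold structures attached to a branched covering\<close>

lemma derived_set_of_finite_surface:
  assumes "is_surface S" "finite F" shows "surf_top S derived_set_of F = {}"
proof -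
  have "t1_space (surf_top S)"
    using assms(1) Hausdorff_imp_t1_space unfolding is_surface_def by blast
  then show ?thesis using assms(2) t1_space_derived_set_of_finite by blast
qed

context
  fixes R :: "'a surface" and C :: "'b surface" and f :: "'a \<Rightarrow> 'b"
  assumes br: "branched_covering R C f" and R: "closed_surface R"
begin

lemma compact_R: "compact_space (surf_top R)" using R by (simp add: closed_surface_def)

lemma Lcm_local_degrees_pos:
  assumes "y \<in> points C" shows "1 \<le> Lcm (local_degree R C f ` fiber R f y)"
proof -
  have "0 \<notin> local_degree R C f ` fiber R f y"
    using local_degree_ge_1[OF br] by (fastforce simp: fiber_def)
  then have "Lcm (local_degree R C f ` fiber R f y) \<noteq> 0"
    using finite_fiber[OF br compact_R assms] by (simp add: Lcm_0_iff)
  then show ?thesis by linarith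
qed

text \<open>Exceptional points lie under the finitely many ramified ones, hence cannot
  accumulate.\<close>

lemma finite_Lcm_ramified:
  "finite {y \<in> points C. Lcm (local_degree R C f ` fiber R f y) \<noteq> 1}"
proof (rule finite_subset)
  show "finite (f ` {x \<in> points R. local_degree R C f x \<noteq> 1})"
    using finite_ramification[OF br compact_R] by simp
  show "{y \<in> points C. Lcm (local_degree R C f ` fiber R f y) \<noteq> 1}
      \<subseteq> f ` {x \<in> points R. local_degree R C f x \<noteq> 1}"
  proof
    fix y assume y: "y \<in> {y \<in> points C. Lcm (local_degree R C f ` fiber R f y) \<noteq> 1}"
    have "\<not> local_degree R C f ` fiber R f y \<subseteq> {1}"
    proof
      assume "local_degree R C f ` fiber R f y \<subseteq> {1}"
      then have "Lcm (local_degree R C f ` fiber R f y) dvd 1" by (intro Lcm_least) auto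
      then show False using y by simp
    qed
    then show "y \<in> f ` {x \<in> points R. local_degree R C f x \<noteq> 1}" by (auto simp: fiber_def)
  qed
qed

lemma is_orbifold_orbi2: "is_orbifold (orbi2 R C f)"
  unfolding is_orbifold_def orbi2_def
  using branched_covering_surfaces(2)[OF br] Lcm_local_degrees_pos
    derived_set_of_finite_surface[OF _ finite_Lcm_ramified] by simp

lemma is_orbifold_orbi1: "is_orbifold (orbi1 R C f)"
proof -
  let ?L = "\<lambda>y. Lcm (local_degree R C f ` fiber R f y)" and ?d = "local_degree R C f"
  have dvd: "?d x dvd ?L (f x)" if "x \<in> points R" for x
    using that by (intro dvd_Lcm) (simp add: fiber_def)
  have "1 \<le> ?L (f x) div ?d x" if x: "x \<in> points R" for x
  proof -
    have "?L (f x) \<noteq> 0"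
      using Lcm_local_degrees_pos[OF branched_covering_surfaces(4)[OF br x]] by linarith
    then have "?L (f x) div ?d x \<noteq> 0" using dvd[OF x] by (metis dvd_div_eq_0_iff)
    then show ?thesis by linarith
  qed
  moreover have "finite {x \<in> points R. ?L (f x) div ?d x \<noteq> 1}"
  proof (rule finite_subset)
    let ?Y = "{y \<in> points C. ?L y \<noteq> 1}"
    show "finite (\<Union>y\<in>?Y. fiber R f y)"
      using finite_Lcm_ramified finite_fiber[OF br compact_R] by blast
    show "{x \<in> points R. ?L (f x) div ?d x \<noteq> 1} \<subseteq> (\<Union>y\<in>?Y. fiber R f y)"
    proof
      fix x assume x: "x \<in> {x \<in> points R. ?L (f x) div ?d x \<noteq> 1}"
      have "?L (f x) \<noteq> 1"
      proof
        assume L: "?L (f x) = 1"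
        then have "?d x = 1" using dvd[of x] x by simp
        then show False using x L by simp
      qed
      then show "x \<in> (\<Union>y\<in>?Y. fiber R f y)"
        using x branched_covering_surfaces(4)[OF br] by (auto simp: fiber_def)
    qed
  qed
  ultimately show ?thesis
    unfolding is_orbifold_def orbi1_def orbi2_def
    using branched_covering_surfaces(1)[OF br]
      derived_set_of_finite_surface[OF branched_covering_surfaces(1)[OF br]] by simp
qed

end

theorem theorem1p1:
  fixes R :: "'a surface" and C1 :: "'b surface" and C2 :: "'c surface" and C :: "'d surface"
    and p :: "'a \<Rightarrow> 'b" and q :: "'a \<Rightarrow> 'c" and f :: "'b \<Rightarrow> 'd" and g :: "'c \<Rightarrow> 'd"
  assumes "closed_surface R" and "closed_surface C1"
    and "closed_surface C2" and "closed_surface C"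
    and "branched_covering R C1 p" and "branched_covering R C2 q"
    and "branched_covering C1 C f" and "branched_covering C2 C g"
    and "global_degree C1 C f \<ge> 2"
    and "\<forall>x\<in>points R. f (p x) = g (q x)"
    and "no_common_right_factor R C1 C2 p q"
    and "global_degree R C1 p = global_degree C2 C g"
  shows "(\<forall>z\<in>points C1. local_degrees R C1 p z =
            partition_power (local_degrees C2 C g (f z)) (local_degree C1 C f z)) \<and>
         minimal_holomorphic_map (orbi2 R C1 p) (orbi2 C2 C g) f \<and>
         minimal_holomorphic_map (orbi1 R C1 p) (orbi1 C2 C g) q"
proof -
  interpret branched_square R C1 C2 C p q f g
    by unfold_locales (use assms in auto)
  obtain V A \<phi>1 B \<phi>2 U \<phi> om where "charted_square R C1 C2 C p q f g V A \<phi>1 B \<phi>2 U \<phi> om"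
    using ex_charted_square by blast
  then interpret charted_square R C1 C2 C p q f g V A \<phi>1 B \<phi>2 U \<phi> om .
  note hyps = assms(11,12)
  have "minimal_holomorphic_map (orbi2 R C1 p) (orbi2 C2 C g) f"
    unfolding minimal_holomorphic_map_def
  proof (intro conjI is_orbifold_orbi2 p g closed)
    have "nu_g (f z) = nu_p z * gcd (deg_f z) (nu_g (f z))" if z: "z \<in> points C1" for z
      using nu_p_eq[OF hyps z] by (simp add: gcd.commute)
    then show "case (orbi2 R C1 p, orbi2 C2 C g) of ((R1, \<nu>1), (R2, \<nu>2)) \<Rightarrow>
        branched_covering R1 R2 f \<and>
        (\<forall>z\<in>points R1. \<nu>2 (f z) = \<nu>1 z * gcd (local_degree R1 R2 f z) (\<nu>2 (f z)))"
      using f by (simp add: orbi2_def)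
  qed
  moreover have "minimal_holomorphic_map (orbi1 R C1 p) (orbi1 C2 C g) q"
    unfolding minimal_holomorphic_map_def
  proof (intro conjI is_orbifold_orbi1 p g closed)
    have "nu_g (g (q x)) div deg_g (q x) =
        nu_p (p x) div deg_p x * gcd (deg_q x) (nu_g (g (q x)) div deg_g (q x))"
      if x: "x \<in> points R" for x
    proof -
      have y: "g (q x) = f (p x)" using comm[OF x] by simp
      have "deg_g (q x) dvd nu_g (f (p x))"
        using fiberI(4)[OF x] by (intro dvd_Lcm) blast
      moreover have "1 \<le> nu_g (f (p x))"
        by (rule Lcm_local_degrees_pos[OF g closed(3) h_points[OF x]])
      \<comment> \<open>With \<open>a = deg_g (q x)\<close> and \<open>d = deg_f (p x)\<close>, the
        reduced degrees \<open>deg_p x\<close> and \<open>deg_q x\<close> are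
        \<open>a div gcd a d\<close> and \<open>d div gcd a d\<close>, which is the shape of
        \<open>orbifold_quotient_identity\<close>.\<close>
      ultimately show ?thesis
        unfolding y nu_p_eq[OF hyps p_points[OF x]] degrees_reduced[OF hyps x]
        by (intro orbifold_quotient_identity degrees_ge_1[OF x])
    qed
    then show "case (orbi1 R C1 p, orbi1 C2 C g) of ((R1, \<nu>1), (R2, \<nu>2)) \<Rightarrow>
        branched_covering R1 R2 q \<and>
        (\<forall>z\<in>points R1. \<nu>2 (q z) = \<nu>1 z * gcd (local_degree R1 R2 q z) (\<nu>2 (q z)))"
      using q by (simp add: orbi1_def orbi2_def)
  qed
  ultimately show ?thesis using partition_p[OF hyps] by blast
qed

end
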